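(* Let $X$ be a smooth manifold, $I\subset\mathbb R$ an open interval, $h:I\times X\to(0,\infty)$ continuous, and let $\{g_s\}_{s\in I}$ be a family of Riemannian metrics on $X$ such that the local coordinate representations $(s,p)\mapsto (g_s)_{ij}(p)$ are continuous in $(s,p)$. Let $\mathcal F=\{d_{g_s}\}_{s\in I}$, where $d_{g_s}$ is the length metric on $X$ associated to $g_s$. Then the generalized Lorentzian product $hI\times_{\mathcal F}X$ is the Lorentzian length structure induced by the continuous Lorentzian metric $g:=-h^2\,\mathrm ds^2+g_s$ on $I\times X$. (That is, both structures have the same future/past directed causal curves and timelike curves, the same Lorentzian length of causal curves, and hence the same relations $\le,\ll$ and the same time separation function.)
   Context: Generalized Lorentzian product. Let $X$ be a locally compact topological space, $I\subset\mathbb R$ an open interval, $h:I\times X\to(0,\infty)$ continuous, and $\mathcal F=\{d_s\}_{s\in I}$ a family of metrics on $X$ whose induced length metrics generate the topology of $X$. It is defined whenever: for all compact $J\subset I$, $K\subset X$ there are $r>0$ and a modulus of continuity $\omega$ with $\big|\log\frac{d_s(x,y)}{d_{s'}(x,y)}\big|\le\omega(|s-s'|)$ for $s,s'\in J$ and distinct $x,y\in K$ with $\inf_{s\in J}d_s(x,y)<r$. Then absolute continuity of a curve $\beta:[a,b]\to X$ does not depend on the chosen metric in $\mathcal F$. For an absolutely continuous $\beta:[a,b]\to X$ let $|\beta_t'|_{d_s}$ be its metric speed with respect to $d_s$, and define the generalized metric speed $v_\beta(s,t)=\limsup_{\delta\to0}\frac1\delta\int_t^{t+\delta}|\beta_u'|_{d_s}\,\mathrm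 du$. For an absolutely continuous curve $\gamma=(\alpha,\beta):[a,b]\to I\times X$ put $|\tau_\gamma'|^2(t)=h(\gamma_t)^2\alpha'(t)^2-v_\beta(\alpha_t,t)^2$. The curve is future (past) directed if $\alpha'>0$ ($\alpha'<0$) a.e.; a future or past directed curve is causal if $|\tau_\gamma'|^2\ge0$ a.e. and timelike if $|\tau_\gamma'|^2>0$ a.e. The Lorentzian length of a causal curve is $\tau(\gamma)=\int_a^b\sqrt{|\tau_\gamma'|^2(t)}\,\mathrm dt$. Write $p\le q$ (resp. $p\ll q$) if there is a future directed causal (resp. timelike) curve from $p$ to $q$ ($\le$ is a preorder, so $p\le p$ always), and $\tau(p,q)=\sup\tau(\gamma)$ over future directed causal curves $\gamma$ from $p$ to $q$, with $\sup\varnothing=0$. The collection $(I\times X,\le,\ll,\tau)$ with these curves and length is denoted $hI\times_{\mathcal F}X$. The Lorentzian length structure induced by $g$: absolutely continuous curves $\gamma=(\alpha,\beta)$ in $I\times X$ with $\alpha'>0$ a.e. (future) or $\alpha'<0$ a.e. (past) are causal if $g(\gamma_t',\gamma_t')\le0$ a.e., timelike if $g(\gamma_t',\gamma_t')<0$ a.e., with length $\int\sqrt{-g(\gamma_t',\gamma_t')}\,\mathrm dt$; the relations and time separation are defined from these as follows: $p\le_g q$ (resp. $p\ll_g q$) if there is a future directed curve from $p$ to $q$ that is causal (resp. timelike) with respect to $g$ ($\le_g$ is a preorder, so $p\le_g p$ always), and $\tau_g(p,q)=\sup\int\sqrt{-g(\gamma_t',\gamma_t')}\,\mathrm dt$ over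 future directed $g$-causal curves $\gamma$ from $p$ to $q$, with $\sup\varnothing=0$. *)

theory Defs
  imports "HOL-Analysis.Analysis"
begin

section \<open>Metric notions\<close>

text \<open>Distances take values in \<^typ>\<open>ennreal\<close>: the length metric of a Riemannian metric is
  infinite between different connected components.\<close>

definition extended_metric :: "('a \<Rightarrow> 'a \<Rightarrow> ennreal) \<Rightarrow> bool" where
  "extended_metric d \<longleftrightarrow>
     (\<forall>x y. d x y = 0 \<longleftrightarrow> x = y) \<and> (\<forall>x y. d x y = d y x) \<and> (\<forall>x y z. d x z \<le> d x y + d y z)"

definition generates_topology :: "('a::topological_space \<Rightarrow> 'a \<Rightarrow> ennreal) \<Rightarrow> bool" where
  "generates_topology d \<longleftrightarrow> (\<forall>S. open S \<longleftrightarrow> (\<forall>x\<in>S. \<exists>e>0. \<forall>y. d x y < e \<longrightarrow> y \<in> S))"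

definition continuous_curve :: "('a \<Rightarrow> 'a \<Rightarrow> ennreal) \<Rightarrow> real \<Rightarrow> real \<Rightarrow> (real \<Rightarrow> 'a) \<Rightarrow> bool" where
  "continuous_curve d a b c \<longleftrightarrow> (\<forall>t\<in>{a..b}. ((\<lambda>u. d (c u) (c t)) \<longlongrightarrow> 0) (at t within {a..b}))"

definition curve_length :: "('a \<Rightarrow> 'a \<Rightarrow> ennreal) \<Rightarrow> real \<Rightarrow> real \<Rightarrow> (real \<Rightarrow> 'a) \<Rightarrow> ennreal" where
  "curve_length d a b c =
     (SUP (n, \<tau>) \<in> {(n::nat, \<tau>::nat \<Rightarrow> real). mono_on {..n} \<tau> \<and> \<tau> ` {..n} \<subseteq> {a..b}}.
        \<Sum>i<n. d (c (\<tau> i)) (c (\<tau> (Suc i))))"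

definition induced_length_metric :: "('a \<Rightarrow> 'a \<Rightarrow> ennreal) \<Rightarrow> 'a \<Rightarrow> 'a \<Rightarrow> ennreal" where
  "induced_length_metric d x y =
     (INF c \<in> {c. continuous_curve d 0 1 c \<and> c 0 = x \<and> c 1 = y}. curve_length d 0 1 c)"

definition abs_continuous :: "('a \<Rightarrow> 'a \<Rightarrow> ennreal) \<Rightarrow> real \<Rightarrow> real \<Rightarrow> (real \<Rightarrow> 'a) \<Rightarrow> bool" where
  "abs_continuous d a b c \<longleftrightarrow>
     (\<forall>e>0. \<exists>\<delta>>0. \<forall>(n::nat) (u::nat \<Rightarrow> real) (v::nat \<Rightarrow> real).
        (\<forall>i<n. a \<le> u i \<and> u i \<le> v i \<and> v i \<le> b) \<and>
        (\<forall>i<n. \<forall>j<n. i \<noteq> j \<longrightarrow> {u i<..<v i} \<inter> {u j<..<v j} = {}) \<and>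
        (\<Sum>i<n. v i - u i) < \<delta> \<longrightarrow>
        (\<Sum>i<n. d (c (u i)) (c (v i))) < e)"

definition edist :: "'a::metric_space \<Rightarrow> 'a \<Rightarrow> ennreal" where
  "edist x y = ennreal (dist x y)"

text \<open>For an absolutely continuous curve this limit exists at almost every parameter and the
  distances occurring in it are finite.\<close>

definition metric_speed :: "('a \<Rightarrow> 'a \<Rightarrow> ennreal) \<Rightarrow> real \<Rightarrow> real \<Rightarrow> (real \<Rightarrow> 'a) \<Rightarrow> real \<Rightarrow> real" where
  "metric_speed d a b c t =
     Lim (at t within {a..b}) (\<lambda>u. enn2real (d (c u) (c t)) / \<bar>u - t\<bar>)"

text \<open>The interval integral is oriented, so the average is also the right one for negative
  \<open>\<delta>\<close>.\<close>

definition gen_metric_speed :: "('a \<Rightarrow> 'a \<Rightarrow> ennreal) \<Rightarrow> real \<Rightarrow> real \<Rightarrow> (real \<Rightarrow> 'a) \<Rightarrow> real \<Rightarrow> ereal" where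
  "gen_metric_speed d a b c t =
     Limsup (at 0) (\<lambda>\<delta>. ereal (1 / \<delta> * (LINT u=t..t + \<delta>|lebesgue. metric_speed d a b c u)))"


section \<open>Curves in a product, causality\<close>

text \<open>A structure on curves in \<open>I \<times> X\<close> consists of the admissible (absolutely continuous) curves
  on an interval \<open>[a,b]\<close> and of the squared causal speed of such a curve (positive on timelike
  vectors). A curve is a function on all of \<^typ>\<open>real\<close> of which only the restriction to
  \<open>[a,b]\<close> matters.\<close>

record 'a causal_structure =
  curve :: "real \<Rightarrow> real \<Rightarrow> (real \<Rightarrow> real \<times> 'a) \<Rightarrow> bool"
  speed_sq :: "real \<Rightarrow> real \<Rightarrow> (real \<Rightarrow> real \<times> 'a) \<Rightarrow> real \<Rightarrow> ereal"

definition future_directed :: "real \<Rightarrow> real \<Rightarrow> (real \<Rightarrow> real \<times> 'a) \<Rightarrow> bool" where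
  "future_directed a b \<gamma> \<longleftrightarrow> (AE t in lebesgue_on {a..b}. deriv (fst \<circ> \<gamma>) t > 0)"

definition past_directed :: "real \<Rightarrow> real \<Rightarrow> (real \<Rightarrow> real \<times> 'a) \<Rightarrow> bool" where
  "past_directed a b \<gamma> \<longleftrightarrow> (AE t in lebesgue_on {a..b}. deriv (fst \<circ> \<gamma>) t < 0)"

definition future_causal :: "'a causal_structure \<Rightarrow> real \<Rightarrow> real \<Rightarrow> (real \<Rightarrow> real \<times> 'a) \<Rightarrow> bool" where
  "future_causal S a b \<gamma> \<longleftrightarrow> curve S a b \<gamma> \<and> future_directed a b \<gamma> \<and>
     (AE t in lebesgue_on {a..b}. speed_sq S a b \<gamma> t \<ge> 0)"

definition past_causal :: "'a causal_structure \<Rightarrow> real \<Rightarrow> real \<Rightarrow> (real \<Rightarrow> real \<times> 'a) \<Rightarrow> bool" where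
  "past_causal S a b \<gamma> \<longleftrightarrow> curve S a b \<gamma> \<and> past_directed a b \<gamma> \<and>
     (AE t in lebesgue_on {a..b}. speed_sq S a b \<gamma> t \<ge> 0)"

definition future_timelike :: "'a causal_structure \<Rightarrow> real \<Rightarrow> real \<Rightarrow> (real \<Rightarrow> real \<times> 'a) \<Rightarrow> bool" where
  "future_timelike S a b \<gamma> \<longleftrightarrow> curve S a b \<gamma> \<and> future_directed a b \<gamma> \<and>
     (AE t in lebesgue_on {a..b}. speed_sq S a b \<gamma> t > 0)"

definition past_timelike :: "'a causal_structure \<Rightarrow> real \<Rightarrow> real \<Rightarrow> (real \<Rightarrow> real \<times> 'a) \<Rightarrow> bool" where
  "past_timelike S a b \<gamma> \<longleftrightarrow> curve S a b \<gamma> \<and> past_directed a b \<gamma> \<and>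
     (AE t in lebesgue_on {a..b}. speed_sq S a b \<gamma> t > 0)"

text \<open>For causal curves the squared speed is finite almost everywhere, so \<^const>\<open>real_of_ereal\<close>
  loses nothing.\<close>

definition lorentzian_length :: "'a causal_structure \<Rightarrow> real \<Rightarrow> real \<Rightarrow> (real \<Rightarrow> real \<times> 'a) \<Rightarrow> ennreal" where
  "lorentzian_length S a b \<gamma> =
     (\<integral>\<^sup>+ t. ennreal (sqrt (real_of_ereal (speed_sq S a b \<gamma> t))) \<partial>lebesgue_on {a..b})"

definition causal_le :: "'a causal_structure \<Rightarrow> real \<times> 'a \<Rightarrow> real \<times> 'a \<Rightarrow> bool" where
  "causal_le S p q \<longleftrightarrow> p = q \<or> (\<exists>a b \<gamma>. future_causal S a b \<gamma> \<and> \<gamma> a = p \<and> \<gamma> b = q)"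

definition timelike_ll :: "'a causal_structure \<Rightarrow> real \<times> 'a \<Rightarrow> real \<times> 'a \<Rightarrow> bool" where
  "timelike_ll S p q \<longleftrightarrow> (\<exists>a b \<gamma>. future_timelike S a b \<gamma> \<and> \<gamma> a = p \<and> \<gamma> b = q)"

text \<open>In \<^typ>\<open>ennreal\<close> the supremum of the empty set is 0.\<close>

definition time_separation :: "'a causal_structure \<Rightarrow> real \<times> 'a \<Rightarrow> real \<times> 'a \<Rightarrow> ennreal" where
  "time_separation S p q =
     (SUP (a, b, \<gamma>) \<in> {(a, b, \<gamma>). future_causal S a b \<gamma> \<and> \<gamma> a = p \<and> \<gamma> b = q}.
        lorentzian_length S a b \<gamma>)"


section \<open>Generalized Lorentzian products\<close>

definition modulus_of_continuity :: "(real \<Rightarrow> real) \<Rightarrow> bool" where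
  "modulus_of_continuity \<omega> \<longleftrightarrow> \<omega> 0 = 0 \<and> mono_on {0..} \<omega> \<and> (\<omega> \<longlongrightarrow> 0) (at_right 0)"

text \<open>Finiteness of both distances is stated separately since \<^const>\<open>enn2real\<close> sends \<open>\<infinity>\<close> to 0.\<close>

definition product_defined ::
    "real set \<Rightarrow> (real \<times> 'a::topological_space \<Rightarrow> real) \<Rightarrow> (real \<Rightarrow> 'a \<Rightarrow> 'a \<Rightarrow> ennreal) \<Rightarrow> bool" where
  "product_defined I h F \<longleftrightarrow>
     locally_compact_space (euclidean :: 'a topology) \<and>
     open I \<and> is_interval I \<and>
     continuous_on (I \<times> UNIV) h \<and> (\<forall>z\<in>I \<times> UNIV. h z > 0) \<and>
     (\<forall>s\<in>I. extended_metric (F s) \<and> generates_topology (induced_length_metric (F s))) \<and>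
     (\<forall>J K. compact J \<and> J \<subseteq> I \<and> compact K \<longrightarrow>
        (\<exists>r>0::real. \<exists>\<omega>. modulus_of_continuity \<omega> \<and>
           (\<forall>s\<in>J. \<forall>s'\<in>J. \<forall>x\<in>K. \<forall>y\<in>K. x \<noteq> y \<and> (INF \<sigma>\<in>J. F \<sigma> x y) < ennreal r \<longrightarrow>
              F s x y < \<infinity> \<and> F s' x y < \<infinity> \<and>
              \<bar>ln (enn2real (F s x y) / enn2real (F s' x y))\<bar> \<le> \<omega> \<bar>s - s'\<bar>)))"

text \<open>When the product is defined, absolute continuity of the second component does not depend on
  the choice of \<open>s \<in> I\<close>.\<close>

definition product_curve ::
    "real set \<Rightarrow> (real \<Rightarrow> 'a \<Rightarrow> 'a \<Rightarrow> ennreal) \<Rightarrow> real \<Rightarrow> real \<Rightarrow> (real \<Rightarrow> real \<times> 'a) \<Rightarrow> bool" where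
  "product_curve I F a b \<gamma> \<longleftrightarrow>
     a < b \<and> \<gamma> ` {a..b} \<subseteq> I \<times> UNIV \<and>
     abs_continuous edist a b (fst \<circ> \<gamma>) \<and> (\<forall>s\<in>I. abs_continuous (F s) a b (snd \<circ> \<gamma>))"

definition product_speed_sq ::
    "(real \<times> 'a \<Rightarrow> real) \<Rightarrow> (real \<Rightarrow> 'a \<Rightarrow> 'a \<Rightarrow> ennreal) \<Rightarrow>
      real \<Rightarrow> real \<Rightarrow> (real \<Rightarrow> real \<times> 'a) \<Rightarrow> real \<Rightarrow> ereal" where
  "product_speed_sq h F a b \<gamma> t =
     ereal ((h (\<gamma> t))\<^sup>2 * (deriv (fst \<circ> \<gamma>) t)\<^sup>2)
       - (gen_metric_speed (F (fst (\<gamma> t))) a b (snd \<circ> \<gamma>) t)\<^sup>2"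

definition generalized_product ::
    "real set \<Rightarrow> (real \<times> 'a \<Rightarrow> real) \<Rightarrow> (real \<Rightarrow> 'a \<Rightarrow> 'a \<Rightarrow> ennreal) \<Rightarrow> 'a causal_structure" where
  "generalized_product I h F = \<lparr>curve = product_curve I F, speed_sq = product_speed_sq h F\<rparr>"


section \<open>Smooth manifolds\<close>

primrec Ck_on :: "nat \<Rightarrow> ('a::real_normed_vector \<Rightarrow> 'b::real_normed_vector) \<Rightarrow> 'a set \<Rightarrow> bool" where
  "Ck_on 0 f S \<longleftrightarrow> continuous_on S f"
| "Ck_on (Suc k) f S \<longleftrightarrow>
     (\<forall>x\<in>S. f differentiable (at x)) \<and> (\<forall>v. Ck_on k (\<lambda>x. frechet_derivative f (at x) v) S)"

definition smooth_on :: "('a::real_normed_vector \<Rightarrow> 'b::real_normed_vector) \<Rightarrow> 'a set \<Rightarrow> bool" where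
  "smooth_on f S \<longleftrightarrow> (\<forall>k. Ck_on k f S)"

text \<open>A chart is a pair of its domain and its coordinate map, the latter being relevant only on
  the domain. The manifold is the whole type \<open>'a\<close>, with a smooth atlas that need not be maximal.\<close>

type_synonym ('a, 'e) chart = "'a set \<times> ('a \<Rightarrow> 'e)"

definition transition :: "('a, 'e) chart \<Rightarrow> ('a, 'e) chart \<Rightarrow> 'e \<Rightarrow> 'e" where
  "transition c c' = snd c' \<circ> inv_into (fst c) (snd c)"

definition smooth_atlas ::
    "('a::{t2_space,second_countable_topology}, 'e::euclidean_space) chart set \<Rightarrow> bool" where
  "smooth_atlas A \<longleftrightarrow>
     (\<Union>c\<in>A. fst c) = UNIV \<and>
     (\<forall>c\<in>A. open (fst c) \<and> open (snd c ` fst c) \<and>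
        (\<exists>\<psi>. homeomorphism (fst c) (snd c ` fst c) (snd c) \<psi>)) \<and>
     (\<forall>c\<in>A. \<forall>c'\<in>A. smooth_on (transition c c') (snd c ` (fst c \<inter> fst c')))"

text \<open>A tangent vector at \<open>p\<close> assigns to every chart around \<open>p\<close> a coordinate vector, subject to the
  usual transformation law; it is set to 0 on all other arguments.\<close>

type_synonym ('a, 'e) tangent = "('a, 'e) chart \<Rightarrow> 'e"

definition coord_change ::
    "'a \<Rightarrow> ('a, 'e::euclidean_space) chart \<Rightarrow> ('a, 'e) chart \<Rightarrow> 'e \<Rightarrow> 'e" where
  "coord_change p c c' = frechet_derivative (transition c c') (at (snd c p))"

definition tangent_space ::
    "('a, 'e::euclidean_space) chart set \<Rightarrow> 'a \<Rightarrow> ('a, 'e) tangent set" where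
  "tangent_space A p = {v.
     (\<forall>c. \<not> (c \<in> A \<and> p \<in> fst c) \<longrightarrow> v c = 0) \<and>
     (\<forall>c\<in>A. \<forall>c'\<in>A. p \<in> fst c \<inter> fst c' \<longrightarrow> v c' = coord_change p c c' (v c))}"

definition coord_vector ::
    "('a, 'e::euclidean_space) chart set \<Rightarrow> 'a \<Rightarrow> ('a, 'e) chart \<Rightarrow> 'e \<Rightarrow> ('a, 'e) tangent" where
  "coord_vector A p c x = (\<lambda>c'. if c' \<in> A \<and> p \<in> fst c' then coord_change p c c' x else 0)"

definition velocity ::
    "('a, 'e::euclidean_space) chart set \<Rightarrow> (real \<Rightarrow> 'a) \<Rightarrow> real \<Rightarrow> ('a, 'e) tangent" where
  "velocity A \<beta> t =
     (\<lambda>c. if c \<in> A \<and> \<beta> t \<in> fst c then vector_derivative (snd c \<circ> \<beta>) (at t) else 0)"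

definition metric_coeff ::
    "('a, 'e::euclidean_space) chart set \<Rightarrow> ('a \<Rightarrow> ('a, 'e) tangent \<Rightarrow> ('a, 'e) tangent \<Rightarrow> real) \<Rightarrow>
      ('a, 'e) chart \<Rightarrow> 'e \<Rightarrow> 'e \<Rightarrow> 'a \<Rightarrow> real" where
  "metric_coeff A g c i j p = g p (coord_vector A p c i) (coord_vector A p c j)"

text \<open>Riemannian metrics are only required to be continuous; the value of \<open>g p\<close> matters only on
  the tangent space at \<open>p\<close>.\<close>

definition riemannian_metric ::
    "('a::topological_space, 'e::euclidean_space) chart set \<Rightarrow>
      ('a \<Rightarrow> ('a, 'e) tangent \<Rightarrow> ('a, 'e) tangent \<Rightarrow> real) \<Rightarrow> bool" where
  "riemannian_metric A g \<longleftrightarrow>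
     (\<forall>p. \<forall>u\<in>tangent_space A p. \<forall>v\<in>tangent_space A p. \<forall>w\<in>tangent_space A p. \<forall>k.
        g p v w = g p w v \<and>
        g p (\<lambda>c. k *\<^sub>R u c + v c) w = k * g p u w + g p v w \<and>
        (v \<noteq> (\<lambda>_. 0) \<longrightarrow> g p v v > 0)) \<and>
     (\<forall>c\<in>A. \<forall>i\<in>Basis. \<forall>j\<in>Basis. continuous_on (fst c) (metric_coeff A g c i j))"

definition jointly_continuous_family ::
    "('a::topological_space, 'e::euclidean_space) chart set \<Rightarrow> real set \<Rightarrow>
      (real \<Rightarrow> 'a \<Rightarrow> ('a, 'e) tangent \<Rightarrow> ('a, 'e) tangent \<Rightarrow> real) \<Rightarrow> bool" where
  "jointly_continuous_family A I g \<longleftrightarrow>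
     (\<forall>c\<in>A. \<forall>i\<in>Basis. \<forall>j\<in>Basis.
        continuous_on (I \<times> fst c) (\<lambda>(s, p). metric_coeff A (g s) c i j p))"

definition C1_curve_on ::
    "('a::topological_space, 'e::euclidean_space) chart set \<Rightarrow> real set \<Rightarrow> (real \<Rightarrow> 'a) \<Rightarrow> bool" where
  "C1_curve_on A J \<beta> \<longleftrightarrow> continuous_on J \<beta> \<and>
     (\<forall>c\<in>A. \<exists>D.
        (\<forall>t\<in>J. \<beta> t \<in> fst c \<longrightarrow> ((snd c \<circ> \<beta>) has_vector_derivative D t) (at t within J)) \<and>
        continuous_on {t\<in>J. \<beta> t \<in> fst c} D)"

definition piecewise_C1_curve ::
    "('a::topological_space, 'e::euclidean_space) chart set \<Rightarrow> (real \<Rightarrow> 'a) \<Rightarrow> bool" where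
  "piecewise_C1_curve A \<beta> \<longleftrightarrow> continuous_on {0..1} \<beta> \<and>
     (\<exists>S. finite S \<and>
        (\<forall>u v. 0 \<le> u \<and> u < v \<and> v \<le> 1 \<and> {u<..<v} \<inter> S = {} \<longrightarrow> C1_curve_on A {u..v} \<beta>))"

definition riemannian_length ::
    "('a, 'e::euclidean_space) chart set \<Rightarrow>
      ('a \<Rightarrow> ('a, 'e) tangent \<Rightarrow> ('a, 'e) tangent \<Rightarrow> real) \<Rightarrow> (real \<Rightarrow> 'a) \<Rightarrow> ennreal" where
  "riemannian_length A g \<beta> =
     (\<integral>\<^sup>+ t. ennreal (sqrt (g (\<beta> t) (velocity A \<beta> t) (velocity A \<beta> t))) \<partial>lebesgue_on {0..1})"

definition riemannian_dist ::
    "('a::topological_space, 'e::euclidean_space) chart set \<Rightarrow>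
      ('a \<Rightarrow> ('a, 'e) tangent \<Rightarrow> ('a, 'e) tangent \<Rightarrow> real) \<Rightarrow> 'a \<Rightarrow> 'a \<Rightarrow> ennreal" where
  "riemannian_dist A g x y =
     (INF \<beta> \<in> {\<beta>. piecewise_C1_curve A \<beta> \<and> \<beta> 0 = x \<and> \<beta> 1 = y}. riemannian_length A g \<beta>)"


section \<open>Lorentzian metrics on \<open>I \<times> X\<close>\<close>

text \<open>The tangent space of \<open>I \<times> X\<close> at \<open>(s, p)\<close> is the product of \<open>\<real>\<close> and the tangent space of \<open>X\<close>
  at \<open>p\<close>.\<close>

type_synonym ('a, 'e) form =
  "real \<times> 'a \<Rightarrow> real \<times> ('a, 'e) tangent \<Rightarrow> real \<times> ('a, 'e) tangent \<Rightarrow> real"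

definition lorentz_form ::
    "(real \<times> 'a \<Rightarrow> real) \<Rightarrow> (real \<Rightarrow> 'a \<Rightarrow> ('a, 'e) tangent \<Rightarrow> ('a, 'e) tangent \<Rightarrow> real) \<Rightarrow>
      ('a, 'e) form" where
  "lorentz_form h g z V W = - (h z)\<^sup>2 * (fst V * fst W) + g (fst z) (snd z) (snd V) (snd W)"

text \<open>Signature \<open>(-,+,\<dots>,+)\<close>: some vector is negative and the form is positive definite on its
  orthogonal complement.\<close>

definition continuous_lorentzian_metric ::
    "('a::topological_space, 'e::euclidean_space) chart set \<Rightarrow> real set \<Rightarrow> ('a, 'e) form \<Rightarrow> bool" where
  "continuous_lorentzian_metric A I G \<longleftrightarrow>
     (\<forall>s\<in>I. \<forall>p. let T = (UNIV :: real set) \<times> tangent_space A p in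
        (\<forall>U\<in>T. \<forall>V\<in>T. \<forall>W\<in>T. \<forall>k.
           G (s, p) V W = G (s, p) W V \<and>
           G (s, p) (k * fst U + fst V, \<lambda>c. k *\<^sub>R snd U c + snd V c) W
             = k * G (s, p) U W + G (s, p) V W) \<and>
        (\<exists>N\<in>T. G (s, p) N N < 0 \<and>
           (\<forall>V\<in>T. G (s, p) N V = 0 \<and> V \<noteq> (0, \<lambda>_. 0) \<longrightarrow> G (s, p) V V > 0))) \<and>
     (\<forall>c\<in>A. \<forall>E\<in>(Basis :: (real \<times> 'e) set). \<forall>E'\<in>Basis.
        continuous_on (I \<times> fst c)
          (\<lambda>z. G z (fst E, coord_vector A (snd z) c (snd E)) (fst E', coord_vector A (snd z) c (snd E'))))"

definition abs_continuous_in_charts ::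
    "('a::topological_space, 'e::euclidean_space) chart set \<Rightarrow> real \<Rightarrow> real \<Rightarrow> (real \<Rightarrow> 'a) \<Rightarrow> bool" where
  "abs_continuous_in_charts A a b \<beta> \<longleftrightarrow> continuous_on {a..b} \<beta> \<and>
     (\<forall>c\<in>A. \<forall>u v. a \<le> u \<and> u \<le> v \<and> v \<le> b \<and> \<beta> ` {u..v} \<subseteq> fst c \<longrightarrow>
        abs_continuous edist u v (snd c \<circ> \<beta>))"

definition spacetime_curve ::
    "('a::topological_space, 'e::euclidean_space) chart set \<Rightarrow> real set \<Rightarrow>
      real \<Rightarrow> real \<Rightarrow> (real \<Rightarrow> real \<times> 'a) \<Rightarrow> bool" where
  "spacetime_curve A I a b \<gamma> \<longleftrightarrow>
     a < b \<and> \<gamma> ` {a..b} \<subseteq> I \<times> UNIV \<and>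
     abs_continuous edist a b (fst \<circ> \<gamma>) \<and> abs_continuous_in_charts A a b (snd \<circ> \<gamma>)"

definition spacetime_velocity ::
    "('a, 'e::euclidean_space) chart set \<Rightarrow> (real \<Rightarrow> real \<times> 'a) \<Rightarrow> real \<Rightarrow>
      real \<times> ('a, 'e) tangent" where
  "spacetime_velocity A \<gamma> t = (deriv (fst \<circ> \<gamma>) t, velocity A (snd \<circ> \<gamma>) t)"

definition induced_structure ::
    "('a::topological_space, 'e::euclidean_space) chart set \<Rightarrow> real set \<Rightarrow> ('a, 'e) form \<Rightarrow>
      'a causal_structure" where
  "induced_structure A I G =
     \<lparr>curve = spacetime_curve A I,
      speed_sq = (\<lambda>a b \<gamma> t.
        ereal (- G (\<gamma> t) (spacetime_velocity A \<gamma> t) (spacetime_velocity A \<gamma> t)))\<rparr>"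

end

theory Submission
  imports Defs
begin

text \<open>
  The two structures admit the same curves, and along each of them the two squared speeds agree at
  almost every parameter. Equality of the directed causal and timelike curves, of the lengths, of the
  relations and of the time separations follows formally.

  The geometric input is that the distance \<open>d\<^sub>s\<close> of a continuous Riemannian metric is, to first order, the
  norm of the chart displacement: near \<open>(s\<^sub>0, p\<^sub>0)\<close> the distance \<open>d\<^sub>s(x, y)\<close> lies between \<open>1 - \<epsilon>\<close> and \<open>1 + \<epsilon>\<close>
  times the norm of \<open>\<phi>(y) - \<phi>(x)\<close> in the inner product at \<open>(s\<^sub>0, p\<^sub>0)\<close> (\<open>local_comparison\<close>). Coordinate
  segments give the upper bound. For the lower bound, a curve either stays in a coordinate ball, and is
  then at least as long as its displacement, or it leaves the ball and is long for that reason.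

  In particular \<open>d\<^sub>s\<close> is locally bi-Lipschitz to every chart. As absolute continuity is a local property,
  it means the same for \<open>d\<^sub>s\<close> and in charts (\<open>product_curve_iff\<close>).

  Wherever a curve \<open>\<beta>\<close> has a coordinate velocity, its metric speed for \<open>d\<^sub>s\<close> is the \<open>g\<^sub>s\<close>-norm of that velocity,
  for all \<open>s\<close> at once (\<open>metric_speed_eq\<close>). The generalized metric speed at \<open>t\<close> averages the metric speed for
  the parameter \<open>s = \<alpha>(t)\<close>, which changes with \<open>t\<close>; the differentiation theorem for a fixed \<open>s\<close> would leave
  an exceptional set depending on \<open>s\<close>. It is therefore applied to the coordinate velocity: at a
  Lebesgue point of the velocity the averages converge for every \<open>s\<close> (\<open>gen_metric_speed_eq\<close>).

  From real analysis this needs that an absolutely continuous curve in a Euclidean space has a velocity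
  almost everywhere and that almost every parameter is a Lebesgue point of it
  (\<open>abs_continuous_lebesgue_points\<close>). The total variation reduces this to a monotone function, whose
  Stieltjes measure is absolutely continuous and so has a Radon-Nikodym density.

  That the generalized product is defined (\<open>product_defined_F\<close>) is a compactness argument: short curves
  that start in a compact set stay in a larger compact set, on which the norms depend uniformly
  continuously on \<open>s\<close>, with a relative error.
\<close>

section \<open>Curve length and absolute continuity\<close>

lemma edist_triangle: "edist x z \<le> edist x y + edist y z"
  by (simp add: edist_def dist_triangle flip: ennreal_plus)

lemma ennreal_halve:
  fixes e :: ennreal
  assumes "e > 0"
  obtains r :: real where "r > 0" "ennreal r + ennreal r \<le> e"
proof -
  obtain e' where e': "0 < e'" "e' < e" using dense[OF assms] by auto
  then obtain s where s: "e' = ennreal s" "s > 0"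
    by (cases e') auto
  have "ennreal (s/2) + ennreal (s/2) = ennreal s" using s by (simp flip: ennreal_plus)
  then show ?thesis using that[of "s/2"] s e' by (metis half_gt_zero less_imp_le)
qed

lemma ennreal_add_le_less:
  fixes x y :: ennreal
  assumes "x \<le> c" "y < d" "c \<noteq> \<infinity>"
  shows "x + y < c + d"
proof -
  have "x + y \<le> c + y" using assms(1) by (rule add_right_mono)
  also have "\<dots> < c + d" using assms(2,3) by (simp add: ennreal_add_left_cancel_less)
  finally show ?thesis .
qed

text \<open>A bound for all choices of near-maximizers bounds the sum of suprema. The summand \<open>c\<close> collects the
  choices already made in the induction.\<close>

lemma sum_SUP_le_ennreal:
  fixes g :: "nat \<Rightarrow> 'b \<Rightarrow> ennreal"
  assumes "\<And>i. i < n \<Longrightarrow> S i \<noteq> {}"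
    and "\<And>x. (\<And>i. i < n \<Longrightarrow> x i \<in> S i) \<Longrightarrow> c + (\<Sum>i<n. g i (x i)) \<le> e"
  shows "c + (\<Sum>i<n. SUP y\<in>S i. g i y) \<le> e"
  using assms
proof (induction n arbitrary: c)
  case (Suc n)
  have "c + (\<Sum>i<Suc n. SUP y\<in>S i. g i y) = (SUP y\<in>S n. (c + (\<Sum>i<n. SUP y\<in>S i. g i y)) + g n y)"
    using ennreal_SUP_add_right[of "S n" "c + (\<Sum>i<n. SUP y\<in>S i. g i y)" "g n"] Suc.prems(1)[of n]
    by (simp add: add.assoc)
  also have "\<dots> \<le> e"
  proof (rule SUP_least)
    fix y assume y: "y \<in> S n"
    have "(c + g n y) + (\<Sum>i<n. SUP y\<in>S i. g i y) \<le> e"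
    proof (rule Suc.IH)
      fix x assume x: "\<And>i. i < n \<Longrightarrow> x i \<in> S i"
      have "c + (\<Sum>i<Suc n. g i ((x(n := y)) i)) \<le> e"
        by (rule Suc.prems(2)) (use x y in \<open>auto simp: less_Suc_eq\<close>)
      then show "(c + g n y) + (\<Sum>i<n. g i (x i)) \<le> e" by (simp add: ac_simps)
    qed (use Suc.prems(1) in auto)
    then show "(c + (\<Sum>i<n. SUP y\<in>S i. g i y)) + g n y \<le> e" by (simp add: ac_simps)
  qed
  finally show ?case .
qed simp

lemma sum_le_curve_length:
  assumes "mono_on {..n} \<tau>" "\<tau> ` {..n} \<subseteq> {a..b}"
  shows "(\<Sum>i<n. d (c (\<tau> i)) (c (\<tau> (Suc i)))) \<le> curve_length d a b c"
  unfolding curve_length_def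
  by (rule SUP_upper2[where i="(n,\<tau>)"]) (use assms in auto)

lemma curve_length_leI:
  assumes "\<And>n \<tau>. mono_on {..n} \<tau> \<Longrightarrow> \<tau> ` {..n} \<subseteq> {a..b} \<Longrightarrow>
      (\<Sum>i<n. d (c (\<tau> i)) (c (\<tau> (Suc i)))) \<le> L"
  shows "curve_length d a b c \<le> L"
  unfolding curve_length_def by (rule SUP_least) (use assms in auto)

text \<open>Clipping a partition at \<open>m\<close> from above and from below produces partitions of both halves; no index
  has to be found at which the partition crosses \<open>m\<close>.\<close>

lemma curve_length_subadditive:
  assumes tri: "\<And>x y z. d x z \<le> d x y + d y z" and "a \<le> m" "m \<le> b"
  shows "curve_length d a b c \<le> curve_length d a m c + curve_length d m b c"
proof (rule curve_length_leI)
  fix n :: nat and \<tau> :: "nat \<Rightarrow> real" assume \<tau>: "mono_on {..n} \<tau>" "\<tau> ` {..n} \<subseteq> {a..b}"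
  let ?l = "\<lambda>i. min (\<tau> i) m" and ?r = "\<lambda>i. max (\<tau> i) m"
  have mono: "\<tau> i \<le> \<tau> (Suc i)" if "i < n" for i
    using \<tau>(1) that by (auto simp: mono_on_def)
  have "(\<Sum>i<n. d (c (\<tau> i)) (c (\<tau> (Suc i)))) \<le>
      (\<Sum>i<n. d (c (?l i)) (c (?l (Suc i))) + d (c (?r i)) (c (?r (Suc i))))"
  proof (rule sum_mono)
    fix i assume "i \<in> {..<n}"
    then have "\<tau> i \<le> \<tau> (Suc i)" using mono by simp
    then consider "\<tau> (Suc i) \<le> m" "\<tau> i \<le> m" | "m \<le> \<tau> i" "m \<le> \<tau> (Suc i)" | "\<tau> i \<le> m" "m \<le> \<tau> (Suc i)" by linarith
    then show "d (c (\<tau> i)) (c (\<tau> (Suc i))) \<le>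
        d (c (?l i)) (c (?l (Suc i))) + d (c (?r i)) (c (?r (Suc i)))"
      by cases (auto simp: min_absorb1 min_absorb2 max_absorb1 max_absorb2 intro: tri add_increasing)
  qed
  also have "\<dots> = (\<Sum>i<n. d (c (?l i)) (c (?l (Suc i)))) + (\<Sum>i<n. d (c (?r i)) (c (?r (Suc i))))"
    by (rule sum.distrib)
  also have "\<dots> \<le> curve_length d a m c + curve_length d m b c"
  proof (rule add_mono; rule sum_le_curve_length)
    show "mono_on {..n} ?l" "mono_on {..n} ?r"
      using \<tau>(1) by (auto simp: mono_on_def min.coboundedI1 max.coboundedI1)
    show "?l ` {..n} \<subseteq> {a..m}" "?r ` {..n} \<subseteq> {m..b}" using \<tau>(2) assms by auto
  qed
  finally show "(\<Sum>i<n. d (c (\<tau> i)) (c (\<tau> (Suc i)))) \<le> curve_length d a m c + curve_length d m b c" .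
qed

lemma curve_length_extend:
  assumes "a \<le> x" "x \<le> y"
  shows "curve_length d a x c + d (c x) (c y) \<le> curve_length d a y c"
proof -
  let ?S = "{(n::nat, \<tau>::nat \<Rightarrow> real). mono_on {..n} \<tau> \<and> \<tau> ` {..n} \<subseteq> {a..x}}"
  have ne: "?S \<noteq> {}" using assms by (auto intro!: exI[of _ 0] exI[of _ "\<lambda>_. a"] simp: mono_on_def)
  have "d (c x) (c y) + curve_length d a x c =
      (SUP (n, \<tau>)\<in>?S. d (c x) (c y) + (\<Sum>i<n. d (c (\<tau> i)) (c (\<tau> (Suc i)))))"
    unfolding curve_length_def using ne
    by (subst ennreal_SUP_add_right) (auto simp: case_prod_unfold)
  also have "\<dots> \<le> curve_length d a y c"
  proof (rule SUP_least, clarify)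
    fix n and \<tau> :: "nat \<Rightarrow> real" assume \<tau>: "mono_on {..n} \<tau>" "\<tau> ` {..n} \<subseteq> {a..x}"
    define \<sigma> where "\<sigma> i = (if i \<le> n then \<tau> i else if i = Suc n then x else y)" for i
    have "(\<Sum>i<Suc (Suc n). d (c (\<sigma> i)) (c (\<sigma> (Suc i)))) \<le> curve_length d a y c"
    proof (rule sum_le_curve_length)
      have bd: "a \<le> \<tau> i \<and> \<tau> i \<le> x" if "i \<le> n" for i using \<tau>(2) that by auto
      show "mono_on {..Suc (Suc n)} \<sigma>"
      proof (rule mono_onI)
        fix i j assume "i \<in> {..Suc (Suc n)}" "j \<in> {..Suc (Suc n)}" "i \<le> j"
        then consider "i \<le> n" "j \<le> n" | "i \<le> n" "n < j" | "n < i" "n < j" by fastforce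
        then show "\<sigma> i \<le> \<sigma> j"
        proof cases
          case 1 then show ?thesis using mono_onD[OF \<tau>(1)] \<open>i \<le> j\<close> by (simp add: \<sigma>_def)
        next
          case 2 then show ?thesis using bd[of i] assms by (simp add: \<sigma>_def)
        next
          case 3 then show ?thesis using \<open>i \<le> j\<close> assms by (simp add: \<sigma>_def)
        qed
      qed
      show "\<sigma> ` {..Suc (Suc n)} \<subseteq> {a..y}"
      proof (rule image_subsetI)
        fix i show "\<sigma> i \<in> {a..y}" using bd[of i] assms unfolding \<sigma>_def by auto
      qed
    qed
    moreover have "(\<Sum>i<n. d (c (\<sigma> i)) (c (\<sigma> (Suc i)))) = (\<Sum>i<n. d (c (\<tau> i)) (c (\<tau> (Suc i))))"
      by (rule sum.cong) (auto simp: \<sigma>_def)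
    ultimately have "(\<Sum>i<n. d (c (\<tau> i)) (c (\<tau> (Suc i)))) + d (c (\<tau> n)) (c x) + d (c x) (c y) \<le> curve_length d a y c"
      by (simp add: \<sigma>_def)
    then show "d (c x) (c y) + (\<Sum>i<n. d (c (\<tau> i)) (c (\<tau> (Suc i)))) \<le> curve_length d a y c"
      by (rule order_trans[rotated]) (simp add: ac_simps)
  qed
  finally show ?thesis by (simp add: add.commute)
qed

text \<open>The families in the definition of absolute continuity, over an arbitrary index type because
  partitions of several intervals are naturally indexed by pairs.\<close>

definition disjoint_intervals :: "real \<Rightarrow> real \<Rightarrow> 'k set \<Rightarrow> ('k \<Rightarrow> real) \<Rightarrow> ('k \<Rightarrow> real) \<Rightarrow> bool" where
  "disjoint_intervals a b K u v \<longleftrightarrow> finite K \<and> (\<forall>i\<in>K. a \<le> u i \<and> u i \<le> v i \<and> v i \<le> b) \<and>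
     (\<forall>i\<in>K. \<forall>j\<in>K. i \<noteq> j \<longrightarrow> {u i<..<v i} \<inter> {u j<..<v j} = {})"

lemma abs_continuous_iff:
  "abs_continuous d a b c \<longleftrightarrow> (\<forall>e>0. \<exists>\<delta>>0. \<forall>(n::nat) u v. disjoint_intervals a b {..<n} u v \<longrightarrow>
     (\<Sum>i<n. v i - u i) < \<delta> \<longrightarrow> (\<Sum>i<n. d (c (u i)) (c (v i))) < e)"
  unfolding abs_continuous_def disjoint_intervals_def
  by (simp only: Ball_def lessThan_iff finite_lessThan simp_thms imp_conjL)

lemma abs_continuous_finite_family:
  assumes "abs_continuous d a b c" "e > 0"
  shows "\<exists>\<delta>>0. \<forall>(K::'k set) u v. disjoint_intervals a b K u v \<longrightarrow> (\<Sum>i\<in>K. v i - u i) < \<delta> \<longrightarrow>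
    (\<Sum>i\<in>K. d (c (u i)) (c (v i))) < e"
proof -
  obtain \<delta> where \<delta>: "\<delta> > 0" "\<forall>(n::nat) u v. disjoint_intervals a b {..<n} u v \<longrightarrow>
      (\<Sum>i<n. v i - u i) < \<delta> \<longrightarrow> (\<Sum>i<n. d (c (u i)) (c (v i))) < e"
    using assms unfolding abs_continuous_iff by blast
  show ?thesis
  proof (intro exI[of _ \<delta>] conjI allI impI \<delta>(1))
    fix K :: "'k set" and u v
    assume K: "disjoint_intervals a b K u v" and small: "(\<Sum>i\<in>K. v i - u i) < \<delta>"
    then have "finite K" by (simp add: disjoint_intervals_def)
    from ex_bij_betw_nat_finite[OF this] obtain f n where f: "bij_betw f {..<n::nat} K"
      by (auto simp: atLeast0LessThan)
    have s: "(\<Sum>i<n. g (f i)) = (\<Sum>i\<in>K. g i)" for g :: "'k \<Rightarrow> 'z::comm_monoid_add"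
      by (rule sum.reindex_bij_betw[OF f])
    have fK: "f i \<in> K" "j < n \<Longrightarrow> i \<noteq> j \<Longrightarrow> f i \<noteq> f j" if "i < n" for i j
      using f that by (auto simp: bij_betw_def inj_on_def)
    have "disjoint_intervals a b {..<n} (\<lambda>i. u (f i)) (\<lambda>i. v (f i))"
      using K fK by (simp add: disjoint_intervals_def)
    then have "(\<Sum>i<n. d (c (u (f i))) (c (v (f i)))) < e"
      using \<delta>(2) small s[of "\<lambda>i. v i - u i"] by simp
    then show "(\<Sum>i\<in>K. d (c (u i)) (c (v i))) < e" using s[of "\<lambda>i. d (c (u i)) (c (v i))"] by simp
  qed
qed

lemma abs_continuous_dominated:
  assumes ac: "abs_continuous d a b c" and sub: "a \<le> p" "q \<le> b" and K: "K > 0"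
    and le: "\<And>x y. x \<in> {p..q} \<Longrightarrow> y \<in> {p..q} \<Longrightarrow> d' (c' x) (c' y) \<le> ennreal K * d (c x) (c y)"
  shows "abs_continuous d' p q c'"
  unfolding abs_continuous_iff
proof (intro allI impI)
  fix e :: ennreal assume "e > 0"
  then obtain r where r: "r > 0" "ennreal r + ennreal r \<le> e" by (rule ennreal_halve)
  have "ennreal (r / K) > 0" using r K by simp
  with ac obtain \<delta> where \<delta>: "\<delta> > 0" "\<forall>(n::nat) u v. disjoint_intervals a b {..<n} u v \<longrightarrow>
      (\<Sum>i<n. v i - u i) < \<delta> \<longrightarrow> (\<Sum>i<n. d (c (u i)) (c (v i))) < ennreal (r / K)"
    unfolding abs_continuous_iff by blast
  show "\<exists>\<delta>>0. \<forall>(n::nat) u v. disjoint_intervals p q {..<n} u v \<longrightarrow>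
      (\<Sum>i<n. v i - u i) < \<delta> \<longrightarrow> (\<Sum>i<n. d' (c' (u i)) (c' (v i))) < e"
  proof (intro exI[of _ \<delta>] conjI allI impI \<delta>(1))
    fix n :: nat and u v
    assume uv: "disjoint_intervals p q {..<n} u v" and small: "(\<Sum>i<n. v i - u i) < \<delta>"
    have pq: "p \<le> u i \<and> u i \<le> v i \<and> v i \<le> q" if "i < n" for i
      using uv that by (simp add: disjoint_intervals_def)
    have "a \<le> u i \<and> u i \<le> v i \<and> v i \<le> b" if "i < n" for i
      using pq[OF that] sub by linarith
    then have "disjoint_intervals a b {..<n} u v" using uv by (simp add: disjoint_intervals_def)
    then have lt: "(\<Sum>i<n. d (c (u i)) (c (v i))) < ennreal (r / K)" using \<delta>(2) small by blast
    have "(\<Sum>i<n. d' (c' (u i)) (c' (v i))) \<le> (\<Sum>i<n. ennreal K * d (c (u i)) (c (v i)))"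
    proof (rule sum_mono)
      fix i assume "i \<in> {..<n}"
      then show "d' (c' (u i)) (c' (v i)) \<le> ennreal K * d (c (u i)) (c (v i))"
        using pq[of i] by (intro le) auto
    qed
    also have "\<dots> = ennreal K * (\<Sum>i<n. d (c (u i)) (c (v i)))" by (rule sum_distrib_left[symmetric])
    also have "\<dots> < ennreal K * ennreal (r / K)" using lt K by (intro ennreal_mult_strict_left_mono) auto
    also have "\<dots> = ennreal r" using r K by (simp flip: ennreal_mult)
    also have "\<dots> \<le> ennreal r + ennreal r" by simp
    also have "\<dots> \<le> e" by (rule r)
    finally show "(\<Sum>i<n. d' (c' (u i)) (c' (v i))) < e" .
  qed
qed

lemma abs_continuous_join:
  assumes tri: "\<And>x y z. d x z \<le> d x y + d y z" and m: "a \<le> m" "m \<le> b"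
    and ac: "abs_continuous d a m c" "abs_continuous d m b c"
  shows "abs_continuous d a b c"
  unfolding abs_continuous_iff
proof (intro allI impI)
  fix e :: ennreal assume "e > 0"
  then obtain r where r: "r > 0" "ennreal r + ennreal r \<le> e" by (rule ennreal_halve)
  have r0: "ennreal r > 0" using r by simp
  obtain \<delta>1 where 1: "\<delta>1 > 0" "\<forall>(n::nat) u v. disjoint_intervals a m {..<n} u v \<longrightarrow> (\<Sum>i<n. v i - u i) < \<delta>1 \<longrightarrow>
     (\<Sum>i<n. d (c (u i)) (c (v i))) < ennreal r"
    using ac(1) r0 unfolding abs_continuous_iff by blast
  obtain \<delta>2 where 2: "\<delta>2 > 0" "\<forall>(n::nat) u v. disjoint_intervals m b {..<n} u v \<longrightarrow> (\<Sum>i<n. v i - u i) < \<delta>2 \<longrightarrow>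
     (\<Sum>i<n. d (c (u i)) (c (v i))) < ennreal r"
    using ac(2) r0 unfolding abs_continuous_iff by blast
  show "\<exists>\<delta>>0. \<forall>(n::nat) u v. disjoint_intervals a b {..<n} u v \<longrightarrow>
      (\<Sum>i<n. v i - u i) < \<delta> \<longrightarrow> (\<Sum>i<n. d (c (u i)) (c (v i))) < e"
  proof (rule exI[of _ "min \<delta>1 \<delta>2"], intro conjI allI impI)
    show "min \<delta>1 \<delta>2 > 0" using 1(1) 2(1) by simp
    fix n :: nat and u v :: "nat \<Rightarrow> real"
    assume "disjoint_intervals a b {..<n} u v" "(\<Sum>i<n. v i - u i) < min \<delta>1 \<delta>2"
    then have uv: "\<And>i. i < n \<Longrightarrow> a \<le> u i \<and> u i \<le> v i \<and> v i \<le> b"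
      and dis: "\<And>i j. i < n \<Longrightarrow> j < n \<Longrightarrow> i \<noteq> j \<Longrightarrow> {u i<..<v i} \<inter> {u j<..<v j} = {}"
      and sm: "(\<Sum>i<n. v i - u i) < \<delta>1" "(\<Sum>i<n. v i - u i) < \<delta>2" by (auto simp: disjoint_intervals_def)
    \<comment> \<open>Clipping at \<open>m\<close> splits every interval, including the one that may contain \<open>m\<close>.\<close>
    let ?l = "\<lambda>w i. min (w i) m" and ?r = "\<lambda>w i. max (w i) m"
    have sub: "{?l u i<..<?l v i} \<subseteq> {u i<..<v i}" "{?r u i<..<?r v i} \<subseteq> {u i<..<v i}" for i by auto
    have dl: "disjoint_intervals a m {..<n} (?l u) (?l v)" unfolding disjoint_intervals_def
    proof (intro conjI ballI impI)
      show "{?l u i<..<?l v i} \<inter> {?l u j<..<?l v j} = {}" if "i \<in> {..<n}" "j \<in> {..<n}" "i \<noteq> j" for i j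
        using dis[of i j] sub(1)[of i] sub(1)[of j] that by (meson disjoint_iff lessThan_iff subsetD)
    next
      fix i assume "i \<in> {..<n}"
      then have "a \<le> u i \<and> u i \<le> v i \<and> v i \<le> b" using uv by simp
      then show "a \<le> ?l u i" "?l u i \<le> ?l v i" "?l v i \<le> m" using m by (auto simp: min_def)
    qed simp
    have dr: "disjoint_intervals m b {..<n} (?r u) (?r v)" unfolding disjoint_intervals_def
    proof (intro conjI ballI impI)
      show "{?r u i<..<?r v i} \<inter> {?r u j<..<?r v j} = {}" if "i \<in> {..<n}" "j \<in> {..<n}" "i \<noteq> j" for i j
        using dis[of i j] sub(2)[of i] sub(2)[of j] that by (meson disjoint_iff lessThan_iff subsetD)
    next
      fix i assume "i \<in> {..<n}"
      then have "a \<le> u i \<and> u i \<le> v i \<and> v i \<le> b" using uv by simp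
      then show "m \<le> ?r u i" "?r u i \<le> ?r v i" "?r v i \<le> b" using m by (auto simp: max_def)
    qed simp
    have "(\<Sum>i<n. ?l v i - ?l u i) \<le> (\<Sum>i<n. v i - u i)" "(\<Sum>i<n. ?r v i - ?r u i) \<le> (\<Sum>i<n. v i - u i)"
    proof (rule_tac [!] sum_mono)
      fix i assume "i \<in> {..<n}"
      then have "u i \<le> v i" using uv by simp
      then show "?l v i - ?l u i \<le> v i - u i" "?r v i - ?r u i \<le> v i - u i" by (auto simp: min_def max_def)
    qed
    then have "(\<Sum>i<n. ?l v i - ?l u i) < \<delta>1" "(\<Sum>i<n. ?r v i - ?r u i) < \<delta>2" using sm by linarith+
    then have lts: "(\<Sum>i<n. d (c (?l u i)) (c (?l v i))) < ennreal r" "(\<Sum>i<n. d (c (?r u i)) (c (?r v i))) < ennreal r"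
      using 1(2) 2(2) dl dr by blast+
    have "(\<Sum>i<n. d (c (u i)) (c (v i))) \<le> (\<Sum>i<n. d (c (?l u i)) (c (?l v i)) + d (c (?r u i)) (c (?r v i)))"
    proof (rule sum_mono)
      fix i assume "i \<in> {..<n}"
      then have "u i \<le> v i" using uv by simp
      then consider "v i \<le> m" "u i \<le> m" | "m \<le> u i" "m \<le> v i" | "u i \<le> m" "m \<le> v i" by linarith
      then show "d (c (u i)) (c (v i)) \<le> d (c (?l u i)) (c (?l v i)) + d (c (?r u i)) (c (?r v i))"
        by cases (auto simp: min_absorb1 min_absorb2 max_absorb1 max_absorb2 intro: tri add_increasing add_increasing2)
    qed
    also have "\<dots> = (\<Sum>i<n. d (c (?l u i)) (c (?l v i))) + (\<Sum>i<n. d (c (?r u i)) (c (?r v i)))"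
      by (rule sum.distrib)
    also have "\<dots> < ennreal r + ennreal r"
      by (rule ennreal_add_le_less[OF less_imp_le[OF lts(1)] lts(2)]) simp
    finally show "(\<Sum>i<n. d (c (u i)) (c (v i))) < e" using r(2) by simp
  qed
qed

text \<open>Absolute continuity is a local property, by compactness of the interval.\<close>

lemma abs_continuous_local:
  assumes tri: "\<And>x y z. d x z \<le> d x y + d y z" and ab: "a \<le> b"
    and local: "\<And>t. t \<in> {a..b} \<Longrightarrow> \<exists>\<delta>>0. \<forall>p q. a \<le> p \<and> p \<le> t \<and> t \<le> q \<and> q \<le> b \<and> q - p < \<delta> \<longrightarrow> abs_continuous d p q c"
  shows "abs_continuous d a b c"
proof -
  define P where "P p q \<longleftrightarrow> (a \<le> p \<and> p \<le> q \<and> q \<le> b \<longrightarrow> abs_continuous d p q c)" for p q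
  have "P a b" using ab
  proof (induction rule: Bolzano)
    case (trans p q r)
    then show ?case unfolding P_def using abs_continuous_join[where d=d and a=p and m=q and b=r and c=c, OF tri] by auto
  next
    case (local t)
    then obtain \<delta> where "\<delta> > 0" "\<forall>p q. a \<le> p \<and> p \<le> t \<and> t \<le> q \<and> q \<le> b \<and> q - p < \<delta> \<longrightarrow> abs_continuous d p q c"
      using assms(3)[of t] by auto
    then show ?case unfolding P_def by (intro exI[of _ \<delta>]) auto
  qed
  then show ?thesis using ab by (simp add: P_def)
qed

text \<open>The same \<open>\<delta>\<close> works with the distances of the end points replaced by the lengths in between:
  partitions of disjoint intervals form one disjoint family of the same total length.\<close>

lemma abs_continuous_curve_length:
  assumes "abs_continuous d a b c" "e > 0"
  shows "\<exists>\<delta>>0. \<forall>(n::nat) u v. disjoint_intervals a b {..<n} u v \<longrightarrow> (\<Sum>i<n. v i - u i) < \<delta> \<longrightarrow>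
    (\<Sum>i<n. curve_length d (u i) (v i) c) \<le> e"
proof -
  obtain \<delta> where \<delta>: "\<delta> > 0" 
    "\<forall>(K::(nat\<times>nat) set) u v. disjoint_intervals a b K u v \<longrightarrow> (\<Sum>i\<in>K. v i - u i) < \<delta> \<longrightarrow>
      (\<Sum>i\<in>K. d (c (u i)) (c (v i))) < e"
    using abs_continuous_finite_family[OF assms, where ?'k="nat \<times> nat"] by (elim exE conjE)
  show ?thesis
  proof (intro exI[of _ \<delta>] conjI allI impI \<delta>(1))
    fix n :: nat and u v :: "nat \<Rightarrow> real"
    assume duv: "disjoint_intervals a b {..<n} u v" and small: "(\<Sum>i<n. v i - u i) < \<delta>"
    from duv have uv: "\<And>i. i < n \<Longrightarrow> a \<le> u i \<and> u i \<le> v i \<and> v i \<le> b"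
      and disj: "\<And>i j. i < n \<Longrightarrow> j < n \<Longrightarrow> i \<noteq> j \<Longrightarrow> {u i<..<v i} \<inter> {u j<..<v j} = {}"
      by (auto simp: disjoint_intervals_def)
    have "0 + (\<Sum>i<n. curve_length d (u i) (v i) c) \<le> e"
      unfolding curve_length_def
    proof (rule sum_SUP_le_ennreal)
      fix i assume "i < n"
      then show "{(m::nat, \<tau>::nat \<Rightarrow> real). mono_on {..m} \<tau> \<and> \<tau> ` {..m} \<subseteq> {u i..v i}} \<noteq> {}"
        using uv by (auto intro!: exI[of _ 0] exI[of _ "\<lambda>_. u i"] simp: mono_on_def)
    next
      fix x assume "\<And>i. i < n \<Longrightarrow> x i \<in> {(m::nat, \<tau>::nat \<Rightarrow> real). mono_on {..m} \<tau> \<and> \<tau> ` {..m} \<subseteq> {u i..v i}}"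
      then have x: "mono_on {..fst (x i)} (snd (x i)) \<and> snd (x i) ` {..fst (x i)} \<subseteq> {u i..v i}" if "i < n" for i
        using that by (auto simp: case_prod_unfold)
      let ?K = "Sigma {..<n} (\<lambda>i. {..<fst (x i)})"
      let ?p = "\<lambda>(i, k). snd (x i) k" and ?q = "\<lambda>(i, k). snd (x i) (Suc k)"
      have mono: "snd (x i) k \<le> snd (x i) l" if "i < n" "k \<le> l" "l \<le> fst (x i)" for i k l
        using x[OF that(1)] that by (auto simp: mono_on_def)
      have rng: "u i \<le> snd (x i) k \<and> snd (x i) k \<le> v i" if "i < n" "k \<le> fst (x i)" for i k
        using x[OF that(1)] that by auto
      have "disjoint_intervals a b ?K ?p ?q" unfolding disjoint_intervals_def
      proof (intro conjI ballI impI)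
        show "finite ?K" by simp
      next
        fix z assume z: "z \<in> ?K"
        obtain i k where [simp]: "z = (i, k)" by (cases z)
        have "i < n" "Suc k \<le> fst (x i)" "k \<le> fst (x i)" using z by auto
        then show "a \<le> ?p z" "?p z \<le> ?q z" "?q z \<le> b"
          using mono[of i k "Suc k"] rng[of i k] rng[of i "Suc k"] uv[of i] by (auto simp del: Suc_le_eq)
      next
        fix z z' assume z: "z \<in> ?K" "z' \<in> ?K" "z \<noteq> z'"
        obtain i k i' k' where [simp]: "z = (i, k)" "z' = (i', k')" by (cases z; cases z')
        have *: "i < n" "Suc k \<le> fst (x i)" "k \<le> fst (x i)" "i' < n" "Suc k' \<le> fst (x i')" "k' \<le> fst (x i')" 
          using z by auto
        show "{?p z<..<?q z} \<inter> {?p z'<..<?q z'} = {}"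
        proof (cases "i = i'")
          case True
          then have "k \<noteq> k'" using z by auto
          then consider "Suc k \<le> k'" | "Suc k' \<le> k" by linarith
          then show ?thesis
            using mono[of i "Suc k" k'] mono[of i "Suc k'" k] * True by cases auto
        next
          case False
          have "{?p z<..<?q z} \<subseteq> {u i<..<v i}" "{?p z'<..<?q z'} \<subseteq> {u i'<..<v i'}"
            using rng[OF *(1) *(3)] rng[OF *(1) *(2)] rng[OF *(4) *(6)] rng[OF *(4) *(5)] by auto
          then show ?thesis using disj[OF *(1) *(4) False] by blast
        qed
      qed
      moreover have "(\<Sum>z\<in>?K. ?q z - ?p z) < \<delta>"
      proof -
        have "(\<Sum>z\<in>?K. ?q z - ?p z) = (\<Sum>i<n. \<Sum>k<fst (x i). snd (x i) (Suc k) - snd (x i) k)"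
          by (subst sum.Sigma) (auto simp: case_prod_unfold)
        also have "\<dots> = (\<Sum>i<n. snd (x i) (fst (x i)) - snd (x i) 0)"
          by (simp add: sum_lessThan_telescope)
        also have "\<dots> \<le> (\<Sum>i<n. v i - u i)"
          using rng by (intro sum_mono diff_mono) auto
        finally show ?thesis using small by simp
      qed
      ultimately have "(\<Sum>i\<in>?K. d (c (?p i)) (c (?q i))) < e" using \<delta>(2) by blast
      also have "(\<Sum>i\<in>?K. d (c (?p i)) (c (?q i))) = (\<Sum>i<n. \<Sum>k<fst (x i). d (c (snd (x i) k)) (c (snd (x i) (Suc k))))"
        by (subst sum.Sigma) (auto simp: case_prod_unfold)
      finally show "0 + (\<Sum>i<n. case x i of (m, \<tau>) \<Rightarrow> \<Sum>i<m. d (c (\<tau> i)) (c (\<tau> (Suc i)))) \<le> e"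
        by (simp add: case_prod_unfold)
    qed
    then show "(\<Sum>i<n. curve_length d (u i) (v i) c) \<le> e" by simp
  qed
qed

lemma abs_continuous_curve_length_finite:
  assumes "abs_continuous d a b c" and tri: "\<And>x y z. d x z \<le> d x y + d y z" and "a \<le> b"
  shows "curve_length d a b c < \<infinity>"
proof -
  obtain \<delta> where \<delta>: "\<delta> > 0" 
    "\<forall>(n::nat) u v. disjoint_intervals a b {..<n} u v \<longrightarrow> (\<Sum>i<n. v i - u i) < \<delta> \<longrightarrow>
      (\<Sum>i<n. curve_length d (u i) (v i) c) \<le> 1"
    using abs_continuous_curve_length[OF assms(1) zero_less_one] by (elim exE conjE)
  define Q where "Q p q \<longleftrightarrow> (a \<le> p \<and> p \<le> q \<and> q \<le> b \<longrightarrow> curve_length d p q c < \<infinity>)" for p q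
  have "Q a b" using \<open>a \<le> b\<close>
  proof (induction rule: Bolzano)
    case (trans p q r)
    show ?case unfolding Q_def
    proof
      assume "a \<le> p \<and> p \<le> r \<and> r \<le> b"
      then have "curve_length d p q c < \<infinity>" "curve_length d q r c < \<infinity>" using trans by (auto simp: Q_def)
      then show "curve_length d p r c < \<infinity>"
        using curve_length_subadditive[of d p q r c, OF tri] trans by (auto simp: le_less_trans)
    qed
  next
    case (local x)
    have "Q p q" if "q - p < \<delta>" for p q
    proof -
      have "(\<Sum>i<1::nat. curve_length d p q c) \<le> 1" if "a \<le> p \<and> p \<le> q \<and> q \<le> b"
        using \<open>q - p < \<delta>\<close> that by (intro \<delta>(2)[rule_format]) (auto simp: disjoint_intervals_def)
      then show ?thesis by (auto simp: Q_def intro: le_less_trans)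
    qed
    then show ?case using \<delta>(1) by (intro exI[of _ \<delta>]) simp
  qed
  then show ?thesis using \<open>a \<le> b\<close> by (simp add: Q_def)
qed



section \<open>Derivatives and Lebesgue points of absolutely continuous curves\<close>

lemma abs_continuous_imp_continuous_on:
  fixes f :: "real \<Rightarrow> 'b::metric_space"
  assumes "abs_continuous edist a b f"
  shows "continuous_on {a..b} f"
  unfolding continuous_on_iff
proof (intro ballI allI impI)
  fix t and e :: real assume t: "t \<in> {a..b}" and "0 < e"
  then obtain \<delta> where \<delta>: "\<delta> > 0" 
    "\<forall>(K::nat set) u v. disjoint_intervals a b K u v \<longrightarrow> (\<Sum>i\<in>K. v i - u i) < \<delta> \<longrightarrow>
      (\<Sum>i\<in>K. edist (f (u i)) (f (v i))) < ennreal e"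
    using abs_continuous_finite_family[OF assms, of "ennreal e", where ?'k=nat] by auto
  show "\<exists>d>0. \<forall>t'\<in>{a..b}. dist t' t < d \<longrightarrow> dist (f t') (f t) < e"
  proof (intro exI[of _ \<delta>] conjI ballI impI \<delta>(1))
    fix t' assume t': "t' \<in> {a..b}" "dist t' t < \<delta>"
    have "(\<Sum>i\<in>{0::nat}. edist (f (min t t')) (f (max t t'))) < ennreal e"
      using t t' by (intro \<delta>(2)[rule_format]) (auto simp: disjoint_intervals_def dist_real_def)
    then show "dist (f t') (f t) < e"
      using \<open>0 < e\<close> by (cases "t \<le> t'") (auto simp: edist_def dist_commute ennreal_less_iff)
  qed
qed

text \<open>A null set is covered by nonoverlapping intervals of small total length, over which an absolutely
  continuous function increases little. So its Stieltjes measure is absolutely continuous, and the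
  Radon-Nikodym theorem applies.\<close>

lemma mono_abs_continuous_has_density:
  fixes G :: "real \<Rightarrow> real"
  assumes ab: "a < b" and mono: "mono_on {a..b} G" and ac: "abs_continuous edist a b G"
  obtains g where "g absolutely_integrable_on {a..b}"
    "\<And>x. x \<in> {a..b} \<Longrightarrow> (g has_integral G x - G a) {a..x}"
proof -
  \<comment> \<open>The Stieltjes measure needs a monotone function on the whole line: extend by constants.\<close>
  define H where "H x = G (min (max x a) b)" for x
  have H: "H x = G x" if "x \<in> {a..b}" for x using that by (simp add: H_def)
  have monoH: "H x \<le> H y" if "x \<le> y" for x y
    unfolding H_def using that ab by (intro mono_onD[OF mono]) auto
  have "continuous_on UNIV (G \<circ> (\<lambda>x. min (max x a) b))"
    by (rule continuous_on_compose[OF _ continuous_on_subset[OF abs_continuous_imp_continuous_on[OF ac]]])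
       (use ab in \<open>auto intro!: continuous_intros\<close>)
  then have contH: "continuous_on UNIV H" unfolding H_def comp_def .
  define \<mu> where "\<mu> = interval_measure H"
  have sets_\<mu>[measurable_cong]: "sets \<mu> = sets borel" by (simp add: \<mu>_def)
  have \<mu>: "emeasure \<mu> {x..y} = ennreal (H y - H x)" if "x \<le> y" for x y
    unfolding \<mu>_def by (rule emeasure_interval_measure_Icc[OF that monoH contH])
  have UN_borel: "(\<Union>n::nat. {s n..t n::real}) \<in> sets \<mu>" for s t by (auto simp: sets_\<mu>)
  have left0: "emeasure \<mu> {..a} = 0"
  proof -
    have "emeasure \<mu> (\<Union>n::nat. {a - n..a}) = 0"
      by (rule emeasure_UN_eq_0) (auto simp: \<mu> H_def sets_\<mu>)
    moreover have "{..a} \<subseteq> (\<Union>n::nat. {a - n..a})"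
    proof
      fix x assume "x \<in> {..a}"
      moreover obtain n :: nat where "a - x \<le> n" using real_arch_simple by blast
      ultimately have "x \<in> {a - n..a}" by auto
      then show "x \<in> (\<Union>n::nat. {a - n..a})" by blast
    qed
    ultimately show ?thesis by (rule emeasure_eq_0[OF UN_borel])
  qed
  have right0: "emeasure \<mu> {b..} = 0"
  proof -
    have "emeasure \<mu> (\<Union>n::nat. {b..b + n}) = 0"
      using ab by (intro emeasure_UN_eq_0) (auto simp: \<mu> H_def sets_\<mu>)
    moreover have "{b..} \<subseteq> (\<Union>n::nat. {b..b + n})"
    proof
      fix x assume "x \<in> {b..}"
      moreover obtain n :: nat where "x - b \<le> n" using real_arch_simple by blast
      ultimately have "x \<in> {b..b+n}" by auto
      then show "x \<in> (\<Union>n::nat. {b..b + n})" by blast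
    qed
    ultimately show ?thesis by (rule emeasure_eq_0[OF UN_borel])
  qed
  have small: "emeasure \<mu> (N \<inter> {a..b}) \<le> ennreal e" if N: "N \<in> null_sets lborel" and "e > 0" for N e
  proof -
    obtain \<delta> where \<delta>: "\<delta> > 0" 
      "\<forall>(K::real set set) u v. disjoint_intervals a b K u v \<longrightarrow> (\<Sum>i\<in>K. v i - u i) < \<delta> \<longrightarrow>
        (\<Sum>i\<in>K. edist (G (u i)) (G (v i))) < ennreal e"
      using abs_continuous_finite_family[OF ac, of "ennreal e", where ?'k="real set"] \<open>e > 0\<close> by auto
    have Nb: "N \<in> sets borel" "emeasure lborel N = 0" using N by (auto simp: null_sets_def)
    obtain U where U: "open U" "N \<subseteq> U" "emeasure lborel (U - N) < \<delta>"
      using outer_regular_lborel[OF Nb(1) \<delta>(1)] by blast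
    have "emeasure lborel U = emeasure lborel (N \<union> (U - N))" using U(2) by (simp add: Un_absorb1)
    also have "\<dots> \<le> emeasure lborel N + emeasure lborel (U - N)"
      using U(1) Nb by (intro emeasure_subadditive) auto
    also have "\<dots> = emeasure lborel (U - N)" using Nb by simp
    finally have mU: "emeasure lborel U < \<delta>" using U(3) by simp
    \<comment> \<open>With this gauge every interval of the covering lies in the open set \<open>U\<close> of small measure.\<close>
    define \<gamma> where "\<gamma> x = (if x \<in> U then U else UNIV)" for x
    have "gauge \<gamma>" unfolding gauge_def \<gamma>_def using U(1) by auto
    have "N \<inter> {a..b} \<subseteq> cbox a b" "box a b \<noteq> {}" using ab by auto
    from this \<open>gauge \<gamma>\<close> show ?thesis
    proof (rule covering_lemma)
      fix \<D>
      assume \<D>: "countable \<D>" "\<Union>\<D> \<subseteq> cbox a b"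
          "\<And>K. K \<in> \<D> \<Longrightarrow> interior K \<noteq> {} \<and> (\<exists>c d. K = cbox c d)"
          "pairwise (\<lambda>A B. interior A \<inter> interior B = {}) \<D>"
          "\<And>K. K \<in> \<D> \<Longrightarrow> \<exists>x \<in> (N \<inter> {a..b}) \<inter> K. K \<subseteq> \<gamma> x" "N \<inter> {a..b} \<subseteq> \<Union>\<D>"
      have "\<forall>K\<in>\<D>. \<exists>c d. c < d \<and> K = {c..d}"
      proof
        fix K assume "K \<in> \<D>"
        from \<D>(3)[OF this] obtain c d where "K = {c..d}" "interior K \<noteq> {}" by (auto simp: cbox_interval)
        then show "\<exists>c d. c < d \<and> K = {c..d}" by auto
      qed
      then obtain p where "\<forall>K\<in>\<D>. \<exists>d. p K < d \<and> K = {p K..d}" by (rule bchoice[THEN exE])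
      then obtain q where "\<forall>K\<in>\<D>. p K < q K \<and> K = {p K..q K}" by (rule bchoice[THEN exE])
      then have pq: "\<And>K. K \<in> \<D> \<Longrightarrow> p K < q K \<and> K = {p K..q K}" by blast
      have KU: "K \<subseteq> U" if "K \<in> \<D>" for K using \<D>(5)[OF that] U(2) by (auto simp: \<gamma>_def split: if_splits)
      have Kab: "a \<le> p K \<and> q K \<le> b" if "K \<in> \<D>" for K
      proof -
        have "K \<subseteq> {a..b}" using \<D>(2) that by auto
        moreover have "p K \<in> K" "q K \<in> K" using pq[OF that] by (metis atLeastAtMost_iff less_imp_le order_refl)+
        ultimately show ?thesis by auto
      qed
      have fin: "emeasure \<mu> (\<Union>F) \<le> ennreal e" if F: "finite F" "F \<subseteq> \<D>" for F
      proof -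
        have dis: "{p K<..<q K} \<inter> {p L<..<q L} = {}" if "K \<in> F" "L \<in> F" "K \<noteq> L" for K L
        proof -
          have KL: "K \<in> \<D>" "L \<in> \<D>" using that F by auto
          have "interior K \<inter> interior L = {}" by (rule pairwiseD[OF \<D>(4) KL that(3)])
          moreover have "interior K = {p K<..<q K}" "interior L = {p L<..<q L}"
            using arg_cong[OF conjunct2[OF pq[OF KL(1)]], of interior]
              arg_cong[OF conjunct2[OF pq[OF KL(2)]], of interior] by simp_all
          ultimately show ?thesis by simp
        qed
        have "ennreal (\<Sum>K\<in>F. q K - p K) = (\<Sum>K\<in>F. ennreal (q K - p K))"
          using pq F by (subst sum_ennreal) (auto simp: subset_iff less_imp_le)
        also have "\<dots> = (\<Sum>K\<in>F. emeasure lborel {p K<..<q K})"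
          using pq F by (intro sum.cong) (auto simp: subset_iff less_imp_le)
        also have "\<dots> = emeasure lborel (\<Union>K\<in>F. {p K<..<q K})"
          using F dis by (intro sum_emeasure) (auto simp: disjoint_family_on_def)
        also have "\<dots> \<le> emeasure lborel U"
        proof (rule emeasure_mono)
          show "(\<Union>K\<in>F. {p K<..<q K}) \<subseteq> U"
            using KU pq F by (force simp: subset_iff)
        qed (use U(1) in auto)
        finally have "ennreal (\<Sum>K\<in>F. q K - p K) < ennreal \<delta>" using mU by simp
        then have "(\<Sum>K\<in>F. q K - p K) < \<delta>"
          by (metis ennreal_less_iff ennreal_less_zero_iff leI less_le_not_le ennreal_leI)
        moreover have "disjoint_intervals a b F p q"
          using pq Kab F dis by (auto simp: disjoint_intervals_def subset_iff less_imp_le)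
        ultimately have *: "(\<Sum>K\<in>F. edist (G (p K)) (G (q K))) < ennreal e" using \<delta>(2) by blast
        have "emeasure \<mu> (\<Union>F) = emeasure \<mu> (\<Union>K\<in>F. K)" by simp
        also have "\<dots> \<le> (\<Sum>K\<in>F. emeasure \<mu> K)"
        proof (rule emeasure_subadditive_finite[OF F(1)])
          show "(\<lambda>K. K) ` F \<subseteq> sets \<mu>" using pq F by (auto simp: sets_\<mu>) (metis atLeastAtMost_borel subsetD)
        qed
        also have "\<dots> = (\<Sum>K\<in>F. edist (G (p K)) (G (q K)))"
        proof (rule sum.cong[OF refl])
          fix K assume "K \<in> F"
          then have K: "K \<in> \<D>" using F by auto
          have "emeasure \<mu> K = ennreal (H (q K) - H (p K))"
            using \<mu>[of "p K" "q K"] pq[OF K] by (metis less_imp_le)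
          also have "\<dots> = ennreal (G (q K) - G (p K))" using H pq[OF K] Kab[OF K] by auto
          also have "\<dots> = edist (G (p K)) (G (q K))"
            using mono_onD[OF mono, of "p K" "q K"] pq[OF K] Kab[OF K] by (simp add: edist_def dist_real_def)
          finally show "emeasure \<mu> K = edist (G (p K)) (G (q K))" .
        qed
        finally show ?thesis using * by simp
      qed
      have "emeasure \<mu> (\<Union>\<D>) \<le> ennreal e"
      proof (cases "\<D> = {}")
        case False
        define f where "f = from_nat_into \<D>"
        have rf: "range f = \<D>" using False \<D>(1) by (simp add: f_def range_from_nat_into)
        have fm: "f n \<in> sets \<mu>" for n
          using pq[of "f n"] rf by (metis atLeastAtMost_borel rangeI sets_\<mu>)
        have "emeasure \<mu> (\<Union>\<D>) = emeasure \<mu> (\<Union>n. \<Union>i\<le>n. f i)"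
          by (rule arg_cong[where f="emeasure \<mu>"]) (auto simp flip: rf)
        also have "\<dots> = (SUP n. emeasure \<mu> (\<Union>i\<le>n. f i))"
          using fm by (intro SUP_emeasure_incseq[symmetric]) (auto simp: incseq_def intro!: sets.finite_UN, fastforce)
        also have "\<dots> \<le> ennreal e"
        proof (rule SUP_least)
          fix n show "emeasure \<mu> (\<Union>i\<le>n. f i) \<le> ennreal e"
            using rf by (intro fin[of "f ` {..n}"]) auto
        qed
        finally show ?thesis .
      qed simp
      moreover have "\<Union>\<D> \<in> sets \<mu>"
        using \<D>(1) pq by (intro sets.countable_Union) (auto simp: sets_\<mu>, metis atLeastAtMost_borel)
      ultimately show "emeasure \<mu> (N \<inter> {a..b}) \<le> ennreal e"
        using emeasure_mono[OF \<D>(6), of \<mu>] by (meson order_trans)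
    qed
  qed
  have "absolutely_continuous lborel \<mu>"
    unfolding absolutely_continuous_def
  proof
    fix N :: "real set" assume N: "N \<in> null_sets lborel"
    then have Nb: "N \<in> sets borel" by (auto simp: null_sets_def)
    have 1: "emeasure \<mu> (N \<inter> {a..b}) = 0"
      using small[OF N] by (metis ennreal_le_epsilon add_0 le_zero_eq)
    have "N \<inter> {a..b} \<in> null_sets \<mu>" "{..a} \<in> null_sets \<mu>" "{b..} \<in> null_sets \<mu>"
      using 1 left0 right0 Nb by (auto simp: null_sets_def sets_\<mu>)
    then have "(N \<inter> {a..b}) \<union> {..a} \<union> {b..} \<in> null_sets \<mu>" by blast
    then show "N \<in> null_sets \<mu>"
      by (rule null_sets_subset) (use Nb in \<open>auto simp: sets_\<mu>\<close>)
  qed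
  then obtain f where f: "f \<in> borel_measurable lborel" "density lborel f = \<mu>"
    using sigma_finite_measure.Radon_Nikodym[OF sigma_finite_lborel, of \<mu>] by (auto simp: sets_\<mu>)
  then have [measurable]: "f \<in> borel_measurable borel" by simp
  have f\<mu>: "(\<integral>\<^sup>+t. f t * indicator {a..x} t \<partial>lborel) = ennreal (G x - G a)" if "x \<in> {a..b}" for x
    using emeasure_density[OF f(1), of "{a..x}"] \<mu>[of a x] that f(2) H[of x] H[of a] ab by auto
  \<comment> \<open>The density is finite almost everywhere on \<open>{a..b}\<close>, where its integral is finite.\<close>
  define g where "g t = enn2real (f t * indicator {a..b} t)" for t
  have [measurable]: "g \<in> borel_measurable borel" unfolding g_def by measurable
  have fin: "AE t in lborel. f t * indicator {a..b} t \<noteq> \<infinity>"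
    by (rule nn_integral_PInf_AE) (use f\<mu>[of b] ab in \<open>auto\<close>)
  have gI: "((\<lambda>t. g t * indicator {a..x} t) has_integral (G x - G a)) UNIV" if x: "x \<in> {a..b}" for x
  proof (rule nn_integral_has_integral)
    have "(\<integral>\<^sup>+t. ennreal (g t * indicator {a..x} t) \<partial>lborel) = (\<integral>\<^sup>+t. f t * indicator {a..x} t \<partial>lborel)"
      by (rule nn_integral_cong_AE)
         (use fin in \<open>eventually_elim; use x in \<open>auto simp: g_def indicator_def ennreal_enn2real_if\<close>\<close>)
    then show "(\<integral>\<^sup>+t. ennreal (g t * indicator {a..x} t) \<partial>lborel) = ennreal (G x - G a)"
      using f\<mu>[OF x] by simp
    show "0 \<le> G x - G a" using mono_onD[OF mono, of a x] x by auto
  qed (auto simp: g_def)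
  have gI': "(g has_integral (G x - G a)) {a..x}" if x: "x \<in> {a..b}" for x
  proof -
    have "(\<lambda>t. g t * indicator {a..x} t) = (\<lambda>t. if t \<in> {a..x} then g t else 0)" by (auto simp: indicator_def)
    with gI[OF x] show ?thesis by (simp only: has_integral_restrict_UNIV)
  qed
  have "g absolutely_integrable_on {a..b}"
    by (rule nonnegative_absolutely_integrable_1) (use gI'[of b] ab in \<open>auto simp: g_def\<close>)
  then show ?thesis using gI' that by blast
qed

text \<open>The total variation of an absolutely continuous function is absolutely continuous, so the
  function is a difference of two monotone ones, each with a density.\<close>

lemma abs_continuous_real_has_density:
  fixes f :: "real \<Rightarrow> real"
  assumes ab: "a < b" and ac: "abs_continuous edist a b f"
  obtains g where "g absolutely_integrable_on {a..b}"
    "\<And>x. x \<in> {a..b} \<Longrightarrow> (g has_integral f x - f a) {a..x}"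
proof -
  let ?L = "\<lambda>x y. curve_length edist x y f"
  define V where "V x = enn2real (?L a x)" for x
  have ext: "?L a x + edist (f x) (f y) \<le> ?L a y" if "a \<le> x" "x \<le> y" for x y
    by (rule curve_length_extend[OF that])
  have finb: "?L a b < \<infinity>"
    using abs_continuous_curve_length_finite[OF ac edist_triangle] ab by simp
  have fin: "?L a x < \<infinity>" if "x \<in> {a..b}" for x
  proof -
    have "?L a x \<le> ?L a x + edist (f x) (f b)" by simp
    also have "\<dots> \<le> ?L a b" using ext[of x b] that by simp
    finally show ?thesis using finb by (rule le_less_trans)
  qed
  have V: "ennreal (V x) = ?L a x" if "x \<in> {a..b}" for x
    using fin[OF that] by (simp add: V_def)
  have V0: "0 \<le> V x" for x by (simp add: V_def)
  have Vf: "V x + \<bar>f y - f x\<bar> \<le> V y" if "a \<le> x" "x \<le> y" "y \<le> b" for x y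
  proof -
    have "ennreal (V x + \<bar>f y - f x\<bar>) \<le> ennreal (V y)"
      using ext[of x y] that V[of x] V[of y] V0
      by (simp add: edist_def dist_real_def abs_minus_commute)
    then show ?thesis using V0 by (simp add: ennreal_le_iff del: ennreal_plus)
  qed
  have VL: "edist (V x) (V y) \<le> ?L x y" if "a \<le> x" "x \<le> y" "y \<le> b" for x y
  proof -
    have "?L a y \<le> ?L a x + ?L x y"
      using that by (intro curve_length_subadditive edist_triangle)
    then have "ennreal (V y) \<le> ennreal (V x) + ?L x y" using V[of x] V[of y] that by simp
    moreover have "V x \<le> V y" using Vf[OF that] by linarith
    ultimately show ?thesis using V0
      by (cases "?L x y") (auto simp: edist_def dist_real_def simp flip: ennreal_plus)
  qed
  have sumV: "\<exists>\<delta>>0. \<forall>(n::nat) u v. disjoint_intervals a b {..<n} u v \<longrightarrow> (\<Sum>i<n. v i - u i) < \<delta> \<longrightarrow>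
      (\<Sum>i<n. edist (V (u i)) (V (v i))) \<le> e" if "e > 0" for e
  proof -
    obtain \<delta> where \<delta>: "\<delta> > 0" 
      "\<forall>(n::nat) u v. disjoint_intervals a b {..<n} u v \<longrightarrow> (\<Sum>i<n. v i - u i) < \<delta> \<longrightarrow>
        (\<Sum>i<n. ?L (u i) (v i)) \<le> e"
      using abs_continuous_curve_length[OF ac \<open>e > 0\<close>] by (elim exE conjE)
    show ?thesis
    proof (intro exI[of _ \<delta>] conjI allI impI \<delta>(1))
      fix n :: nat and u v
      assume uv: "disjoint_intervals a b {..<n} u v" "(\<Sum>i<n. v i - u i) < \<delta>"
      have "(\<Sum>i<n. edist (V (u i)) (V (v i))) \<le> (\<Sum>i<n. ?L (u i) (v i))"
        using uv(1) by (intro sum_mono VL) (auto simp: disjoint_intervals_def)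
      also have "\<dots> \<le> e" using \<delta>(2) uv by blast
      finally show "(\<Sum>i<n. edist (V (u i)) (V (v i))) \<le> e" .
    qed
  qed
  have acI: "abs_continuous edist a b W" if W: "\<And>x y. edist (W x) (W y) \<le> edist (V x) (V y) + edist (f x) (f y)" 
    for W :: "real \<Rightarrow> real"
    unfolding abs_continuous_iff
  proof (intro allI impI)
    fix e :: ennreal assume "e > 0"
    then obtain r where r: "r > 0" "ennreal r + ennreal r \<le> e" by (rule ennreal_halve)
    have r0: "ennreal r > 0" using r by simp
    obtain \<delta>1 where \<delta>1: "\<delta>1 > 0" "\<forall>(n::nat) u v. disjoint_intervals a b {..<n} u v \<longrightarrow> (\<Sum>i<n. v i - u i) < \<delta>1 \<longrightarrow>
      (\<Sum>i<n. edist (V (u i)) (V (v i))) \<le> ennreal r"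
      using sumV[OF r0] by blast
    obtain \<delta>2 where \<delta>2: "\<delta>2 > 0" "\<forall>(n::nat) u v. disjoint_intervals a b {..<n} u v \<longrightarrow> (\<Sum>i<n. v i - u i) < \<delta>2 \<longrightarrow>
        (\<Sum>i<n. edist (f (u i)) (f (v i))) < ennreal r"
      using ac r0 unfolding abs_continuous_iff by blast
    show "\<exists>\<delta>>0. \<forall>(n::nat) u v. disjoint_intervals a b {..<n} u v \<longrightarrow>
        (\<Sum>i<n. v i - u i) < \<delta> \<longrightarrow> (\<Sum>i<n. edist (W (u i)) (W (v i))) < e"
    proof (intro exI[of _ "min \<delta>1 \<delta>2"] conjI allI impI)
      fix n :: nat and u v :: "nat \<Rightarrow> real"
      assume uv: "disjoint_intervals a b {..<n} u v" and *: "(\<Sum>i<n. v i - u i) < min \<delta>1 \<delta>2"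
      have "(\<Sum>i<n. edist (W (u i)) (W (v i))) \<le>
          (\<Sum>i<n. edist (V (u i)) (V (v i))) + (\<Sum>i<n. edist (f (u i)) (f (v i)))"
        unfolding sum.distrib[symmetric] by (intro sum_mono W)
      also have "\<dots> < ennreal r + ennreal r"
      proof (rule ennreal_add_le_less)
        show "(\<Sum>i<n. edist (V (u i)) (V (v i))) \<le> ennreal r" using \<delta>1(2) uv * by (simp only: min_less_iff_conj)
        show "(\<Sum>i<n. edist (f (u i)) (f (v i))) < ennreal r" using \<delta>2(2) uv * by (simp only: min_less_iff_conj)
      qed simp
      finally show "(\<Sum>i<n. edist (W (u i)) (W (v i))) < e" using r(2) by simp
    qed (use \<delta>1(1) \<delta>2(1) in auto)
  qed
  have ac1: "abs_continuous edist a b V" by (rule acI) (simp add: add_increasing2)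
  have ac2: "abs_continuous edist a b (\<lambda>x. V x + f x)"
    by (rule acI) (auto simp: edist_def dist_real_def simp flip: ennreal_plus intro!: ennreal_leI)
  have mono1: "mono_on {a..b} V"
  proof (rule mono_onI)
    fix r s assume "r \<in> {a..b}" "s \<in> {a..b}" "r \<le> s"
    then show "V r \<le> V s" using Vf[of r s] by auto
  qed
  have mono2: "mono_on {a..b} (\<lambda>x. V x + f x)"
  proof (rule mono_onI)
    fix r s assume "r \<in> {a..b}" "s \<in> {a..b}" "r \<le> s"
    then show "V r + f r \<le> V s + f s" using Vf[of r s] by auto
  qed
  obtain g1 where g1: "g1 absolutely_integrable_on {a..b}" "\<And>x. x \<in> {a..b} \<Longrightarrow> (g1 has_integral V x - V a) {a..x}"
    using mono_abs_continuous_has_density[OF ab mono1 ac1] by blast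
  obtain g2 where g2: "g2 absolutely_integrable_on {a..b}"
      "\<And>x. x \<in> {a..b} \<Longrightarrow> (g2 has_integral (V x + f x) - (V a + f a)) {a..x}"
    using mono_abs_continuous_has_density[OF ab mono2 ac2] by blast
  show ?thesis
  proof
    show "(\<lambda>t. g2 t - g1 t) absolutely_integrable_on {a..b}" using g1 g2 by blast
    fix x assume "x \<in> {a..b}"
    from has_integral_diff[OF g2(2)[OF this] g1(2)[OF this]]
    show "((\<lambda>t. g2 t - g1 t) has_integral f x - f a) {a..x}" by (simp add: algebra_simps)
  qed
qed

lemma abs_continuous_has_density:
  fixes f :: "real \<Rightarrow> 'e::euclidean_space"
  assumes ab: "a < b" and ac: "abs_continuous edist a b f"
  obtains g where "g absolutely_integrable_on {a..b}"
    "\<And>x. x \<in> {a..b} \<Longrightarrow> (g has_integral f x - f a) {a..x}"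
proof -
  have "\<exists>g. g absolutely_integrable_on {a..b} \<and> (\<forall>x\<in>{a..b}. (g has_integral f x \<bullet> i - f a \<bullet> i) {a..x})"
    if i: "i \<in> Basis" for i
  proof -
    have "edist (x \<bullet> i) (y \<bullet> i) \<le> ennreal 1 * edist x y" for x y :: 'e
      using Basis_le_norm[OF i, of "x - y"] by (simp add: edist_def dist_norm inner_diff_left ennreal_leI)
    then have "abs_continuous edist a b (\<lambda>t. f t \<bullet> i)"
      by (intro abs_continuous_dominated[OF ac order_refl order_refl zero_less_one])
    from abs_continuous_real_has_density[OF ab this] show ?thesis by metis
  qed
  then have "\<forall>i\<in>Basis. \<exists>g. g absolutely_integrable_on {a..b} \<and> (\<forall>x\<in>{a..b}. (g has_integral f x \<bullet> i - f a \<bullet> i) {a..x})"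
    by blast
  then obtain g where g: "\<forall>i\<in>Basis. g i absolutely_integrable_on {a..b} \<and> (\<forall>x\<in>{a..b}. (g i has_integral f x \<bullet> i - f a \<bullet> i) {a..x})"
    by (rule bchoice[THEN exE])
  define G where "G t = (\<Sum>i\<in>Basis. g i t *\<^sub>R (i::'e))" for t
  have Gi: "G t \<bullet> i = g i t" if "i \<in> Basis" for t i
    using that by (simp add: G_def inner_sum_left inner_Basis if_distrib cong: if_cong)
  show ?thesis
  proof
    show "G absolutely_integrable_on {a..b}"
      by (subst absolutely_integrable_componentwise_iff) (use g Gi in auto)
    fix x assume x: "x \<in> {a..b}"
    show "(G has_integral f x - f a) {a..x}"
      by (subst has_integral_componentwise_iff) (use g Gi x in \<open>auto simp: inner_diff_left\<close>)
  qed
qed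

text \<open>In dimension 1 the differentiation theorem for cubes with a corner at \<open>x\<close> is one-sided; reflection
  supplies the other side.\<close>

lemma integrable_right_averages:
  fixes f :: "real \<Rightarrow> real"
  assumes "\<And>a b. f integrable_on {a..b}"
  shows "AE t in lebesgue. ((\<lambda>h. integral {t..t + h} f / h) \<longlongrightarrow> f t) (at_right 0)"
proof -
  obtain N where N: "negligible N"
    "\<And>x e. \<lbrakk>x \<notin> N; 0 < e\<rbrakk> \<Longrightarrow> \<exists>d>0. \<forall>h. 0 < h \<and> h < d \<longrightarrow>
       norm (integral (cbox x (x + h *\<^sub>R One)) f /\<^sub>R h ^ DIM(real) - f x) < e"
    using integrable_ccontinuous_explicit[of f] assms by (metis box_real(2))
  have "((\<lambda>h. integral {t..t + h} f / h) \<longlongrightarrow> f t) (at_right 0)" if "t \<notin> N" for t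
    unfolding tendsto_iff
  proof (intro allI impI)
    fix e :: real assume "e > 0"
    from N(2)[OF that this] obtain d where "d > 0" "\<forall>h. 0 < h \<and> h < d \<longrightarrow>
       norm (integral (cbox t (t + h *\<^sub>R One)) f /\<^sub>R h ^ DIM(real) - f t) < e" by blast
    then show "\<forall>\<^sub>F h in at_right 0. dist (integral {t..t + h} f / h) (f t) < e"
      unfolding eventually_at_right_field by (intro exI[of _ d]) (auto simp: dist_real_def divide_inverse_commute)
  qed
  then show ?thesis
    using N(1) by (intro AE_I'[of N]) (auto simp: negligible_iff_null_sets)
qed

lemma AE_lebesgue_uminus:
  assumes "AE t in lebesgue. P (t::real)"
  shows "AE t in lebesgue. P (- t)"
proof -
  obtain N where N: "N \<in> null_sets lebesgue" "{t. \<not> P t} \<subseteq> N"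
    using assms by (auto elim!: AE_E3 simp: eventually_ae_filter)
  have "negligible (uminus ` N)"
    using N(1) by (intro negligible_differentiable_image_negligible)
      (auto simp: negligible_iff_null_sets intro!: derivative_intros)
  moreover have "{t. \<not> P (- t)} \<subseteq> uminus ` N"
  proof
    fix t assume "t \<in> {t. \<not> P (- t)}"
    then have "- t \<in> N" using N(2) by auto
    then show "t \<in> uminus ` N" by (metis image_eqI minus_minus)
  qed
  ultimately show ?thesis by (intro AE_I'[of "uminus ` N"]) (auto simp: negligible_iff_null_sets)
qed

lemma integrable_symmetric_averages:
  fixes f :: "real \<Rightarrow> real"
  assumes int: "\<And>a b. f integrable_on {a..b}"
  shows "AE t in lebesgue. ((\<lambda>h. integral {t - h..t + h} f / h) \<longlongrightarrow> 2 * f t) (at_right 0)"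
proof -
  have int': "(\<lambda>x. f (- x)) integrable_on {a..b}" for a b
    using int[of "- b" "- a"] Henstock_Kurzweil_Integration.integrable_reflect_real[where f=f and a="- b" and b="- a"] by simp
  have "AE t in lebesgue. ((\<lambda>h. integral {- t..- t + h} (\<lambda>x. f (- x)) / h) \<longlongrightarrow> f t) (at_right 0)"
    using AE_lebesgue_uminus[OF integrable_right_averages[OF int']] by simp
  with integrable_right_averages[OF int] show ?thesis
  proof eventually_elim
    case (elim t)
    have "((\<lambda>h. integral {t..t + h} f / h + integral {- t..- t + h} (\<lambda>x. f (- x)) / h) \<longlongrightarrow> f t + f t) (at_right 0)"
      by (rule tendsto_add[OF elim])
    then show ?case
    proof (rule Lim_transform_eventually[THEN tendsto_eq_rhs])
      show "\<forall>\<^sub>F h in at_right 0. integral {t..t + h} f / h + integral {- t..- t + h} (\<lambda>x. f (- x)) / h = integral {t - h..t + h} f / h"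
      proof (rule eventually_at_rightI[of 0 1])
        fix h :: real assume "h \<in> {0<..<1}"
        then have "integral {t - h..t} f + integral {t..t + h} f = integral {t - h..t + h} f"
          by (intro Henstock_Kurzweil_Integration.integral_combine int) auto
        moreover have "integral {- t..- t + h} (\<lambda>x. f (- x)) = integral {t - h..t} f"
          using Henstock_Kurzweil_Integration.integral_reflect_real[where f=f and a="t - h" and b=t] by (simp add: algebra_simps)
        ultimately show "integral {t..t + h} f / h + integral {- t..- t + h} (\<lambda>x. f (- x)) / h = integral {t - h..t + h} f / h"
          by (simp add: add_divide_distrib[symmetric] algebra_simps)
      qed simp
    qed simp
  qed
qed

text \<open>Differentiation of \<open>norm (g u - q)\<close> for the countably many \<open>q\<close> in a dense set leaves one null set;
  outside it \<open>g t\<close> is approximated by such a \<open>q\<close>.\<close>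

lemma lebesgue_points:
  fixes g :: "real \<Rightarrow> 'e::euclidean_space"
  assumes int: "\<And>a b. g absolutely_integrable_on {a..b}"
  shows "AE t in lebesgue. ((\<lambda>h. integral {t - h..t + h} (\<lambda>u. norm (g u - g t)) / h) \<longlongrightarrow> 0) (at_right 0)"
proof -
  obtain Q :: "'e set" where Q: "countable Q" "\<And>S. open S \<Longrightarrow> S \<noteq> {} \<Longrightarrow> \<exists>q\<in>Q. q \<in> S"
    by (rule countable_dense_setE) blast
  have intq: "(\<lambda>u. norm (g u - q)) integrable_on {a..b}" for q a b
  proof -
    have "(\<lambda>u. g u - q) absolutely_integrable_on {a..b}"
      by (intro set_integral_diff(1) int) (auto simp: absolutely_integrable_on_const)
    then show ?thesis by (auto simp: absolutely_integrable_on_def)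
  qed
  have "AE t in lebesgue. \<forall>q\<in>Q. ((\<lambda>h. integral {t - h..t + h} (\<lambda>u. norm (g u - q)) / h) \<longlongrightarrow> 2 * norm (g t - q)) (at_right 0)"
    using Q(1) by (simp add: AE_ball_countable integrable_symmetric_averages[OF intq])
  then show ?thesis
  proof eventually_elim
    case (elim t)
    show ?case unfolding tendsto_iff
    proof (intro allI impI)
      fix e :: real assume "e > 0"
      \<comment> \<open>The distance from \<open>q\<close> to \<open>g t\<close> enters twice in the limit and twice in the triangle inequality.\<close>
      obtain q where q: "q \<in> Q" "q \<in> ball (g t) (e / 5)" using Q(2)[of "ball (g t) (e / 5)"] \<open>e > 0\<close> by auto
      then have nq: "norm (g t - q) < e / 5" by (simp add: dist_norm)
      have "\<forall>\<^sub>F h in at_right 0. integral {t - h..t + h} (\<lambda>u. norm (g u - q)) / h < 3 * e / 5"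
        using order_tendstoD(2)[OF elim[rule_format, OF q(1)], of "3 * e/5"] nq \<open>e > 0\<close> by simp
      moreover have "\<forall>\<^sub>F h in at_right (0::real). h > 0" by (simp add: eventually_at_right_less)
      ultimately show "\<forall>\<^sub>F h in at_right 0. dist (integral {t - h..t + h} (\<lambda>u. norm (g u - g t)) / h) 0 < e"
      proof eventually_elim
        case (elim h)
        have "integral {t - h..t + h} (\<lambda>u. norm (g u - g t)) \<le> integral {t - h..t + h} (\<lambda>u. norm (g u - q) + norm (g t - q))"
        proof (rule integral_le)
          show "(\<lambda>u. norm (g u - q) + norm (g t - q)) integrable_on {t - h..t + h}"
            by (intro integrable_add intq integrable_const_ivl)
          show "norm (g u - g t) \<le> norm (g u - q) + norm (g t - q)" for u
            using norm_triangle_ineq4[of "g u - q" "g t - q"] by simp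
        qed (rule intq)
        also have "\<dots> = integral {t - h..t + h} (\<lambda>u. norm (g u - q)) + 2 * h * norm (g t - q)"
          using elim by (subst Henstock_Kurzweil_Integration.integral_add) (auto simp: intq)
        finally have "integral {t - h..t + h} (\<lambda>u. norm (g u - g t)) / h \<le> integral {t - h..t + h} (\<lambda>u. norm (g u - q)) / h + 2 * norm (g t - q)"
          using elim by (simp add: field_simps)
        also have "\<dots> < 3 * e / 5 + 2 * (e / 5)" using elim nq by linarith
        finally have "integral {t - h..t + h} (\<lambda>u. norm (g u - g t)) / h < e" by simp
        moreover have "0 \<le> integral {t - h..t + h} (\<lambda>u. norm (g u - g t)) / h"
          using elim by (intro divide_nonneg_pos Henstock_Kurzweil_Integration.integral_nonneg intq) auto
        ultimately show ?case by simp
      qed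
    qed
  qed
qed

text \<open>At a Lebesgue point of the density the difference quotients converge to it, as they differ from it
  by averages of \<open>g u - g t\<close>.\<close>

lemma abs_continuous_lebesgue_points:
  fixes f :: "real \<Rightarrow> 'e::euclidean_space"
  assumes ab: "a < b" and ac: "abs_continuous edist a b f"
  obtains g where "g absolutely_integrable_on UNIV"
    "AE t in lebesgue. t \<in> {a..b} \<longrightarrow> t \<in> {a<..<b} \<and> (f has_vector_derivative g t) (at t) \<and>
      ((\<lambda>h. integral {t - h..t + h} (\<lambda>u. norm (g u - g t)) / h) \<longlongrightarrow> 0) (at_right 0)"
proof -
  obtain g0 where g0: "g0 absolutely_integrable_on {a..b}"
    "\<And>x. x \<in> {a..b} \<Longrightarrow> (g0 has_integral f x - f a) {a..x}"
    using abs_continuous_has_density[OF assms] by blast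
  \<comment> \<open>Extended by 0, as symmetric intervals around a point may leave \<open>{a..b}\<close>.\<close>
  define g where "g t = (if t \<in> {a..b} then g0 t else 0)" for t
  have gU: "g absolutely_integrable_on UNIV"
    unfolding g_def absolutely_integrable_restrict_UNIV by (rule g0(1))
  then have gabs: "g absolutely_integrable_on {x..y}" for x y
    by (rule set_integrable_subset) auto
  then have gint: "g integrable_on {x..y}" for x y
    by (simp add: absolutely_integrable_on_def)
  have gnint: "(\<lambda>u. norm (g u - c)) integrable_on {x..y}" for x y c
  proof -
    have "(\<lambda>u. g u - c) absolutely_integrable_on {x..y}"
      by (intro set_integral_diff(1) gabs) (auto simp: absolutely_integrable_on_const)
    then show ?thesis by (auto simp: absolutely_integrable_on_def)
  qed
  have gI: "integral {a..x} g = f x - f a" if "x \<in> {a..b}" for x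
  proof -
    have "(g has_integral f x - f a) {a..x}"
      by (rule has_integral_eq[OF _ g0(2)[OF that]]) (use that in \<open>auto simp: g_def\<close>)
    then show ?thesis by (rule integral_unique)
  qed
  have gI2: "integral {x..y} g = f y - f x" if "a \<le> x" "x \<le> y" "y \<le> b" for x y
    using Henstock_Kurzweil_Integration.integral_combine[of a x y g, OF that(1,2) gint] gI[of x] gI[of y] that
    by (simp add: algebra_simps)
  have "AE t in lebesgue. t \<noteq> a \<and> t \<noteq> b"
    by (intro AE_conjI AE_completion AE_lborel_singleton)
  with lebesgue_points[OF gabs] have "AE t in lebesgue. t \<in> {a..b} \<longrightarrow> t \<in> {a<..<b} \<and> (f has_vector_derivative g t) (at t) \<and>
      ((\<lambda>h. integral {t - h..t + h} (\<lambda>u. norm (g u - g t)) / h) \<longlongrightarrow> 0) (at_right 0)"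
  proof eventually_elim
    case (elim t)
    have "(f has_vector_derivative g t) (at t)" if t: "t \<in> {a<..<b}"
      unfolding has_vector_derivative_def has_derivative_iff_norm
    proof (intro conjI bounded_linear_scaleR_left)
      let ?A = "\<lambda>h. integral {t - h..t + h} (\<lambda>u. norm (g u - g t)) / h"
      have lim: "((\<lambda>y. ?A (norm (y - t))) \<longlongrightarrow> 0) (at t)"
      proof (rule filterlim_compose[OF elim(1)])
        show "filterlim (\<lambda>y. norm (y - t)) (at_right 0) (at t)"
          unfolding filterlim_at using tendsto_norm[OF tendsto_diff[OF tendsto_ident_at tendsto_const[of t]], of t UNIV]
          by (auto simp: eventually_at_filter)
      qed
      show "((\<lambda>y. norm (f y - f t - (y - t) *\<^sub>R g t) / norm (y - t)) \<longlongrightarrow> 0) (at t)"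
      proof (rule Lim_null_comparison[OF _ lim])
        have "\<forall>\<^sub>F y in at t. y \<in> {a<..<b}" using t by (intro eventually_at_in_open') auto
        moreover have "\<forall>\<^sub>F y in at t. y \<noteq> t" by (simp add: eventually_at_filter)
        ultimately show "\<forall>\<^sub>F y in at t. norm (norm (f y - f t - (y - t) *\<^sub>R g t) / norm (y - t)) \<le> ?A (norm (y - t))"
        proof eventually_elim
          case (elim y)
          define p q where "p = min t y" and "q = max t y"
          have pq: "a \<le> p" "p \<le> q" "q \<le> b" using elim t by (auto simp: p_def q_def)
          have "integral {p..q} (\<lambda>u. g u - g t) = (f q - f p) - (q - p) *\<^sub>R g t"
            using gI2[OF pq] pq gint by (subst Henstock_Kurzweil_Integration.integral_diff) auto
          moreover have "norm (f y - f t - (y - t) *\<^sub>R g t) = norm ((f q - f p) - (q - p) *\<^sub>R g t)"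
          proof (cases "t \<le> y")
            case False
            then have "f y - f t - (y - t) *\<^sub>R g t = - ((f q - f p) - (q - p) *\<^sub>R g t)"
              by (simp add: p_def q_def algebra_simps)
            then show ?thesis by (simp only: norm_minus_cancel)
          qed (simp add: p_def q_def)
          ultimately have "norm (f y - f t - (y - t) *\<^sub>R g t) = norm (integral {p..q} (\<lambda>u. g u - g t))"
            by simp
          also have "\<dots> \<le> integral {p..q} (\<lambda>u. norm (g u - g t))"
            by (intro integral_norm_bound_integral gnint integrable_diff gint) auto
          also have "\<dots> \<le> integral {t - norm (y - t)..t + norm (y - t)} (\<lambda>u. norm (g u - g t))"
            by (intro integral_subset_le gnint) (auto simp: p_def q_def)
          finally show ?case by (simp add: divide_right_mono)
        qed
      qed
    qed
    then show ?case using elim by auto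
  qed
  with gU show ?thesis by (rule that)
qed



section \<open>Inner products on a Euclidean space\<close>

definition inner_form :: "('e::euclidean_space \<Rightarrow> 'e \<Rightarrow> real) \<Rightarrow> bool" where
  "inner_form B \<longleftrightarrow> bilinear B \<and> (\<forall>v w. B v w = B w v) \<and> (\<forall>v. v \<noteq> 0 \<longrightarrow> B v v > 0)"

definition form_norm :: "('e::euclidean_space \<Rightarrow> 'e \<Rightarrow> real) \<Rightarrow> 'e \<Rightarrow> real" where
  "form_norm B v = sqrt (B v v)"

context
  fixes B :: "'e::euclidean_space \<Rightarrow> 'e \<Rightarrow> real"
  assumes B: "inner_form B"
begin

lemma inner_form_bilinear: "bilinear B" and inner_form_sym: "B v w = B w v"
  and inner_form_pos: "v \<noteq> 0 \<Longrightarrow> B v v > 0"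
  using B by (auto simp: inner_form_def)

lemma inner_form_nonneg: "B v v \<ge> 0"
  using inner_form_pos[of v] bilinear_lzero[OF inner_form_bilinear] by (cases "v = 0") auto

lemma form_norm_nonneg: "form_norm B v \<ge> 0" by (simp add: form_norm_def inner_form_nonneg)

lemma form_norm_power2: "(form_norm B v)\<^sup>2 = B v v" by (simp add: form_norm_def inner_form_nonneg)

lemma form_norm_scale: "form_norm B (k *\<^sub>R v) = \<bar>k\<bar> * form_norm B v"
  by (simp add: form_norm_def bilinear_lmul[OF inner_form_bilinear] bilinear_rmul[OF inner_form_bilinear]
      real_sqrt_mult flip: mult.assoc)

lemma form_norm_minus: "form_norm B (- v) = form_norm B v"
  using form_norm_scale[of "-1" v] by simp

lemma form_Cauchy_Schwarz: "B v w \<le> form_norm B v * form_norm B w"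
proof (cases "w = 0")
  case True
  then show ?thesis by (simp add: bilinear_rzero[OF inner_form_bilinear] form_norm_nonneg)
next
  case False
  note bl = inner_form_bilinear
  have pos: "B w w > 0" using inner_form_pos[OF False] .
  define t where "t = B v w / B w w"
  have "0 \<le> B (v - t *\<^sub>R w) (v - t *\<^sub>R w)" by (rule inner_form_nonneg)
  also have "\<dots> = B v v - 2 * t * B v w + t * t * B w w"
    by (simp add: bilinear_lsub[OF bl] bilinear_rsub[OF bl] bilinear_lmul[OF bl] bilinear_rmul[OF bl]
        inner_form_sym[of w v] algebra_simps)
  also have "\<dots> = B v v - (B v w)\<^sup>2 / B w w"
    using pos by (simp add: t_def field_simps power2_eq_square)
  finally have "(B v w)\<^sup>2 \<le> B v v * B w w" using pos by (simp add: field_simps)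
  then have "sqrt ((B v w)\<^sup>2) \<le> sqrt (B v v * B w w)" by (rule real_sqrt_le_mono)
  then show ?thesis by (simp add: form_norm_def real_sqrt_mult)
qed

lemma form_norm_triangle: "form_norm B (v + w) \<le> form_norm B v + form_norm B w"
proof (rule power2_le_imp_le)
  note bl = inner_form_bilinear
  have "(form_norm B (v + w))\<^sup>2 = B v v + 2 * B v w + B w w"
    by (simp add: form_norm_power2 bilinear_ladd[OF bl] bilinear_radd[OF bl] inner_form_sym[of w v])
  also have "\<dots> \<le> (form_norm B v + form_norm B w)\<^sup>2"
    using form_Cauchy_Schwarz[of v w] by (simp add: power2_sum form_norm_power2)
  finally show "(form_norm B (v + w))\<^sup>2 \<le> (form_norm B v + form_norm B w)\<^sup>2" .
qed (simp add: form_norm_nonneg)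

lemma form_norm_triangle_diff: "\<bar>form_norm B v - form_norm B w\<bar> \<le> form_norm B (v - w)"
  using form_norm_triangle[of "v - w" w] form_norm_triangle[of "w - v" v] form_norm_minus[of "v - w"]
  by simp

lemma form_continuous: "continuous_on S (\<lambda>v. B v v)"
  using inner_form_bilinear unfolding bilinear_conv_bounded_bilinear
  by (rule bounded_bilinear.continuous_on) (auto intro: continuous_intros)

lemma form_norm_continuous: "continuous_on S (form_norm B)"
  unfolding form_norm_def by (intro continuous_intros form_continuous)

lemma form_norm_upper: obtains M where "M > 0" "\<And>v. form_norm B v \<le> M * norm v"
proof -
  obtain K where K: "K > 0" "\<And>v w. norm (B v w) \<le> K * norm v * norm w"
    using bilinear_bounded_pos[OF inner_form_bilinear] by blast
  have "form_norm B v \<le> sqrt K * norm v" for v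
  proof -
    have "B v v \<le> K * (norm v)\<^sup>2" using K(2)[of v v] by (simp add: power2_eq_square)
    then have "sqrt (B v v) \<le> sqrt (K * (norm v)\<^sup>2)" by (rule real_sqrt_le_mono)
    then show ?thesis by (simp add: form_norm_def real_sqrt_mult)
  qed
  then show ?thesis using that[of "sqrt K"] K(1) by auto
qed

lemma form_norm_lower: obtains m where "m > 0" "\<And>v. m * norm v \<le> form_norm B v"
proof -
  let ?S = "sphere (0::'e) 1"
  obtain i :: 'e where i: "i \<in> Basis" using nonempty_Basis by blast
  then have "?S \<noteq> {}" by (auto intro!: exI[of _ i])
  then obtain v0 where v0: "v0 \<in> ?S" "\<And>v. v \<in> ?S \<Longrightarrow> form_norm B v0 \<le> form_norm B v"
    using continuous_attains_inf[OF compact_sphere _ form_norm_continuous[of ?S]] by blast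
  have pos: "form_norm B v0 > 0"
  proof -
    have "v0 \<noteq> 0" using v0(1) by auto
    then show ?thesis using inner_form_pos by (simp add: form_norm_def)
  qed
  have "form_norm B v0 * norm v \<le> form_norm B v" for v
  proof (cases "v = 0")
    case False
    have "form_norm B v0 \<le> form_norm B ((1 / norm v) *\<^sub>R v)" using False by (intro v0(2)) simp
    then show ?thesis using False by (simp add: form_norm_scale field_simps)
  qed (simp add: form_norm_nonneg)
  then show ?thesis using pos that by blast
qed

lemma form_norm_0 [simp]: "form_norm B 0 = 0"
  by (simp add: form_norm_def bilinear_lzero[OF inner_form_bilinear])

text \<open>A form whose matrix is close to that of \<open>B\<close> is close to \<open>B\<close> with a relative error, since
  \<open>B\<close> dominates the Euclidean square.\<close>

lemma inner_form_perturb: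
  assumes "\<epsilon> > 0"
  shows "\<exists>\<eta>>0. \<forall>B'. inner_form B' \<and> (\<forall>i\<in>Basis. \<forall>j\<in>Basis. \<bar>B' i j - B i j\<bar> < \<eta>) \<longrightarrow>
    (\<forall>v. (1 - \<epsilon>) * form_norm B v \<le> form_norm B' v \<and> form_norm B' v \<le> (1 + \<epsilon>) * form_norm B v)"
proof -
  obtain m where m: "m > 0" "\<And>v. m * norm v \<le> form_norm B v" by (rule form_norm_lower) blast
  \<comment> \<open>The matrix has \<open>DIM('e)\<^sup>2\<close> entries, and \<open>m\<^sup>2\<close> compares the Euclidean square with \<open>B\<close>.\<close>
  define \<eta> where "\<eta> = \<epsilon> * m\<^sup>2 / (DIM('e))\<^sup>2"
  have \<eta>: "\<eta> > 0" using m(1) assms by (simp add: \<eta>_def)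
  show ?thesis
  proof (intro exI[of _ \<eta>] conjI \<eta> allI impI)
    fix B' v assume B': "inner_form B' \<and> (\<forall>i\<in>Basis. \<forall>j\<in>Basis. \<bar>B' i j - B i j\<bar> < \<eta>)"
    have bl': "bilinear B'" using B' by (simp add: inner_form_def)
    have nn': "B' v v \<ge> 0" using B' bilinear_lzero[OF bl'] by (cases "v = 0") (auto simp: inner_form_def less_imp_le)
    have expand: "D v v = (\<Sum>i\<in>Basis. \<Sum>j\<in>Basis. (v \<bullet> i) * (v \<bullet> j) * D i j)" if D: "bilinear D" for D :: "'e \<Rightarrow> 'e \<Rightarrow> real"
    proof -
      have "D v v = D (\<Sum>i\<in>Basis. (v \<bullet> i) *\<^sub>R i) (\<Sum>j\<in>Basis. (v \<bullet> j) *\<^sub>R j)" by (simp add: euclidean_representation)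
      also have "\<dots> = (\<Sum>(i, j)\<in>Basis \<times> Basis. D ((v \<bullet> i) *\<^sub>R i) ((v \<bullet> j) *\<^sub>R j))"
        by (rule bilinear_sum[OF D])
      finally show ?thesis
        by (simp add: bilinear_lmul[OF D] bilinear_rmul[OF D] sum.cartesian_product mult_ac)
    qed
    have "\<bar>B' v v - B v v\<bar> = \<bar>\<Sum>i\<in>Basis. \<Sum>j\<in>Basis. (v \<bullet> i) * (v \<bullet> j) * (B' i j - B i j)\<bar>"
      by (simp add: expand[OF bl'] expand[OF inner_form_bilinear] right_diff_distrib sum_subtractf)
    also have "\<dots> \<le> (\<Sum>i\<in>Basis. \<Sum>j\<in>Basis. \<bar>(v \<bullet> i) * (v \<bullet> j) * (B' i j - B i j)\<bar>)"
      by (intro order_trans[OF sum_abs] sum_mono sum_abs)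
    also have "\<dots> \<le> (\<Sum>i\<in>(Basis::'e set). \<Sum>j\<in>(Basis::'e set). norm v * norm v * \<eta>)"
      unfolding abs_mult using B' by (intro sum_mono mult_mono) (auto simp: Basis_le_norm less_imp_le)
    also have "\<dots> = \<epsilon> * (m * norm v)\<^sup>2" by (simp add: \<eta>_def power2_eq_square)
    also have "\<dots> \<le> \<epsilon> * (form_norm B v)\<^sup>2"
      using m assms by (intro mult_left_mono power_mono) auto
    finally have bd: "\<bar>B' v v - B v v\<bar> \<le> \<epsilon> * B v v" by (simp add: form_norm_power2)
    let ?b = "form_norm B v" and ?b' = "form_norm B' v"
    have b'2: "?b'\<^sup>2 = B' v v" using nn' by (simp add: form_norm_def)
    have b'0: "?b' \<ge> 0" using nn' by (simp add: form_norm_def)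
    have "?b' \<le> (1 + \<epsilon>) * ?b"
    proof (rule power2_le_imp_le)
      have "?b'\<^sup>2 \<le> (1 + \<epsilon>) * ?b\<^sup>2" using bd by (simp add: b'2 form_norm_power2 algebra_simps)
      also have "\<dots> \<le> (1 + \<epsilon>)\<^sup>2 * ?b\<^sup>2"
        using assms by (intro mult_right_mono) (auto simp: power2_eq_square algebra_simps)
      finally show "?b'\<^sup>2 \<le> ((1 + \<epsilon>) * ?b)\<^sup>2" by (simp add: power_mult_distrib)
    qed (use assms form_norm_nonneg in auto)
    moreover have "(1 - \<epsilon>) * ?b \<le> ?b'"
    proof (cases "\<epsilon> \<le> 1")
      case True
      show ?thesis
      proof (rule power2_le_imp_le)
        have "((1 - \<epsilon>) * ?b)\<^sup>2 = (1 - \<epsilon>) * (1 - \<epsilon>) * ?b\<^sup>2" by (simp add: power2_eq_square)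
        also have "\<dots> \<le> (1 - \<epsilon>) * 1 * ?b\<^sup>2"
          using True assms by (intro mult_right_mono mult_left_mono) auto
        also have "\<dots> \<le> ?b'\<^sup>2" using bd by (simp add: b'2 form_norm_power2 algebra_simps)
        finally show "((1 - \<epsilon>) * ?b)\<^sup>2 \<le> ?b'\<^sup>2" .
      qed (rule b'0)
    next
      case False
      then have "(1 - \<epsilon>) * ?b \<le> 0" using form_norm_nonneg[of v] by (simp add: mult_nonpos_nonneg)
      then show ?thesis using b'0 by simp
    qed
    ultimately show "(1 - \<epsilon>) * ?b \<le> ?b'" "?b' \<le> (1 + \<epsilon>) * ?b" by blast+
  qed
qed

end

section \<open>Charts and tangent vectors\<close>

locale manifold =
  fixes A :: "('a::{t2_space,second_countable_topology}, 'e::euclidean_space) chart set"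
  assumes atlas: "smooth_atlas A"
begin

lemma chart_at: obtains c where "c \<in> A" "p \<in> fst c"
  using atlas unfolding smooth_atlas_def by blast

context
  fixes c assumes c: "c \<in> A"
begin

lemma open_chart: "open (fst c)" and open_chart_image: "open (snd c ` fst c)"
  using atlas c by (auto simp: smooth_atlas_def)

lemma chart_homeomorphism: "homeomorphism (fst c) (snd c ` fst c) (snd c) (inv_into (fst c) (snd c))"
proof -
  obtain \<psi> where \<psi>: "homeomorphism (fst c) (snd c ` fst c) (snd c) \<psi>"
    using atlas c unfolding smooth_atlas_def by blast
  then have inj: "inj_on (snd c) (fst c)" by (metis homeomorphism_apply1 inj_on_inverseI)
  show ?thesis
    by (rule homeomorphism_cong[OF \<psi>]) (use inj \<psi> in \<open>auto simp: homeomorphism_apply1\<close>)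
qed

lemma chart_continuous: "continuous_on (fst c) (snd c)"
  and chart_inv_continuous: "continuous_on (snd c ` fst c) (inv_into (fst c) (snd c))"
  using chart_homeomorphism by (auto simp: homeomorphism_def)

lemma chart_inj: "inj_on (snd c) (fst c)"
  using chart_homeomorphism by (metis homeomorphism_apply1 inj_on_inverseI)

lemma chart_inv [simp]: "p \<in> fst c \<Longrightarrow> inv_into (fst c) (snd c) (snd c p) = p"
  using chart_inj by simp

lemma open_chart_image_subset: "open W \<Longrightarrow> W \<subseteq> fst c \<Longrightarrow> open (snd c ` W)"
  using homeomorphism_imp_open_map[OF chart_homeomorphism, of W] open_chart open_chart_image
  by (simp add: openin_open_eq)

lemma open_chart_preimage:
  assumes "open V" shows "open {p \<in> fst c. snd c p \<in> V}"
proof -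
  have "{p \<in> fst c. snd c p \<in> V} = fst c \<inter> snd c -` V" by auto
  then show ?thesis using continuous_open_preimage[OF chart_continuous open_chart assms] by simp
qed

lemma compact_chart_preimage:
  assumes "compact K" "K \<subseteq> snd c ` fst c"
  shows "compact {p \<in> fst c. snd c p \<in> K}"
proof -
  have "{p \<in> fst c. snd c p \<in> K} = inv_into (fst c) (snd c) ` K"
  proof (intro set_eqI iffI)
    fix p assume "p \<in> {p \<in> fst c. snd c p \<in> K}"
    then have "p = inv_into (fst c) (snd c) (snd c p)" "snd c p \<in> K" by auto
    then show "p \<in> inv_into (fst c) (snd c) ` K" by (rule image_eqI)
  next
    fix p assume "p \<in> inv_into (fst c) (snd c) ` K"
    then show "p \<in> {p \<in> fst c. snd c p \<in> K}" using assms(2) by (auto simp: inv_into_into f_inv_into_f)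
  qed
  then show ?thesis
    using compact_continuous_image[OF continuous_on_subset[OF chart_inv_continuous assms(2)] assms(1)] by simp
qed

end

lemma transition_apply: "c \<in> A \<Longrightarrow> p \<in> fst c \<Longrightarrow> transition c c' (snd c p) = snd c' p"
  by (simp add: transition_def)

lemma transition_C1:
  assumes "c \<in> A" "c' \<in> A"
  shows "Ck_on (Suc 0) (transition c c') (snd c ` (fst c \<inter> fst c'))"
  using atlas assms unfolding smooth_atlas_def smooth_on_def by blast

lemma transition_has_derivative:
  assumes "c \<in> A" "c' \<in> A" "p \<in> fst c \<inter> fst c'"
  shows "(transition c c' has_derivative coord_change p c c') (at (snd c p))"
  unfolding coord_change_def
  by (rule frechet_derivative_works[THEN iffD1])
     (use transition_C1[OF assms(1,2)] assms(3) in auto)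

lemma coord_change_linear:
  assumes "c \<in> A" "c' \<in> A" "p \<in> fst c \<inter> fst c'"
  shows "linear (coord_change p c c')"
  using transition_has_derivative[OF assms] by (rule has_derivative_linear)

lemma coord_change_continuous:
  assumes "c \<in> A" "c' \<in> A"
  shows "continuous_on (fst c \<inter> fst c') (\<lambda>p. coord_change p c c' v)"
proof -
  have "continuous_on (snd c ` (fst c \<inter> fst c')) (\<lambda>x. frechet_derivative (transition c c') (at x) v)"
    using transition_C1[OF assms] by simp
  moreover have "continuous_on (fst c \<inter> fst c') (snd c)"
    by (rule continuous_on_subset[OF chart_continuous[OF assms(1)]]) auto
  ultimately show ?thesis
    unfolding coord_change_def by (rule continuous_on_compose2) simp
qed

text \<open>Continuity of \<open>\<beta>\<close> is assumed separately: a coordinate map is arbitrary outside its domain, so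
  differentiability of \<open>snd c \<circ> \<beta>\<close> does not keep \<open>\<beta>\<close> in the domain near \<open>t\<close>.\<close>

lemma change_chart_has_vector_derivative:
  assumes c: "c \<in> A" "c' \<in> A" and p: "\<beta> t \<in> fst c \<inter> fst c'"
    and cont: "continuous (at t within J) \<beta>"
    and D: "((snd c \<circ> \<beta>) has_vector_derivative D) (at t within J)" and t: "t \<in> J"
  shows "((snd c' \<circ> \<beta>) has_vector_derivative coord_change (\<beta> t) c c' D) (at t within J)"
proof -
  have "((transition c c' \<circ> (snd c \<circ> \<beta>)) has_vector_derivative coord_change (\<beta> t) c c' D) (at t within J)"
  proof -
    have "(transition c c' has_derivative coord_change (\<beta> t) c c') (at ((snd c \<circ> \<beta>) t))"
      using transition_has_derivative[OF c p] by simp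
    then have "(transition c c' has_derivative coord_change (\<beta> t) c c') (at ((snd c \<circ> \<beta>) t) within (snd c \<circ> \<beta>) ` J)"
      by (rule has_derivative_at_withinI)
    from vector_derivative_diff_chain_within[OF D this] show ?thesis .
  qed
  moreover have "\<forall>\<^sub>F u in at t within J. \<beta> u \<in> fst c \<inter> fst c'"
    using cont p open_chart[OF c(1)] open_chart[OF c(2)]
    unfolding continuous_within by (intro topological_tendstoD) auto
  then have "\<forall>\<^sub>F u in at t within J. (transition c c' \<circ> (snd c \<circ> \<beta>)) u = (snd c' \<circ> \<beta>) u"
    by eventually_elim (simp add: transition_apply[OF c(1)])
  ultimately show ?thesis
    unfolding has_vector_derivative_def
    by (rule has_derivative_transform_eventually) (use p t in \<open>auto simp: transition_apply[OF c(1)]\<close>)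
qed

lemma coord_change_cocycle:
  assumes c: "c \<in> A" "c' \<in> A" "c'' \<in> A" and p: "p \<in> fst c \<inter> fst c' \<inter> fst c''"
  shows "coord_change p c' c'' (coord_change p c c' v) = coord_change p c c'' v"
proof -
  have 1: "(transition c c' has_derivative coord_change p c c') (at (snd c p))"
    using transition_has_derivative[of c c' p] c p by auto
  have 2: "(transition c' c'' has_derivative coord_change p c' c'') (at (transition c c' (snd c p)))"
    using transition_has_derivative[of c' c'' p] c p by (simp add: transition_apply)
  have "((transition c' c'' \<circ> transition c c') has_derivative (coord_change p c' c'' \<circ> coord_change p c c')) (at (snd c p))"
    by (rule diff_chain_at[OF 1 2])
  moreover have "\<forall>\<^sub>F x in at (snd c p). (transition c' c'' \<circ> transition c c') x = transition c c'' x"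
  proof -
    have "open (snd c ` (fst c \<inter> fst c' \<inter> fst c''))"
      by (intro open_chart_image_subset[OF c(1)] open_Int open_chart c) auto
    then have "\<forall>\<^sub>F x in at (snd c p). x \<in> snd c ` (fst c \<inter> fst c' \<inter> fst c'')"
      using p by (intro eventually_at_in_open') auto
    then show ?thesis
      by eventually_elim (use c in \<open>auto simp: transition_apply\<close>)
  qed
  ultimately have "(transition c c'' has_derivative (coord_change p c' c'' \<circ> coord_change p c c')) (at (snd c p))"
    using p c by (elim has_derivative_transform_eventually) (auto simp: transition_apply)
  moreover have "(transition c c'' has_derivative coord_change p c c'') (at (snd c p))"
    using transition_has_derivative[of c c'' p] c p by auto
  ultimately have "coord_change p c' c'' \<circ> coord_change p c c' = coord_change p c c''"
    by (rule has_derivative_unique)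
  then show ?thesis by (metis comp_apply)
qed

lemma coord_change_refl:
  assumes "c \<in> A" "p \<in> fst c"
  shows "coord_change p c c v = v"
proof -
  have "((\<lambda>x. x) has_derivative (\<lambda>x. x)) (at (snd c p))" by (rule has_derivative_ident)
  moreover have "\<forall>\<^sub>F x in at (snd c p). x = transition c c x"
  proof -
    have "\<forall>\<^sub>F x in at (snd c p). x \<in> snd c ` fst c"
      using open_chart_image[OF assms(1)] assms(2) by (intro eventually_at_in_open') auto
    then show ?thesis
      by eventually_elim (use assms in \<open>auto simp: transition_apply\<close>)
  qed
  ultimately have "(transition c c has_derivative (\<lambda>x. x)) (at (snd c p))"
    using assms by (elim has_derivative_transform_eventually) (auto simp: transition_apply)
  then have "coord_change p c c = (\<lambda>x. x)"
    using transition_has_derivative[of c c p] assms by (intro has_derivative_unique) auto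
  then show ?thesis by simp
qed

lemma coord_vector_apply [simp]:
  "c \<in> A \<Longrightarrow> p \<in> fst c \<Longrightarrow> coord_vector A p c v c = v"
  by (simp add: coord_vector_def coord_change_refl)

lemma coord_vector_in_tangent_space:
  assumes "c \<in> A" "p \<in> fst c"
  shows "coord_vector A p c v \<in> tangent_space A p"
  using assms by (auto simp: tangent_space_def coord_vector_def coord_change_cocycle)

lemma tangent_space_coord_vector:
  assumes "c \<in> A" "p \<in> fst c" "V \<in> tangent_space A p"
  shows "V = coord_vector A p c (V c)"
proof
  fix c'
  show "V c' = coord_vector A p c (V c) c'"
  proof (cases "c' \<in> A \<and> p \<in> fst c'")
    case True
    then have "V c' = coord_change p c c' (V c)"
      using assms unfolding tangent_space_def by blast
    then show ?thesis using True by (simp add: coord_vector_def)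
  next
    case False
    then have "V c' = 0" using assms(3) unfolding tangent_space_def by blast
    then show ?thesis using False by (simp only: coord_vector_def if_False)
  qed
qed

lemma coord_vector_linear:
  assumes "c \<in> A" "p \<in> fst c"
  shows "coord_vector A p c (k *\<^sub>R v + w) = (\<lambda>c'. k *\<^sub>R coord_vector A p c v c' + coord_vector A p c w c')"
proof
  fix c'
  show "coord_vector A p c (k *\<^sub>R v + w) c' = k *\<^sub>R coord_vector A p c v c' + coord_vector A p c w c'"
  proof (cases "c' \<in> A \<and> p \<in> fst c'")
    case True
    then have "linear (coord_change p c c')" using assms by (intro coord_change_linear) auto
    then show ?thesis using True by (simp add: coord_vector_def linear_add linear_scale)
  qed (auto simp: coord_vector_def)
qed

lemma coord_vector_0: "c \<in> A \<Longrightarrow> p \<in> fst c \<Longrightarrow> coord_vector A p c 0 = (\<lambda>_. 0)"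
  using coord_vector_linear[of c p "-1" 0 0] by simp

lemma tangent_space_0: "(\<lambda>_. 0) \<in> tangent_space A p"
proof -
  obtain c where "c \<in> A" "p \<in> fst c" by (rule chart_at)
  then show ?thesis using coord_vector_in_tangent_space[of c p 0] by (simp add: coord_vector_0)
qed

lemma velocity_eq_coord_vector:
  assumes c: "c \<in> A" and p: "\<beta> t \<in> fst c" and cont: "isCont \<beta> t"
    and D: "((snd c \<circ> \<beta>) has_vector_derivative D) (at t)"
  shows "velocity A \<beta> t = coord_vector A (\<beta> t) c D"
proof
  fix c' show "velocity A \<beta> t c' = coord_vector A (\<beta> t) c D c'"
  proof (cases "c' \<in> A \<and> \<beta> t \<in> fst c'")
    case True
    then have "((snd c' \<circ> \<beta>) has_vector_derivative coord_change (\<beta> t) c c' D) (at t)"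
      using assms by (intro change_chart_has_vector_derivative) auto
    then show ?thesis using True by (simp add: velocity_def coord_vector_def vector_derivative_at)
  qed (auto simp: velocity_def coord_vector_def)
qed

section \<open>Riemannian metrics in charts\<close>

definition chart_form ::
    "('a \<Rightarrow> ('a, 'e) tangent \<Rightarrow> ('a, 'e) tangent \<Rightarrow> real) \<Rightarrow> ('a, 'e) chart \<Rightarrow> 'a \<Rightarrow> 'e \<Rightarrow> 'e \<Rightarrow> real" where
  "chart_form g c p v w = g p (coord_vector A p c v) (coord_vector A p c w)"

lemma riemannian_metric_tangent:
  assumes g: "riemannian_metric A g"
    and "U \<in> tangent_space A p" "V \<in> tangent_space A p" "W \<in> tangent_space A p"
  shows "g p V W = g p W V" "g p (\<lambda>c. k *\<^sub>R U c + V c) W = k * g p U W + g p V W"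
    "V \<noteq> (\<lambda>_. 0) \<Longrightarrow> g p V V > 0"
  using assms unfolding riemannian_metric_def by blast+

lemma riemannian_metric_zero:
  assumes g: "riemannian_metric A g" and W: "W \<in> tangent_space A p"
  shows "g p (\<lambda>_. 0) W = 0"
  using riemannian_metric_tangent(2)[OF g tangent_space_0 tangent_space_0 W, of 1] by simp

lemma chart_form_inner_form:
  assumes g: "riemannian_metric A g" and c: "c \<in> A" "p \<in> fst c"
  shows "inner_form (chart_form g c p)"
proof -
  note T = coord_vector_in_tangent_space[OF c]
  have sym: "chart_form g c p v w = chart_form g c p w v" for v w
    unfolding chart_form_def by (rule riemannian_metric_tangent(1)[OF g T T T])
  have lin: "chart_form g c p (k *\<^sub>R u + v) w = k * chart_form g c p u w + chart_form g c p v w" for k u v w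
    unfolding chart_form_def coord_vector_linear[OF c] by (rule riemannian_metric_tangent(2)[OF g T T T])
  have zero: "chart_form g c p 0 w = 0" for w
    unfolding chart_form_def coord_vector_0[OF c] by (rule riemannian_metric_zero[OF g T])
  have l: "linear (\<lambda>v. chart_form g c p v w)" for w
  proof (rule linearI)
    show "chart_form g c p (v + v') w = chart_form g c p v w + chart_form g c p v' w" for v v'
      using lin[of 1 v v' w] by simp
    show "chart_form g c p (k *\<^sub>R v) w = k *\<^sub>R chart_form g c p v w" for k v
      using lin[of k v 0 w] zero by simp
  qed
  moreover have "linear (chart_form g c p v)" for v
  proof -
    have "chart_form g c p v = (\<lambda>w. chart_form g c p w v)" by (intro ext sym)
    then show ?thesis using l[of v] by simp
  qed
  ultimately have "bilinear (chart_form g c p)" by (simp add: bilinear_def)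
  moreover have "chart_form g c p v v > 0" if "v \<noteq> 0" for v
    unfolding chart_form_def
  proof (rule riemannian_metric_tangent(3)[OF g T T T])
    show "coord_vector A p c v \<noteq> (\<lambda>_. 0)" using coord_vector_apply[OF c, of v] that by auto
  qed
  ultimately show ?thesis using sym by (simp add: inner_form_def)
qed

lemma chart_form_tangent:
  assumes "c \<in> A" "p \<in> fst c" "V \<in> tangent_space A p"
  shows "g p V V = chart_form g c p (V c) (V c)"
  unfolding chart_form_def by (simp add: tangent_space_coord_vector[OF assms, symmetric])

lemma chart_form_velocity:
  assumes c: "c \<in> A" and p: "\<beta> t \<in> fst c" and cont: "isCont \<beta> t"
    and D: "((snd c \<circ> \<beta>) has_vector_derivative D) (at t)"
  shows "g (\<beta> t) (velocity A \<beta> t) (velocity A \<beta> t) = chart_form g c (\<beta> t) D D"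
  using velocity_eq_coord_vector[OF assms] by (simp add: chart_form_def)

lemma metric_coeff_chart_form: "metric_coeff A g c i j p = chart_form g c p i j"
  by (simp add: metric_coeff_def chart_form_def)

lemma chart_form_expand:
  assumes "riemannian_metric A g" "c \<in> A" "p \<in> fst c"
  shows "chart_form g c p v w = (\<Sum>i\<in>Basis. \<Sum>j\<in>Basis. (v \<bullet> i) * (w \<bullet> j) * metric_coeff A g c i j p)"
proof -
  have bl: "bilinear (chart_form g c p)" using chart_form_inner_form[OF assms] by (simp add: inner_form_def)
  have "chart_form g c p v w = chart_form g c p (\<Sum>i\<in>Basis. (v \<bullet> i) *\<^sub>R i) (\<Sum>j\<in>Basis. (w \<bullet> j) *\<^sub>R j)"
    by (simp add: euclidean_representation)
  also have "\<dots> = (\<Sum>(i, j)\<in>Basis \<times> Basis. chart_form g c p ((v \<bullet> i) *\<^sub>R i) ((w \<bullet> j) *\<^sub>R j))"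
    by (rule bilinear_sum[OF bl])
  finally show ?thesis
    by (simp add: bilinear_lmul[OF bl] bilinear_rmul[OF bl] sum.cartesian_product mult_ac metric_coeff_chart_form)
qed

end



section \<open>Lengths of piecewise smooth curves\<close>

context manifold
begin

definition speed :: "('a \<Rightarrow> ('a, 'e) tangent \<Rightarrow> ('a, 'e) tangent \<Rightarrow> real) \<Rightarrow> (real \<Rightarrow> 'a) \<Rightarrow> real \<Rightarrow> real" where
  "speed g \<beta> t = sqrt (g (\<beta> t) (velocity A \<beta> t) (velocity A \<beta> t))"

text \<open>Piecewise smooth curves on arbitrary intervals, with the set of break points made explicit, so
  that curves can be restricted, reparametrized and joined.\<close>

definition C1_pieces :: "real set \<Rightarrow> real \<Rightarrow> real \<Rightarrow> (real \<Rightarrow> 'a) \<Rightarrow> bool" where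
  "C1_pieces S a b \<beta> \<longleftrightarrow> finite S \<and> continuous_on {a..b} \<beta> \<and>
     (\<forall>u v. a \<le> u \<and> u < v \<and> v \<le> b \<and> {u<..<v} \<inter> S = {} \<longrightarrow> C1_curve_on A {u..v} \<beta>)"

text \<open>The nonnegative integral does not change under completion; over \<^term>\<open>lborel\<close> the speed, which is
  continuous between break points, is Borel measurable up to finitely many parameters.\<close>

definition partial_length ::
    "('a \<Rightarrow> ('a, 'e) tangent \<Rightarrow> ('a, 'e) tangent \<Rightarrow> real) \<Rightarrow> real \<Rightarrow> real \<Rightarrow> (real \<Rightarrow> 'a) \<Rightarrow> ennreal" where
  "partial_length g a b \<beta> = (\<integral>\<^sup>+t. ennreal (speed g \<beta> t) * indicator {a..b} t \<partial>lborel)"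

lemma piecewise_C1_iff_pieces: "piecewise_C1_curve A \<beta> \<longleftrightarrow> (\<exists>S. C1_pieces S 0 1 \<beta>)"
  unfolding piecewise_C1_curve_def C1_pieces_def by blast

lemma riemannian_length_partial: "riemannian_length A g \<beta> = partial_length g 0 1 \<beta>"
  unfolding riemannian_length_def partial_length_def speed_def
  by (subst nn_integral_restrict_space) (simp_all add: nn_integral_completion)

lemma speed_eq_form_norm:
  assumes "c \<in> A" "\<beta> t \<in> fst c" "isCont \<beta> t" "((snd c \<circ> \<beta>) has_vector_derivative D) (at t)"
  shows "speed g \<beta> t = form_norm (chart_form g c (\<beta> t)) D"
  using chart_form_velocity[OF assms] by (simp add: speed_def form_norm_def)

lemma C1_curve_interior:
  assumes C1: "C1_curve_on A {u..v} \<beta>" and c: "c \<in> A"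
  obtains D where
    "\<And>t. t \<in> {u<..<v} \<Longrightarrow> \<beta> t \<in> fst c \<Longrightarrow> ((snd c \<circ> \<beta>) has_vector_derivative D t) (at t)"
    "continuous_on {t\<in>{u<..<v}. \<beta> t \<in> fst c} D"
proof -
  obtain D where D: "\<forall>t\<in>{u..v}. \<beta> t \<in> fst c \<longrightarrow> ((snd c \<circ> \<beta>) has_vector_derivative D t) (at t within {u..v})"
      "continuous_on {t\<in>{u..v}. \<beta> t \<in> fst c} D"
    using C1 c unfolding C1_curve_on_def by blast
  show ?thesis
  proof
    show "continuous_on {t\<in>{u<..<v}. \<beta> t \<in> fst c} D"
      by (rule continuous_on_subset[OF D(2)]) auto
    fix t assume t: "t \<in> {u<..<v}" "\<beta> t \<in> fst c"
    then have "at t within {u..v} = at t" by (intro at_within_interior) auto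
    then show "((snd c \<circ> \<beta>) has_vector_derivative D t) (at t)" using D(1) t by force
  qed
qed

lemma C1_pieces_at:
  assumes "C1_pieces S a b \<beta>" and t: "t \<in> {a<..<b} - S"
  obtains u v where "a \<le> u" "u < t" "t < v" "v \<le> b" "C1_curve_on A {u..v} \<beta>"
proof -
  have S: "finite S" using assms by (simp add: C1_pieces_def)
  have "open ({a<..<b} - S)" using S by (intro open_Diff finite_imp_closed) auto
  then obtain e where e: "e > 0" "cball t e \<subseteq> {a<..<b} - S" using t by (meson open_contains_cball)
  then have sub: "{t - e..t + e} \<subseteq> {a<..<b} - S" by (simp add: cball_eq_atLeastAtMost)
  then have "t - e \<in> {a<..<b}" "t + e \<in> {a<..<b}" using e(1) by (auto simp: subset_iff)
  moreover have "{t - e<..<t + e} \<inter> S = {}" using sub by (auto simp: subset_iff)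
  ultimately have "C1_curve_on A {t - e..t + e} \<beta>"
    using assms(1) e(1) unfolding C1_pieces_def by (auto simp: less_imp_le)
  with e(1) \<open>t - e \<in> _\<close> \<open>t + e \<in> _\<close> show ?thesis by (intro that[of "t - e" "t + e"]) auto
qed

lemma C1_pieces_isCont:
  assumes "C1_pieces S a b \<beta>" "t \<in> {a<..<b}"
  shows "isCont \<beta> t"
  using assms by (intro continuous_on_interior[of "{a..b}"]) (auto simp: C1_pieces_def)

lemma C1_pieces_derivative:
  assumes P: "C1_pieces S a b \<beta>" and t: "t \<in> {a<..<b} - S" and c: "c \<in> A" "\<beta> t \<in> fst c"
  shows "((snd c \<circ> \<beta>) has_vector_derivative vector_derivative (snd c \<circ> \<beta>) (at t)) (at t)"
proof -
  obtain u v where uv: "a \<le> u" "u < t" "t < v" "v \<le> b" "C1_curve_on A {u..v} \<beta>"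
    by (rule C1_pieces_at[OF P t])
  obtain D where "\<And>t. t \<in> {u<..<v} \<Longrightarrow> \<beta> t \<in> fst c \<Longrightarrow> ((snd c \<circ> \<beta>) has_vector_derivative D t) (at t)"
    using C1_curve_interior[OF uv(5) c(1)] by blast
  then have "((snd c \<circ> \<beta>) has_vector_derivative D t) (at t)" using uv c by auto
  then show ?thesis by (metis vector_derivative_at)
qed

context
  fixes g assumes g: "riemannian_metric A g"
begin

lemma speed_continuous:
  assumes P: "C1_pieces S a b \<beta>"
  shows "continuous_on ({a<..<b} - S) (speed g \<beta>)"
proof (rule continuous_at_imp_continuous_on, rule ballI)
  fix t assume t: "t \<in> {a<..<b} - S"
  obtain u v where uv: "a \<le> u" "u < t" "t < v" "v \<le> b" "C1_curve_on A {u..v} \<beta>"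
    by (rule C1_pieces_at[OF P t])
  obtain c where c: "c \<in> A" "\<beta> t \<in> fst c" by (rule chart_at)
  obtain D where D: "\<And>t. t \<in> {u<..<v} \<Longrightarrow> \<beta> t \<in> fst c \<Longrightarrow> ((snd c \<circ> \<beta>) has_vector_derivative D t) (at t)"
    "continuous_on {t\<in>{u<..<v}. \<beta> t \<in> fst c} D"
    using C1_curve_interior[OF uv(5) c(1)] by blast
  let ?T = "{t\<in>{u<..<v}. \<beta> t \<in> fst c}"
  have "continuous_on {a..b} \<beta>" using P by (simp add: C1_pieces_def)
  then have cont: "continuous_on {u<..<v} \<beta>"
    by (rule continuous_on_subset) (use uv in auto)
  have "?T = {u<..<v} \<inter> \<beta> -` fst c" by (auto simp: vimage_def)
  then have oT: "open ?T"
    using continuous_open_preimage[OF cont open_greaterThanLessThan open_chart[OF c(1)]] by (simp only:)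
  have tT: "t \<in> ?T" using uv c by auto
  have eq: "speed g \<beta> x = sqrt (\<Sum>i\<in>Basis. \<Sum>j\<in>Basis. (D x \<bullet> i) * (D x \<bullet> j) * metric_coeff A g c i j (\<beta> x))"
    if x: "x \<in> ?T" for x
  proof -
    have "isCont \<beta> x" using C1_pieces_isCont[OF P, of x] x uv by auto
    then have "speed g \<beta> x = form_norm (chart_form g c (\<beta> x)) (D x)"
      using x by (intro speed_eq_form_norm c D(1)) auto
    then show ?thesis using chart_form_expand[OF g c(1), of "\<beta> x"] x by (simp add: form_norm_def)
  qed
  have coeff: "continuous_on ?T (\<lambda>x. metric_coeff A g c i j (\<beta> x))" if "i \<in> Basis" "j \<in> Basis" for i j
  proof (rule continuous_on_compose2[where g="metric_coeff A g c i j" and f=\<beta>])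
    show "continuous_on (fst c) (metric_coeff A g c i j)"
      using g c that unfolding riemannian_metric_def by blast
    show "continuous_on ?T \<beta>" by (rule continuous_on_subset[OF cont]) auto
  qed auto
  have "continuous_on ?T (\<lambda>x. sqrt (\<Sum>i\<in>Basis. \<Sum>j\<in>Basis. (D x \<bullet> i) * (D x \<bullet> j) * metric_coeff A g c i j (\<beta> x)))"
    by (intro continuous_on_real_sqrt continuous_on_sum continuous_on_mult coeff
        continuous_on_inner D(2) continuous_on_const)
  then have "continuous_on ?T (speed g \<beta>)"
    by (rule continuous_on_eq) (rule eq[symmetric])
  then show "isCont (speed g \<beta>) t" using oT tT by (simp add: continuous_on_eq_continuous_at)
qed

lemma speed_measurable:
  assumes "C1_pieces S a b \<beta>"
  shows "(\<lambda>t. ennreal (speed g \<beta> t) * indicator ({a<..<b} - S) t) \<in> borel_measurable borel"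
proof -
  have S: "finite S" using assms by (simp add: C1_pieces_def)
  have "(\<lambda>t. indicator ({a<..<b} - S) t *\<^sub>R speed g \<beta> t) \<in> borel_measurable borel"
  proof (rule borel_measurable_continuous_on_indicator[OF _ speed_continuous[OF assms]])
    show "{a<..<b} - S \<in> sets borel"
      using S by (intro sets.Diff borel_open borel_closed finite_imp_closed) auto
  qed
  then have "(\<lambda>t. ennreal (indicator ({a<..<b} - S) t *\<^sub>R speed g \<beta> t)) \<in> borel_measurable borel"
    by measurable
  moreover have "ennreal (indicator ({a<..<b} - S) t *\<^sub>R speed g \<beta> t) = ennreal (speed g \<beta> t) * indicator ({a<..<b} - S) t" for t
    by (auto simp: indicator_def)
  ultimately show ?thesis by simp
qed

end

text \<open>Removing the break points makes the integrand measurable (\<open>speed_measurable\<close>).\<close>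

lemma partial_length_interior:
  assumes "finite S"
  shows "partial_length g a b \<beta> = (\<integral>\<^sup>+t. ennreal (speed g \<beta> t) * indicator ({a<..<b} - S) t \<partial>lborel)"
  unfolding partial_length_def
proof (rule nn_integral_cong_AE)
  have "AE t in lborel. t \<notin> S \<union> {a, b}"
    using assms by (intro AE_not_in) (auto intro: finite_imp_null_set_lborel)
  then show "AE t in lborel. ennreal (speed g \<beta> t) * indicator {a..b} t = ennreal (speed g \<beta> t) * indicator ({a<..<b} - S) t"
    by eventually_elim (auto simp: indicator_def)
qed

lemma C1_curve_on_cong:
  assumes "\<And>t. t \<in> J \<Longrightarrow> \<beta> t = \<beta>' t" "C1_curve_on A J \<beta>"
  shows "C1_curve_on A J \<beta>'"
  unfolding C1_curve_on_def
proof (intro conjI ballI)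
  show "continuous_on J \<beta>'"
    by (rule continuous_on_eq[of _ \<beta>]) (use assms in \<open>auto simp: C1_curve_on_def\<close>)
  fix c assume "c \<in> A"
  with assms(2) obtain D where D: "\<forall>t\<in>J. \<beta> t \<in> fst c \<longrightarrow> ((snd c \<circ> \<beta>) has_vector_derivative D t) (at t within J)"
     "continuous_on {t\<in>J. \<beta> t \<in> fst c} D" unfolding C1_curve_on_def by blast
  have "{t\<in>J. \<beta> t \<in> fst c} = {t\<in>J. \<beta>' t \<in> fst c}" using assms(1) by auto
  with D(2) have "continuous_on {t\<in>J. \<beta>' t \<in> fst c} D" by simp
  moreover have "((snd c \<circ> \<beta>') has_vector_derivative D t) (at t within J)" if "t \<in> J" "\<beta>' t \<in> fst c" for t
  proof (rule has_vector_derivative_transform[OF that(1)])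
    show "((snd c \<circ> \<beta>) has_vector_derivative D t) (at t within J)" using D(1) that assms(1) by auto
  qed (use assms(1) in auto)
  ultimately show "\<exists>D. (\<forall>t\<in>J. \<beta>' t \<in> fst c \<longrightarrow> ((snd c \<circ> \<beta>') has_vector_derivative D t) (at t within J)) \<and>
      continuous_on {t\<in>J. \<beta>' t \<in> fst c} D" by blast
qed

lemma C1_pieces_cong:
  assumes "\<And>t. t \<in> {a..b} \<Longrightarrow> \<beta> t = \<beta>' t" "C1_pieces S a b \<beta>"
  shows "C1_pieces S a b \<beta>'"
  unfolding C1_pieces_def
proof (intro conjI allI impI)
  show "finite S" using assms by (simp add: C1_pieces_def)
  show "continuous_on {a..b} \<beta>'"
    by (rule continuous_on_eq[of _ \<beta>]) (use assms in \<open>auto simp: C1_pieces_def\<close>)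
  fix u v assume uv: "a \<le> u \<and> u < v \<and> v \<le> b \<and> {u<..<v} \<inter> S = {}"
  show "C1_curve_on A {u..v} \<beta>'"
    by (rule C1_curve_on_cong[of _ \<beta>]) (use assms uv in \<open>auto simp: C1_pieces_def\<close>)
qed

lemma velocity_cong:
  assumes "open T" "t \<in> T" "\<And>u. u \<in> T \<Longrightarrow> \<beta> u = \<beta>' u"
  shows "velocity A \<beta> t = velocity A \<beta>' t"
proof -
  have "vector_derivative (snd c \<circ> \<beta>) (at t) = vector_derivative (snd c \<circ> \<beta>') (at t)" for c :: "('a, 'e) chart"
  proof (rule vector_derivative_cong_eq)
    show "\<forall>\<^sub>F x in nhds t. x \<in> UNIV \<longrightarrow> (snd c \<circ> \<beta>) x = (snd c \<circ> \<beta>') x"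
      using eventually_nhds_in_open[OF assms(1,2)] by eventually_elim (simp add: assms(3))
  qed auto
  then show ?thesis unfolding velocity_def assms(3)[OF assms(2)] by presburger
qed

lemma partial_length_cong:
  assumes "\<And>t. t \<in> {a..b} \<Longrightarrow> \<beta> t = \<beta>' t"
  shows "partial_length g a b \<beta> = partial_length g a b \<beta>'"
proof -
  have "speed g \<beta> t = speed g \<beta>' t" if "t \<in> {a<..<b}" for t
    using velocity_cong[of "{a<..<b}" t \<beta> \<beta>'] that assms by (simp add: speed_def)
  then show ?thesis
    unfolding partial_length_interior[of "{}", simplified] by (intro nn_integral_cong) (auto simp: indicator_def)
qed

lemma C1_curve_on_affine:
  assumes "C1_curve_on A J' \<beta>" "(\<lambda>t. k * t + m) ` J \<subseteq> J'"
  shows "C1_curve_on A J (\<lambda>t. \<beta> (k * t + m))"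
  unfolding C1_curve_on_def
proof (intro conjI ballI)
  let ?f = "\<lambda>t. k * t + m"
  show "continuous_on J (\<lambda>t. \<beta> (k * t + m))"
    using assms by (intro continuous_on_compose2[of J' \<beta> J ?f] continuous_intros) (auto simp: C1_curve_on_def)
  fix c assume "c \<in> A"
  with assms(1) obtain D where D: "\<forall>t\<in>J'. \<beta> t \<in> fst c \<longrightarrow> ((snd c \<circ> \<beta>) has_vector_derivative D t) (at t within J')"
     "continuous_on {t\<in>J'. \<beta> t \<in> fst c} D" unfolding C1_curve_on_def by blast
  show "\<exists>D. (\<forall>t\<in>J. \<beta> (k * t + m) \<in> fst c \<longrightarrow> ((snd c \<circ> (\<lambda>t. \<beta> (k * t + m))) has_vector_derivative D t) (at t within J)) \<and>
      continuous_on {t\<in>J. \<beta> (k * t + m) \<in> fst c} D"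
  proof (intro exI[of _ "\<lambda>t. k *\<^sub>R D (k * t + m)"] conjI ballI impI)
    fix t assume t: "t \<in> J" "\<beta> (k * t + m) \<in> fst c"
    have "(?f has_vector_derivative k) (at t within J)"
      by (auto intro!: derivative_eq_intros simp: has_real_derivative_iff_has_vector_derivative[symmetric])
    moreover have "((snd c \<circ> \<beta>) has_vector_derivative D (?f t)) (at (?f t) within ?f ` J)"
      by (rule has_vector_derivative_within_subset[OF _ assms(2)]) (use D(1) t assms(2) in auto)
    ultimately have "(((snd c \<circ> \<beta>) \<circ> ?f) has_vector_derivative k *\<^sub>R D (?f t)) (at t within J)"
      by (rule vector_diff_chain_within)
    then show "((snd c \<circ> (\<lambda>t. \<beta> (k * t + m))) has_vector_derivative k *\<^sub>R D (k * t + m)) (at t within J)"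
      by (simp add: comp_def)
  next
    show "continuous_on {t \<in> J. \<beta> (k * t + m) \<in> fst c} (\<lambda>t. k *\<^sub>R D (k * t + m))"
      using assms(2) by (intro continuous_intros continuous_on_compose2[OF D(2)]) auto
  qed
qed

lemma affine_image_interval:
  fixes k m :: real
  assumes "k \<noteq> 0" "u < v"
  shows "(\<lambda>t. k * t + m) ` {u..v} = {min (k * u+m) (k * v+m)..max (k * u+m) (k * v+m)}"
    "(\<lambda>t. k * t + m) ` {u<..<v} = {min (k * u+m) (k * v+m)<..<max (k * u+m) (k * v+m)}"
proof -
  consider "k > 0" | "k < 0" using assms by linarith
  then show "(\<lambda>t. k * t + m) ` {u..v} = {min (k * u+m) (k * v+m)..max (k * u+m) (k * v+m)}"
  proof cases
    case 1 then have "k * u < k * v" using assms by simp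
    with 1 show ?thesis using assms by (simp add: image_affinity_atLeastAtMost min_def max_def)
  next
    case 2 then have "k * v < k * u" using assms by simp
    with 2 show ?thesis using assms by (simp add: image_affinity_atLeastAtMost min_def max_def)
  qed
  have "k > 0 \<or> k < 0" using assms by linarith
  then show "(\<lambda>t. k * t + m) ` {u<..<v} = {min (k * u+m) (k * v+m)<..<max (k * u+m) (k * v+m)}"
  proof
    assume 1: "k > 0" then have "k * u < k * v" using assms by simp
    show ?thesis
    proof (intro set_eqI iffI)
      fix y assume "y \<in> {min (k * u+m) (k * v+m)<..<max (k * u+m) (k * v+m)}"
      then show "y \<in> (\<lambda>t. k * t + m) ` {u<..<v}"
        using 1 \<open>k * u < k * v\<close> by (intro image_eqI[of _ _ "(y - m) / k"]) (auto simp: field_simps)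
    qed (use 1 \<open>k * u < k * v\<close> in \<open>auto\<close>)
  next
    assume 2: "k < 0" then have "k * v < k * u" using assms by simp
    show ?thesis
    proof (intro set_eqI iffI)
      fix y assume "y \<in> {min (k * u+m) (k * v+m)<..<max (k * u+m) (k * v+m)}"
      then show "y \<in> (\<lambda>t. k * t + m) ` {u<..<v}"
        using 2 \<open>k * v < k * u\<close> by (intro image_eqI[of _ _ "(y - m) / k"]) (auto simp: field_simps)
    qed (use 2 \<open>k * v < k * u\<close> in \<open>auto\<close>)
  qed
qed

text \<open>The case \<open>k < 0\<close> reverses the curve, whence the minimum and maximum. Symmetry of the Riemannian
  distance uses \<open>k = -1\<close>, the triangle inequality \<open>k = 2\<close>.\<close>

lemma affine_reparametrization:
  assumes g: "riemannian_metric A g" and k: "k \<noteq> 0" and ab: "a < b"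
    and P: "C1_pieces S (min (k * a+m) (k * b+m)) (max (k * a+m) (k * b+m)) \<beta>"
  shows "C1_pieces ((\<lambda>t. (t - m) / k) ` S) a b (\<lambda>t. \<beta> (k * t + m))"
    and "partial_length g a b (\<lambda>t. \<beta> (k * t + m)) = partial_length g (min (k * a+m) (k * b+m)) (max (k * a+m) (k * b+m)) \<beta>"
proof -
  let ?f = "\<lambda>t. k * t + m"
  let ?a = "min (k * a+m) (k * b+m)" and ?b = "max (k * a+m) (k * b+m)" and ?\<beta> = "\<lambda>t. \<beta> (k * t + m)"
  let ?S = "(\<lambda>t. (t - m) / k) ` S"
  have S: "finite S" using P by (simp add: C1_pieces_def)
  have inS: "?f t \<in> S \<longleftrightarrow> t \<in> ?S" for t
    using k by (auto simp: image_iff field_simps intro: bexI[of _ "?f t"])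
  show P': "C1_pieces ?S a b ?\<beta>" unfolding C1_pieces_def
  proof (intro conjI allI impI)
    show "finite ?S" using S by simp
    show "continuous_on {a..b} ?\<beta>"
      using P affine_image_interval(1)[OF k ab]
      by (intro continuous_on_compose2[of "{?a..?b}" \<beta> "{a..b}" ?f] continuous_intros) (auto simp: C1_pieces_def)
    fix u v assume uv: "a \<le> u \<and> u < v \<and> v \<le> b \<and> {u<..<v} \<inter> ?S = {}"
    let ?u = "min (k * u+m) (k * v+m)" and ?v = "max (k * u+m) (k * v+m)"
    have uv': "u < v" using uv by simp
    have img: "?f ` {u..v} = {?u..?v}" "?f ` {u<..<v} = {?u<..<?v}" "?f ` {a..b} = {?a..?b}"
      using affine_image_interval[OF k] uv' ab by blast+
    have "{?u..?v} \<subseteq> {?a..?b}" unfolding img[symmetric] using uv by (intro image_mono) auto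
    moreover have "?u < ?v" using k uv' by (auto simp: min_def max_def less_le)
    moreover have "{?u<..<?v} \<inter> S = {}" unfolding img(2)[symmetric] using uv inS by blast
    ultimately have "C1_curve_on A {?u..?v} \<beta>" using P unfolding C1_pieces_def by auto
    then show "C1_curve_on A {u..v} ?\<beta>" by (rule C1_curve_on_affine) (simp add: img)
  qed
  have sp: "speed g ?\<beta> t = \<bar>k\<bar> * speed g \<beta> (?f t)" if t: "t \<in> {a<..<b} - ?S" for t
  proof -
    have "?f t \<in> {?a<..<?b}" unfolding affine_image_interval(2)[OF k ab, symmetric] using t by blast
    then have ft: "?f t \<in> {?a<..<?b} - S" using inS t by blast
    obtain c where c: "c \<in> A" "\<beta> (?f t) \<in> fst c" by (rule chart_at)
    let ?D = "vector_derivative (snd c \<circ> \<beta>) (at (?f t))"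
    have D: "((snd c \<circ> \<beta>) has_vector_derivative ?D) (at (?f t))" by (rule C1_pieces_derivative[OF P ft c])
    have "(?f has_vector_derivative k) (at t)"
      by (auto intro!: derivative_eq_intros simp: has_real_derivative_iff_has_vector_derivative[symmetric])
    from vector_diff_chain_at[OF this D]
    have D': "((snd c \<circ> ?\<beta>) has_vector_derivative k *\<^sub>R ?D) (at t)" by (simp add: comp_def)
    have i: "inner_form (chart_form g c (\<beta> (?f t)))" by (rule chart_form_inner_form[OF g c])
    have "speed g ?\<beta> t = form_norm (chart_form g c (\<beta> (?f t))) (k *\<^sub>R ?D)"
      by (rule speed_eq_form_norm[OF c(1) _ _ D']) (use c C1_pieces_isCont[OF P'] t in auto)
    also have "\<dots> = \<bar>k\<bar> * form_norm (chart_form g c (\<beta> (?f t))) ?D" by (rule form_norm_scale[OF i])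
    also have "form_norm (chart_form g c (\<beta> (?f t))) ?D = speed g \<beta> (?f t)"
      by (rule speed_eq_form_norm[OF c(1) _ _ D, symmetric]) (use c C1_pieces_isCont[OF P] ft in auto)
    finally show ?thesis .
  qed
  have ind: "indicator ({?a<..<?b} - S) (?f t) = (indicator ({a<..<b} - ?S) t :: ennreal)" for t
  proof -
    have "?f t \<in> {?a<..<?b} \<longleftrightarrow> t \<in> {a<..<b}"
      unfolding affine_image_interval(2)[OF k ab, symmetric] using k by auto
    then show ?thesis using inS[of t] by (simp add: indicator_def)
  qed
  let ?h = "\<lambda>t. ennreal (speed g \<beta> t) * indicator ({?a<..<?b} - S) t"
  have "partial_length g ?a ?b \<beta> = (\<integral>\<^sup>+t. ?h t \<partial>lborel)" by (rule partial_length_interior[OF S])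
  also have "\<dots> = \<bar>k\<bar> * (\<integral>\<^sup>+t. ?h (m + k * t) \<partial>lborel)"
    by (rule nn_integral_real_affine[OF speed_measurable[OF g P] k])
  also have "\<dots> = (\<integral>\<^sup>+t. \<bar>k\<bar> * ?h (m + k * t) \<partial>lborel)"
    by (rule nn_integral_cmult[symmetric]) (use speed_measurable[OF g P] in measurable)
  also have "\<dots> = (\<integral>\<^sup>+t. ennreal (speed g ?\<beta> t) * indicator ({a<..<b} - ?S) t \<partial>lborel)"
  proof (rule nn_integral_cong)
    fix t
    show "ennreal \<bar>k\<bar> * ?h (m + k * t) = ennreal (speed g ?\<beta> t) * indicator ({a<..<b} - ?S) t"
      using sp[of t] ind[of t] by (cases "t \<in> {a<..<b} - ?S") (auto simp: add.commute ennreal_mult')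
  qed
  also have "\<dots> = partial_length g a b ?\<beta>"
    using S by (intro partial_length_interior[symmetric]) simp
  finally show "partial_length g a b ?\<beta> = partial_length g ?a ?b \<beta>" by simp
qed

lemma join_pieces:
  assumes g: "riemannian_metric A g" and m: "a < m" "m < b"
    and P: "C1_pieces S a m \<beta>" "C1_pieces T m b \<beta>"
  shows "C1_pieces (insert m (S \<union> T)) a b \<beta>"
    and "partial_length g a b \<beta> = partial_length g a m \<beta> + partial_length g m b \<beta>"
proof -
  have ST: "finite S" "finite T" using P by (auto simp: C1_pieces_def)
  show "C1_pieces (insert m (S \<union> T)) a b \<beta>" unfolding C1_pieces_def
  proof (intro conjI allI impI)
    have "continuous_on ({a..m} \<union> {m..b}) \<beta>"
      using P by (intro continuous_on_closed_Un) (auto simp: C1_pieces_def)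
    then show "continuous_on {a..b} \<beta>" using m by (simp add: ivl_disj_un_two_touch)
    fix u v assume uv: "a \<le> u \<and> u < v \<and> v \<le> b \<and> {u<..<v} \<inter> insert m (S \<union> T) = {}"
    then have "m \<notin> {u<..<v}" by blast
    then consider "v \<le> m" | "m \<le> u" by fastforce
    then show "C1_curve_on A {u..v} \<beta>"
      using P uv unfolding C1_pieces_def by cases blast+
  qed (use ST in auto)
  let ?f = "\<lambda>t. ennreal (speed g \<beta> t)"
  have "partial_length g a b \<beta> = (\<integral>\<^sup>+t. ?f t * indicator ({a<..<b} - insert m (S \<union> T)) t \<partial>lborel)"
    using ST by (intro partial_length_interior) simp
  also have "\<dots> = (\<integral>\<^sup>+t. ?f t * indicator ({a<..<m} - S) t + ?f t * indicator ({m<..<b} - T) t \<partial>lborel)"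
  proof (rule nn_integral_cong_AE)
    have "AE t in lborel. t \<notin> insert m (S \<union> T)"
      using ST by (intro AE_not_in) (auto intro: finite_imp_null_set_lborel)
    then show "AE t in lborel. ?f t * indicator ({a<..<b} - insert m (S \<union> T)) t =
       ?f t * indicator ({a<..<m} - S) t + ?f t * indicator ({m<..<b} - T) t"
      by eventually_elim (use m in \<open>auto simp: indicator_def\<close>)
  qed
  also have "\<dots> = (\<integral>\<^sup>+t. ?f t * indicator ({a<..<m} - S) t \<partial>lborel) + (\<integral>\<^sup>+t. ?f t * indicator ({m<..<b} - T) t \<partial>lborel)"
    using speed_measurable[OF g P(1)] speed_measurable[OF g P(2)] by (intro nn_integral_add) auto
  also have "\<dots> = partial_length g a m \<beta> + partial_length g m b \<beta>"
    by (simp only: partial_length_interior[OF ST(1), of g a m] partial_length_interior[OF ST(2), of g m b])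
  finally show "partial_length g a b \<beta> = partial_length g a m \<beta> + partial_length g m b \<beta>" .
qed

lemma riemannian_dist_sym_le:
  assumes g: "riemannian_metric A g"
  shows "riemannian_dist A g y x \<le> riemannian_dist A g x y"
proof -
  have "riemannian_dist A g y x \<le> riemannian_length A g \<beta>"
    if \<beta>: "piecewise_C1_curve A \<beta>" "\<beta> 0 = x" "\<beta> 1 = y" for \<beta>
  proof -
    obtain S where "C1_pieces S 0 1 \<beta>" using \<beta> by (auto simp: piecewise_C1_iff_pieces)
    then have P: "C1_pieces S (min (-1 * 0+1) (-1 * 1+1)) (max (-1 * 0+1) (-1 * 1+1)) \<beta>" by simp
    note * = affine_reparametrization[OF g _ _ P]
    have "piecewise_C1_curve A (\<lambda>t. \<beta> (-1 * t + 1))"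
      using *(1) unfolding piecewise_C1_iff_pieces by auto
    moreover have "riemannian_length A g (\<lambda>t. \<beta> (-1 * t + 1)) = riemannian_length A g \<beta>"
      using *(2) unfolding riemannian_length_partial by simp
    ultimately show ?thesis
      unfolding riemannian_dist_def using \<beta> by (intro INF_lower2[of "\<lambda>t. \<beta> (-1 * t + 1)"]) auto
  qed
  then show ?thesis unfolding riemannian_dist_def[of _ _ x y] by (intro INF_greatest) auto
qed

lemma riemannian_dist_sym: "riemannian_metric A g \<Longrightarrow> riemannian_dist A g x y = riemannian_dist A g y x"
  by (intro antisym riemannian_dist_sym_le)

lemma riemannian_dist_triangle:
  assumes g: "riemannian_metric A g"
  shows "riemannian_dist A g x z \<le> riemannian_dist A g x y + riemannian_dist A g y z"
proof -
  have main: "riemannian_dist A g x z \<le> riemannian_length A g \<beta> + riemannian_length A g \<beta>'"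
    if \<beta>: "piecewise_C1_curve A \<beta>" "\<beta> 0 = x" "\<beta> 1 = y" and \<beta>': "piecewise_C1_curve A \<beta>'" "\<beta>' 0 = y" "\<beta>' 1 = z" for \<beta> \<beta>'
  proof -
    obtain S where "C1_pieces S 0 1 \<beta>" using \<beta> by (auto simp: piecewise_C1_iff_pieces)
    then have P: "C1_pieces S (min (2 * 0+0) (2 * (1/2)+0)) (max (2 * 0+0) (2 * (1/2)+0)) \<beta>" by simp
    obtain S' where "C1_pieces S' 0 1 \<beta>'" using \<beta>' by (auto simp: piecewise_C1_iff_pieces)
    then have P': "C1_pieces S' (min (2 * (1/2)+(-1)) (2 * 1+(-1))) (max (2 * (1/2)+(-1)) (2 * 1+(-1))) \<beta>'" by simp
    define \<eta> where "\<eta> t = (if t \<le> 1/2 then \<beta> (2 * t + 0) else \<beta>' (2 * t + (-1)))" for t :: real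
    have eq1: "\<beta> (2 * t + 0) = \<eta> t" if "t \<in> {0..1/2}" for t using that by (simp add: \<eta>_def)
    have eq2: "\<beta>' (2 * t + (-1)) = \<eta> t" if "t \<in> {1/2..1}" for t
    proof (cases "t = 1/2")
      case True
      show ?thesis unfolding True using \<beta> \<beta>' by (simp add: \<eta>_def)
    qed (use that in \<open>simp add: \<eta>_def\<close>)
    have C1: "C1_pieces ((\<lambda>t. (t - 0) / 2) ` S) 0 (1/2) \<eta>"
      by (rule C1_pieces_cong[OF eq1 affine_reparametrization(1)[OF g _ _ P]]) auto
    have C2: "C1_pieces ((\<lambda>t. (t - (-1)) / 2) ` S') (1/2) 1 \<eta>"
      by (rule C1_pieces_cong[OF eq2 affine_reparametrization(1)[OF g _ _ P']]) auto
    have L1: "partial_length g 0 (1/2) \<eta> = partial_length g 0 1 \<beta>"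
      using affine_reparametrization(2)[OF g _ _ P] partial_length_cong[OF eq1, where g=g] by simp
    have L2: "partial_length g (1/2) 1 \<eta> = partial_length g 0 1 \<beta>'"
      using affine_reparametrization(2)[OF g _ _ P'] partial_length_cong[OF eq2, where g=g] by simp
    note J = join_pieces[OF g _ _ C1 C2]
    have "piecewise_C1_curve A \<eta>" using J(1) by (auto simp: piecewise_C1_iff_pieces)
    moreover have "riemannian_length A g \<eta> = riemannian_length A g \<beta> + riemannian_length A g \<beta>'"
      unfolding riemannian_length_partial using J(2) L1 L2 by simp
    moreover have "\<eta> 0 = x" "\<eta> 1 = z" using \<beta> \<beta>' by (auto simp: \<eta>_def)
    ultimately show ?thesis
      unfolding riemannian_dist_def by (intro INF_lower2[of \<eta>]) auto
  qed
  show ?thesis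
  proof (rule ennreal_le_epsilon)
    fix e :: real assume fin: "riemannian_dist A g x y + riemannian_dist A g y z < top" and "e > 0"
    have "riemannian_dist A g x y < riemannian_dist A g x y + ennreal (e/2)"
      "riemannian_dist A g y z < riemannian_dist A g y z + ennreal (e/2)"
      using fin \<open>e > 0\<close> by (auto simp: ennreal_add_left_cancel_less[of _ 0, simplified] less_top[symmetric])
    then obtain \<beta> \<beta>' where 
      \<beta>: "piecewise_C1_curve A \<beta>" "\<beta> 0 = x" "\<beta> 1 = y" "riemannian_length A g \<beta> < riemannian_dist A g x y + ennreal (e/2)" and
      \<beta>': "piecewise_C1_curve A \<beta>'" "\<beta>' 0 = y" "\<beta>' 1 = z" "riemannian_length A g \<beta>' < riemannian_dist A g y z + ennreal (e/2)"
      unfolding riemannian_dist_def[of _ _ x y] riemannian_dist_def[of _ _ y z]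
      by (auto simp: INF_less_iff)
    have "riemannian_dist A g x z \<le> riemannian_length A g \<beta> + riemannian_length A g \<beta>'"
      by (rule main) fact+
    also have "\<dots> \<le> (riemannian_dist A g x y + ennreal (e/2)) + (riemannian_dist A g y z + ennreal (e/2))"
      using \<beta> \<beta>' by (intro add_mono) auto
    also have "\<dots> = riemannian_dist A g x y + riemannian_dist A g y z + (ennreal (e/2) + ennreal (e/2))"
      by (simp add: ac_simps)
    also have "ennreal (e/2) + ennreal (e/2) = ennreal e" using \<open>e > 0\<close> by (simp flip: ennreal_plus)
    finally show "riemannian_dist A g x z \<le> riemannian_dist A g x y + riemannian_dist A g y z + ennreal e" .
  qed
qed


section \<open>Comparing lengths with a chart\<close>

text \<open>In any other chart the velocity of a coordinate segment is given by the change of coordinates, which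
  is continuous.\<close>

lemma chart_segment_C1:
  assumes c: "c \<in> A" and seg: "\<And>t. t \<in> {0..1} \<Longrightarrow> z + t *\<^sub>R v \<in> snd c ` fst c"
  shows "C1_pieces {} 0 1 (\<lambda>t. inv_into (fst c) (snd c) (z + t *\<^sub>R v))"
    and "\<And>t. t \<in> {0..1} \<Longrightarrow> ((snd c \<circ> (\<lambda>t. inv_into (fst c) (snd c) (z + t *\<^sub>R v))) has_vector_derivative v) (at t within {0..1})"
proof -
  let ?\<beta> = "\<lambda>t. inv_into (fst c) (snd c) (z + t *\<^sub>R v)"
  have sc: "snd c (?\<beta> t) = z + t *\<^sub>R v" "?\<beta> t \<in> fst c" if "t \<in> {0..1}" for t
    using seg[OF that] by (auto simp: f_inv_into_f inv_into_into)
  have cont: "continuous_on {0..1} ?\<beta>"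
    by (rule continuous_on_compose2[OF chart_inv_continuous[OF c]])
       (use seg in \<open>auto intro!: continuous_intros\<close>)
  show D: "((snd c \<circ> ?\<beta>) has_vector_derivative v) (at t within {0..1})" if t: "t \<in> {0..1}" for t
  proof (rule has_vector_derivative_transform[OF t])
    show "((\<lambda>t. z + t *\<^sub>R v) has_vector_derivative v) (at t within {0..1})"
      by (auto intro!: derivative_eq_intros)
  qed (use sc in auto)
  have "C1_curve_on A {u..w} ?\<beta>" if uw: "0 \<le> u" "u < w" "w \<le> 1" for u w
    unfolding C1_curve_on_def
  proof (intro conjI ballI)
    have sub: "{u..w} \<subseteq> {0..1}" using uw by auto
    show cont': "continuous_on {u..w} ?\<beta>" by (rule continuous_on_subset[OF cont sub])
    fix c' assume c': "c' \<in> A"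
    show "\<exists>D. (\<forall>t\<in>{u..w}. ?\<beta> t \<in> fst c' \<longrightarrow> ((snd c' \<circ> ?\<beta>) has_vector_derivative D t) (at t within {u..w})) \<and>
        continuous_on {t\<in>{u..w}. ?\<beta> t \<in> fst c'} D"
    proof (intro exI[of _ "\<lambda>t. coord_change (?\<beta> t) c c' v"] conjI ballI impI)
      fix t assume t: "t \<in> {u..w}" "?\<beta> t \<in> fst c'"
      show "((snd c' \<circ> ?\<beta>) has_vector_derivative coord_change (?\<beta> t) c c' v) (at t within {u..w})"
      proof (rule change_chart_has_vector_derivative[OF c c' _ _ _ t(1)])
        show "?\<beta> t \<in> fst c \<inter> fst c'" using sc[of t] t sub by auto
        show "continuous (at t within {u..w}) ?\<beta>"
          using cont' t(1) by (simp add: continuous_on_eq_continuous_within)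
        show "((snd c \<circ> ?\<beta>) has_vector_derivative v) (at t within {u..w})"
          using has_vector_derivative_within_subset[OF D sub] t sub by auto
      qed
    next
      show "continuous_on {t\<in>{u..w}. ?\<beta> t \<in> fst c'} (\<lambda>t. coord_change (?\<beta> t) c c' v)"
      proof (rule continuous_on_compose2[OF coord_change_continuous[OF c c', of v]])
        show "continuous_on {t\<in>{u..w}. ?\<beta> t \<in> fst c'} ?\<beta>"
          by (rule continuous_on_subset[OF cont']) auto
        show "?\<beta> ` {t\<in>{u..w}. ?\<beta> t \<in> fst c'} \<subseteq> fst c \<inter> fst c'"
          using sc sub by fastforce
      qed
    qed
  qed
  then show "C1_pieces {} 0 1 ?\<beta>" using cont by (simp add: C1_pieces_def)
qed

lemma riemannian_dist_le_segment:
  assumes c: "c \<in> A" and xy: "x \<in> fst c" "y \<in> fst c"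
    and seg: "\<And>t. t \<in> {0..1} \<Longrightarrow> snd c x + t *\<^sub>R (snd c y - snd c x) \<in> snd c ` W" and W: "W \<subseteq> fst c"
    and bound: "\<And>p. p \<in> W \<Longrightarrow> form_norm (chart_form g c p) (snd c y - snd c x) \<le> M"
  shows "riemannian_dist A g x y \<le> ennreal M"
proof -
  let ?v = "snd c y - snd c x"
  let ?\<beta> = "\<lambda>t. inv_into (fst c) (snd c) (snd c x + t *\<^sub>R ?v)"
  have seg': "snd c x + t *\<^sub>R ?v \<in> snd c ` fst c" if "t \<in> {0..1}" for t using seg[OF that] W by auto
  note C1 = chart_segment_C1[OF c seg']
  have \<beta>W: "?\<beta> t \<in> W" if t01: "t \<in> {0..1}" for t
  proof -
    obtain w where w: "w \<in> W" "snd c x + t *\<^sub>R ?v = snd c w" using seg[OF t01] by auto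
    then show ?thesis using chart_inv[OF c, of w] W by auto
  qed
  have "riemannian_length A g ?\<beta> = (\<integral>\<^sup>+t. ennreal (speed g ?\<beta> t) * indicator ({0<..<1} - {}) t \<partial>lborel)"
    unfolding riemannian_length_partial by (rule partial_length_interior) simp
  also have "\<dots> \<le> (\<integral>\<^sup>+t. ennreal M * indicator {0<..<1::real} t \<partial>lborel)"
  proof (rule nn_integral_mono)
    fix t :: real
    show "ennreal (speed g ?\<beta> t) * indicator ({0<..<1} - {}) t \<le> ennreal M * indicator {0<..<1} t"
    proof (cases "t \<in> {0<..<1}")
      case True
      have "at t within {0..1} = at t" using True by (intro at_within_interior) auto
      then have "((snd c \<circ> ?\<beta>) has_vector_derivative ?v) (at t)" using C1(2)[of t] True by auto
      moreover have "isCont ?\<beta> t" by (rule C1_pieces_isCont[OF C1(1) True])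
      moreover have "?\<beta> t \<in> W" using \<beta>W True by auto
      ultimately have "speed g ?\<beta> t = form_norm (chart_form g c (?\<beta> t)) ?v"
        using W by (intro speed_eq_form_norm c) auto
      also have "\<dots> \<le> M" using bound \<beta>W True by auto
      finally show ?thesis by (auto intro!: mult_right_mono ennreal_leI)
    qed simp
  qed
  also have "\<dots> = ennreal M" by (simp add: nn_integral_cmult_indicator)
  finally have "riemannian_length A g ?\<beta> \<le> ennreal M" .
  moreover have "piecewise_C1_curve A ?\<beta>" using C1(1) by (auto simp: piecewise_C1_iff_pieces)
  moreover have "?\<beta> 0 = x" "?\<beta> 1 = y" using xy c by simp_all
  ultimately show ?thesis
    unfolding riemannian_dist_def by (intro INF_lower2[of ?\<beta>]) auto
qed

text \<open>While a curve stays in a region on which the Riemannian norm dominates a multiple of a fixed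
  inner product, its length dominates the corresponding multiple of the chart displacement:
  integrate the inner product of the velocity with the displacement.\<close>

lemma riemannian_length_ge_displacement:
  assumes g: "riemannian_metric A g" and c: "c \<in> A" and B: "inner_form B" and "\<kappa> \<ge> 0"
    and \<beta>: "piecewise_C1_curve A \<beta>" and \<tau>: "\<tau> \<in> {0..1}"
    and inW: "\<And>t. t \<in> {0..\<tau>} \<Longrightarrow> \<beta> t \<in> fst c"
    and bound: "\<And>t v. t \<in> {0..\<tau>} \<Longrightarrow> \<kappa> * form_norm B v \<le> form_norm (chart_form g c (\<beta> t)) v"
  shows "ennreal (\<kappa> * form_norm B (snd c (\<beta> \<tau>) - snd c (\<beta> 0))) \<le> riemannian_length A g \<beta>"
proof -
  obtain S where P: "C1_pieces S 0 1 \<beta>" using \<beta> by (auto simp: piecewise_C1_iff_pieces)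
  have S: "finite S" and cont\<beta>: "continuous_on {0..1} \<beta>" using P by (auto simp: C1_pieces_def)
  let ?w = "snd c (\<beta> \<tau>) - snd c (\<beta> 0)"
  let ?n = "form_norm B ?w"
  define G where "G t = speed g \<beta> t * indicator ({0<..<1} - S) t" for t
  have Gm: "(\<lambda>t. ennreal (G t)) = (\<lambda>t. ennreal (speed g \<beta> t) * indicator ({0<..<1} - S) t)"
    by (auto simp: G_def indicator_def)
  have sp0: "speed g \<beta> t \<ge> 0" if "t \<in> {0<..<1} - S" for t
  proof -
    obtain c' where c': "c' \<in> A" "\<beta> t \<in> fst c'" by (rule chart_at)
    have "speed g \<beta> t = form_norm (chart_form g c' (\<beta> t)) (vector_derivative (snd c' \<circ> \<beta>) (at t))"
      by (rule speed_eq_form_norm[OF c' C1_pieces_isCont[OF P] C1_pieces_derivative[OF P that c']]) (use that in auto)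
    then show ?thesis using form_norm_nonneg[OF chart_form_inner_form[OF g c']] by simp
  qed
  have G0: "G t \<ge> 0" for t using sp0[of t] by (auto simp: G_def indicator_def)
  have "(\<lambda>t. enn2real (ennreal (G t))) \<in> borel_measurable borel"
    using speed_measurable[OF g P] unfolding Gm[symmetric] by measurable
  then have Gb: "G \<in> borel_measurable borel" using G0 by simp
  have L: "riemannian_length A g \<beta> = (\<integral>\<^sup>+t. ennreal (G t) \<partial>lborel)"
    unfolding riemannian_length_partial partial_length_interior[OF S] Gm ..
  show ?thesis
  proof (cases "riemannian_length A g \<beta> = \<infinity>")
    case False
    then obtain r where r: "riemannian_length A g \<beta> = ennreal r" "r \<ge> 0"
      by (cases "riemannian_length A g \<beta>") auto
    have GI: "(G has_integral r) UNIV"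
      by (rule nn_integral_has_integral[OF Gb G0 _ r(2)]) (use L r in simp)
    have Gsub: "(G has_integral integral {0..\<tau>} G) {0..\<tau>}"
      using integrable_on_subinterval[of G UNIV 0 \<tau>] GI by (intro integrable_integral) (auto simp: integrable_on_def)
    have le_r: "integral {0..\<tau>} G \<le> r"
      by (rule has_integral_subset_le[OF _ Gsub GI]) (use G0 in auto)
    \<comment> \<open>The derivative of \<open>t \<mapsto> B ?w (snd c (\<beta> t))\<close>; the value at the finitely many
        break points is immaterial, and 0 keeps the pointwise bound below valid there.\<close>
    define f' where "f' t = (if t \<in> {0<..<\<tau>} - S then B ?w (vector_derivative (snd c \<circ> \<beta>) (at t)) else 0)" for t
    have "(f' has_integral B ?w (snd c (\<beta> \<tau>)) - B ?w (snd c (\<beta> 0))) {0..\<tau>}"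
    proof (rule fundamental_theorem_of_calculus_interior_strong[OF S])
      show "0 \<le> \<tau>" using \<tau> by simp
      have blin: "bounded_linear (B ?w)"
        using inner_form_bilinear[OF B] by (auto simp: bilinear_def linear_conv_bounded_linear)
      fix t assume t: "t \<in> {0<..<\<tau>} - S"
      then have "((snd c \<circ> \<beta>) has_vector_derivative vector_derivative (snd c \<circ> \<beta>) (at t)) (at t)"
        using \<tau> by (intro C1_pieces_derivative[OF P _ c inW]) auto
      from bounded_linear.has_vector_derivative[OF blin this]
      show "((\<lambda>t. B ?w (snd c (\<beta> t))) has_vector_derivative f' t) (at t)" using t by (simp add: f'_def)
    next
      have blin: "bounded_linear (B ?w)"
        using inner_form_bilinear[OF B] by (auto simp: bilinear_def linear_conv_bounded_linear)
      have "continuous_on {0..\<tau>} (\<lambda>t. snd c (\<beta> t))"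
        by (rule continuous_on_compose2[OF chart_continuous[OF c] continuous_on_subset[OF cont\<beta>]])
           (use \<tau> inW in auto)
      then show "continuous_on {0..\<tau>} (\<lambda>t. B ?w (snd c (\<beta> t)))"
        by (rule bounded_linear.continuous_on[OF blin])
    qed
    moreover have "B ?w (snd c (\<beta> \<tau>)) - B ?w (snd c (\<beta> 0)) = ?n * ?n"
      using form_norm_power2[OF B, of ?w] bilinear_rsub[OF inner_form_bilinear[OF B], of ?w]
      by (simp add: power2_eq_square)
    ultimately have "((\<lambda>t. \<kappa> * f' t) has_integral \<kappa> * (?n * ?n)) {0..\<tau>}"
      by (metis has_integral_mult_right)
    moreover have "((\<lambda>t. ?n * G t) has_integral ?n * integral {0..\<tau>} G) {0..\<tau>}"
      using Gsub by (rule has_integral_mult_right)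
    moreover have "\<kappa> * f' t \<le> ?n * G t" if "t \<in> {0..\<tau>}" for t
    proof (cases "t \<in> {0<..<\<tau>} - S")
      case True
      let ?D = "vector_derivative (snd c \<circ> \<beta>) (at t)"
      have t1: "t \<in> {0<..<1} - S" using True \<tau> by auto
      have "\<kappa> * f' t \<le> \<kappa> * (?n * form_norm B ?D)"
        using True form_Cauchy_Schwarz[OF B, of ?w ?D] \<open>\<kappa> \<ge> 0\<close> by (simp add: f'_def mult_left_mono)
      also have "\<dots> = ?n * (\<kappa> * form_norm B ?D)" by simp
      also have "\<dots> \<le> ?n * form_norm (chart_form g c (\<beta> t)) ?D"
        by (intro mult_left_mono bound form_norm_nonneg[OF B]) (use True in auto)
      also have "form_norm (chart_form g c (\<beta> t)) ?D = speed g \<beta> t"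
        by (rule speed_eq_form_norm[OF c inW C1_pieces_isCont[OF P] C1_pieces_derivative[OF P t1 c inW], symmetric])
           (use True t1 in auto)
      finally show ?thesis using t1 by (simp add: G_def)
    next
      case False
      then have "f' t = 0" unfolding f'_def by (simp only: if_False)
      then show ?thesis using form_norm_nonneg[OF B, of ?w] G0[of t] by simp
    qed
    ultimately have "\<kappa> * (?n * ?n) \<le> ?n * integral {0..\<tau>} G" by (rule has_integral_le)
    also have "\<dots> \<le> ?n * r" using le_r form_norm_nonneg[OF B] by (intro mult_left_mono) auto
    finally have "?n * (\<kappa> * ?n) \<le> ?n * r" by (simp add: ac_simps)
    then have "\<kappa> * ?n \<le> r" using form_norm_nonneg[OF B, of ?w] r(2) by (cases "?n = 0") auto
    then show ?thesis by (simp add: r ennreal_leI)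
  qed simp
qed

text \<open>In the application \<open>K\<close> is a closed coordinate ball. The exit time is the first parameter at which the
  curve is outside the open ball; up to it the curve stays in \<open>K\<close>, which is closed because it is compact.\<close>

lemma exit_time:
  fixes \<beta> :: "real \<Rightarrow> 'a"
  assumes c: "c \<in> A" and cont: "continuous_on {0..1} \<beta>" and f: "continuous_on UNIV f"
    and K: "K = {p \<in> fst c. f (snd c p) \<le> R}" "compact K"
    and start: "\<beta> 0 \<in> fst c" "f (snd c (\<beta> 0)) < (R::real)"
  shows "(\<forall>t\<in>{0..1}. \<beta> t \<in> K) \<or> (\<exists>\<tau>\<in>{0..1}. (\<forall>t\<in>{0..\<tau>}. \<beta> t \<in> K) \<and> f (snd c (\<beta> \<tau>)) = R)"
proof -
  define U where "U = {p \<in> fst c. snd c p \<in> {z. f z < R}}"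
  have "open {z. f z < R}" using f by (intro open_Collect_less) auto
  then have U: "open U" unfolding U_def by (rule open_chart_preimage[OF c])
  define T where "T = {0..1} \<inter> \<beta> -` (- U)"
  have "closed T" unfolding T_def
    using U by (intro continuous_closed_preimage cont) auto
  then have T: "compact T"
    unfolding T_def by (metis Int_lower1 T_def bounded_closed_interval bounded_subset compact_eq_bounded_closed)
  show ?thesis
  proof (cases "T = {}")
    case True
    then have "\<beta> t \<in> U" if "t \<in> {0..1}" for t using that by (auto simp: T_def)
    then show ?thesis by (auto simp: U_def K(1) less_imp_le)
  next
    case False
    then obtain \<tau> where \<tau>: "\<tau> \<in> T" "\<And>t. t \<in> T \<Longrightarrow> \<tau> \<le> t" using compact_attains_inf[OF T] by blast
    have \<tau>01: "\<tau> \<in> {0..1}" and nU: "\<beta> \<tau> \<notin> U" using \<tau>(1) by (auto simp: T_def)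
    have "\<beta> 0 \<in> U" using start by (simp add: U_def)
    then have pos: "\<tau> > 0" using nU \<tau>01 by (cases "\<tau> = 0") auto
    have before: "\<beta> t \<in> U" if "t \<in> {0..<\<tau>}" for t
      using \<tau>(2)[of t] that \<tau>01 by (force simp: T_def)
    have "closed K" using K(2) by (rule compact_imp_closed)
    have "\<beta> ` closure {0..<\<tau>} \<subseteq> closure (\<beta> ` {0..<\<tau>})"
      using pos \<tau>01 by (intro continuous_image_closure_subset[OF cont]) (auto simp: closure_atLeastLessThan)
    also have "\<dots> \<subseteq> K"
      by (rule closure_minimal[OF _ \<open>closed K\<close>]) (use before in \<open>auto simp: U_def K(1) less_imp_le\<close>)
    finally have in_K: "\<forall>t\<in>{0..\<tau>}. \<beta> t \<in> K" using pos by (auto simp: closure_atLeastLessThan)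
    then have "\<beta> \<tau> \<in> K" using pos by auto
    then have "f (snd c (\<beta> \<tau>)) = R" using nU by (auto simp: U_def K(1))
    then show ?thesis using in_K \<tau>01 by blast
  qed
qed

end



section \<open>Continuous families of Riemannian metrics\<close>

locale riemannian_family = manifold A
  for A :: "('a::{t2_space,second_countable_topology}, 'e::euclidean_space) chart set" +
  fixes I :: "real set"
    and g :: "real \<Rightarrow> 'a \<Rightarrow> ('a, 'e) tangent \<Rightarrow> ('a, 'e) tangent \<Rightarrow> real"
  assumes open_I: "open I" and interval_I: "is_interval I"
    and riemannian: "\<And>s. s \<in> I \<Longrightarrow> riemannian_metric A (g s)"
    and joint: "jointly_continuous_family A I g"
begin

abbreviation "N s c p \<equiv> form_norm (chart_form (g s) c p)"

abbreviation "F s \<equiv> riemannian_dist A (g s)"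

text \<open>Short curves are confined to \<open>K\<close>. When \<open>K\<close> is compact, the metrics of the family can be compared
  uniformly along them.\<close>

definition trapped :: "real \<Rightarrow> 'a set \<Rightarrow> 'a set \<Rightarrow> real \<Rightarrow> bool" where
  "trapped s W K r \<longleftrightarrow> (\<forall>\<beta>. piecewise_C1_curve A \<beta> \<and> \<beta> 0 \<in> W \<and> riemannian_length A (g s) \<beta> < ennreal r \<longrightarrow>
     (\<forall>t\<in>{0..1}. \<beta> t \<in> K))"

lemma trappedD:
  "trapped s W K r \<Longrightarrow> piecewise_C1_curve A \<beta> \<Longrightarrow> \<beta> 0 \<in> W \<Longrightarrow> riemannian_length A (g s) \<beta> < ennreal r \<Longrightarrow>
    t \<in> {0..1} \<Longrightarrow> \<beta> t \<in> K"
  unfolding trapped_def by blast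

lemma trapped_mono: "trapped s W K r \<Longrightarrow> W' \<subseteq> W \<Longrightarrow> K \<subseteq> K' \<Longrightarrow> r' \<le> r \<Longrightarrow> trapped s W' K' r'"
  unfolding trapped_def by (meson ennreal_leI less_le_trans subsetD)

lemma chart_form_family: "s \<in> I \<Longrightarrow> c \<in> A \<Longrightarrow> p \<in> fst c \<Longrightarrow> inner_form (chart_form (g s) c p)"
  by (rule chart_form_inner_form[OF riemannian])

text \<open>Only finitely many coefficients have to be close, and their joint continuity provides that.\<close>

lemma chart_norm_near:
  assumes s0: "s0 \<in> I" and c: "c \<in> A" "p0 \<in> fst c" and "\<epsilon> > 0"
  shows "\<exists>\<delta>>0. \<exists>W. open W \<and> p0 \<in> W \<and> W \<subseteq> fst c \<and> (\<forall>s\<in>I. \<bar>s - s0\<bar> < \<delta> \<longrightarrow> (\<forall>p\<in>W. \<forall>v.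
     (1 - \<epsilon>) * N s0 c p0 v \<le> N s c p v \<and> N s c p v \<le> (1 + \<epsilon>) * N s0 c p0 v))"
proof -
  obtain \<eta> where \<eta>: "\<eta> > 0" "\<And>B'. inner_form B' \<Longrightarrow>
      (\<forall>i\<in>Basis. \<forall>j\<in>Basis. \<bar>B' i j - chart_form (g s0) c p0 i j\<bar> < \<eta>) \<Longrightarrow>
    (\<forall>v. (1 - \<epsilon>) * N s0 c p0 v \<le> form_norm B' v \<and> form_norm B' v \<le> (1 + \<epsilon>) * N s0 c p0 v)"
    using inner_form_perturb[OF chart_form_family[OF s0 c] \<open>\<epsilon> > 0\<close>] by blast
  let ?Q = "\<lambda>z. \<forall>i\<in>Basis. \<forall>j\<in>Basis. \<bar>chart_form (g (fst z)) c (snd z) i j - chart_form (g s0) c p0 i j\<bar> < \<eta>"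
  have op: "open (I \<times> fst c)" using open_I open_chart[OF c(1)] by (rule open_Times)
  have "\<forall>\<^sub>F z in nhds (s0, p0). ?Q z"
  proof (intro eventually_ball_finite ballI finite_Basis)
    fix i j :: 'e assume ij: "i \<in> Basis" "j \<in> Basis"
    define \<phi> where "\<phi> z = chart_form (g (fst z)) c (snd z) i j" for z
    have "continuous_on (I \<times> fst c) \<phi>"
      using joint c(1) ij unfolding jointly_continuous_family_def metric_coeff_chart_form \<phi>_def
      by (auto simp: case_prod_unfold)
    then have "isCont \<phi> (s0, p0)"
      using op s0 c by (simp add: continuous_on_eq_continuous_at)
    then have "(\<phi> \<longlongrightarrow> \<phi> (s0, p0)) (nhds (s0, p0))"
      unfolding isCont_def by (rule tendsto_at_iff_tendsto_nhds[THEN iffD1])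
    from tendstoD[OF this \<eta>(1)]
    show "\<forall>\<^sub>F z in nhds (s0, p0). \<bar>chart_form (g (fst z)) c (snd z) i j - chart_form (g s0) c p0 i j\<bar> < \<eta>"
      by (simp add: dist_real_def \<phi>_def)
  qed
  then obtain T where T: "open T" "(s0, p0) \<in> T" "\<And>z. z \<in> T \<Longrightarrow> ?Q z"
    unfolding eventually_nhds by blast
  obtain X Y where XY: "open X" "open Y" "(s0, p0) \<in> X \<times> Y" "X \<times> Y \<subseteq> T"
    using open_prod_elim[OF T(1,2)] by blast
  then obtain \<delta> where \<delta>: "\<delta> > 0" "ball s0 \<delta> \<subseteq> X" by (metis mem_Sigma_iff openE)
  show ?thesis
  proof (intro exI[of _ \<delta>] conjI \<delta>(1) exI[of _ "Y \<inter> fst c"] ballI impI)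
    show "open (Y \<inter> fst c)" using XY open_chart[OF c(1)] by auto
    show "p0 \<in> Y \<inter> fst c" using XY c by auto
    fix s p assume s: "s \<in> I" "\<bar>s - s0\<bar> < \<delta>" and p: "p \<in> Y \<inter> fst c"
    have "s \<in> X" using s \<delta>(2) by (auto simp: dist_real_def abs_minus_commute)
    then have "?Q (s, p)" using XY(4) p by (intro T(3)) auto
    then show "\<forall>v. (1 - \<epsilon>) * N s0 c p0 v \<le> N s c p v \<and> N s c p v \<le> (1 + \<epsilon>) * N s0 c p0 v"
      using \<eta>(2)[OF chart_form_family[OF s(1) c(1)], of p] p by simp
  qed auto
qed

text \<open>Near a point, the distance of every metric of the family with parameter close to \<open>s0\<close> differs
  from the norm at \<open>(s0, p0)\<close> of the chart displacement by a factor arbitrarily close to 1: segments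
  give the upper bound, and a competing curve is long if it leaves the coordinate ball.\<close>

lemma local_comparison:
  assumes s0: "s0 \<in> I" and c: "c \<in> A" and U: "open U" "p0 \<in> U" "p0 \<in> fst c" and \<epsilon>: "0 < \<epsilon>" "\<epsilon> < 1"
  shows "\<exists>\<delta> r W K. \<delta> > 0 \<and> r > 0 \<and> open W \<and> p0 \<in> W \<and> W \<subseteq> K \<and> K \<subseteq> U \<inter> fst c \<and> compact K \<and>
    convex (snd c ` W) \<and>
    (\<forall>s\<in>I. \<bar>s - s0\<bar> < \<delta> \<longrightarrow> trapped s W K r \<and> (\<forall>x\<in>W. \<forall>y\<in>W.
       ennreal ((1 - \<epsilon>) * N s0 c p0 (snd c y - snd c x)) \<le> F s x y \<and>
       F s x y \<le> ennreal ((1 + \<epsilon>) * N s0 c p0 (snd c y - snd c x))))"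
proof -
  define B where "B = chart_form (g s0) c p0"
  have B: "inner_form B" unfolding B_def by (rule chart_form_family[OF s0 c U(3)])
  let ?n = "form_norm B"
  define z0 where "z0 = snd c p0"
  obtain \<delta> W0 where \<delta>: "\<delta> > 0" and W0: "open W0" "p0 \<in> W0" "W0 \<subseteq> fst c"
    and near': "\<forall>s\<in>I. \<bar>s - s0\<bar> < \<delta> \<longrightarrow> (\<forall>p\<in>W0. \<forall>v. (1 - \<epsilon>) * ?n v \<le> N s c p v \<and> N s c p v \<le> (1 + \<epsilon>) * ?n v)"
    using chart_norm_near[OF s0 c U(3) \<epsilon>(1)] unfolding B_def by (elim exE conjE)
  have near: "(1 - \<epsilon>) * ?n v \<le> N s c p v \<and> N s c p v \<le> (1 + \<epsilon>) * ?n v"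
    if "s \<in> I" "\<bar>s - s0\<bar> < \<delta>" "p \<in> W0" for s p v using near' that by blast
  obtain m where m: "m > 0" "\<And>v. m * norm v \<le> ?n v" by (rule form_norm_lower[OF B]) blast
  have "open (snd c ` (W0 \<inter> U))" using W0 U by (intro open_chart_image_subset[OF c]) auto
  moreover have "z0 \<in> snd c ` (W0 \<inter> U)" using W0(2) U(2) by (simp add: z0_def)
  ultimately have "\<exists>\<rho>>0. cball z0 \<rho> \<subseteq> snd c ` (W0 \<inter> U)" by (meson open_contains_cball)
  then obtain \<rho> where \<rho>: "\<rho> > 0" "cball z0 \<rho> \<subseteq> snd c ` (W0 \<inter> U)" by blast
  define R where "R = m * \<rho>"
  have R: "R > 0" using m \<rho> by (simp add: R_def)
  have ballR: "z \<in> cball z0 \<rho>" if "?n (z - z0) \<le> R" for z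
  proof -
    have "m * norm (z - z0) \<le> m * \<rho>" using m(2)[of "z - z0"] that by (simp add: R_def)
    then show ?thesis using m(1) by (simp add: dist_norm norm_minus_commute)
  qed
  have fcont: "continuous_on S (\<lambda>z. ?n (z - z0))" for S
    by (rule continuous_on_compose2[OF form_norm_continuous[OF B, of UNIV]]) (auto intro!: continuous_intros)
  \<comment> \<open>Points of \<open>W\<close> have displacements less than \<open>R / 2\<close>, while a curve from \<open>W\<close> to the boundary of \<open>K\<close>
      has a displacement of more than \<open>R / 2\<close>; so a curve that leaves \<open>K\<close> is no shortcut.\<close>
  define K where "K = {p \<in> fst c. ?n (snd c p - z0) \<le> R}"
  define W where "W = {p \<in> fst c. ?n (snd c p - z0) < R / 4}"
  have img: "z \<in> snd c ` (W0 \<inter> U)" if "?n (z - z0) \<le> R" for z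
    using ballR[OF that] \<rho>(2) by blast
  have K_sub: "K \<subseteq> W0 \<inter> U"
  proof
    fix p assume p: "p \<in> K"
    then obtain q where q: "q \<in> W0 \<inter> U" "snd c p = snd c q" using img[of "snd c p"] by (auto simp: K_def)
    then have "p = q" using p W0(3) chart_inj[OF c] by (auto simp: K_def inj_on_def)
    then show "p \<in> W0 \<inter> U" using q by simp
  qed
  have "compact {z. ?n (z - z0) \<le> R}"
  proof -
    have "bounded {z. ?n (z - z0) \<le> R}"
      by (rule bounded_subset[OF bounded_cball[of z0 \<rho>]]) (use ballR in auto)
    moreover have "closed {z. ?n (z - z0) \<le> R}"
      by (intro closed_Collect_le fcont continuous_on_const)
    ultimately show ?thesis by (simp add: compact_eq_bounded_closed)
  qed
  then have K: "compact K"
    unfolding K_def using compact_chart_preimage[OF c, of "{z. ?n (z - z0) \<le> R}"] img W0(3) by auto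
  have "open {z. ?n (z - z0) < R / 4}" by (intro open_Collect_less fcont continuous_on_const)
  then have W: "open W" unfolding W_def using open_chart_preimage[OF c, of "{z. ?n (z - z0) < R / 4}"] by simp
  have p0W: "p0 \<in> W" using U(3) R by (simp add: W_def z0_def form_norm_0[OF B])
  have WK: "W \<subseteq> K" using R by (auto simp: W_def K_def)
  have imgW: "snd c ` W = {z. ?n (z - z0) < R / 4}"
  proof (intro set_eqI iffI)
    fix z assume z: "z \<in> {z. ?n (z - z0) < R / 4}"
    then have "z \<in> snd c ` (W0 \<inter> U)" using img[of z] R by auto
    then show "z \<in> snd c ` W" using z W0(3) by (auto simp: W_def)
  qed (auto simp: W_def)
  have conv: "convex (snd c ` W)" unfolding imgW
  proof (rule convexI)
    fix x y :: 'e and u v :: real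
    assume *: "x \<in> {z. ?n (z - z0) < R / 4}" "y \<in> {z. ?n (z - z0) < R / 4}" "0 \<le> u" "0 \<le> v" "u + v = 1"
    have "(u *\<^sub>R x + v *\<^sub>R y) - z0 = u *\<^sub>R (x - z0) + v *\<^sub>R (y - z0)"
      using *(5) by (simp add: algebra_simps flip: scaleR_add_left)
    then have "?n ((u *\<^sub>R x + v *\<^sub>R y) - z0) \<le> u * ?n (x - z0) + v * ?n (y - z0)"
      using form_norm_triangle[OF B, of "u *\<^sub>R (x - z0)" "v *\<^sub>R (y - z0)"] *
      by (simp add: form_norm_scale[OF B])
    also have "\<dots> < R / 4" using * by (intro convex_bound_lt) auto
    finally show "u *\<^sub>R x + v *\<^sub>R y \<in> {z. ?n (z - z0) < R / 4}" by simp
  qed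
  define r where "r = (1 - \<epsilon>) * (R / 2)"
  have r: "r > 0" using \<epsilon> R by (simp add: r_def)
  show ?thesis
  proof (rule exI[of _ \<delta>], rule exI[of _ r], rule exI[of _ W], rule exI[of _ K],
      intro conjI \<delta> r W p0W WK K conv ballI impI allI)
    show "K \<subseteq> U \<inter> fst c" using K_sub W0(3) by auto
    fix s assume s: "s \<in> I" "\<bar>s - s0\<bar> < \<delta>"
    have curve: "(\<forall>t\<in>{0..1}. \<beta> t \<in> K) \<and> ennreal ((1 - \<epsilon>) * ?n (snd c (\<beta> 1) - snd c x)) \<le> riemannian_length A (g s) \<beta>
        \<or> ennreal r \<le> riemannian_length A (g s) \<beta>"
      if x: "x \<in> W" and \<beta>: "piecewise_C1_curve A \<beta>" "\<beta> 0 = x" for x \<beta>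
    proof -
      have xW: "x \<in> fst c" "?n (snd c x - z0) < R / 4" using x by (auto simp: W_def)
      have disp: "ennreal ((1 - \<epsilon>) * ?n (snd c (\<beta> \<tau>) - snd c (\<beta> 0))) \<le> riemannian_length A (g s) \<beta>"
        if \<tau>: "\<tau> \<in> {0..1}" and inK: "\<forall>t\<in>{0..\<tau>}. \<beta> t \<in> K" for \<tau>
      proof (rule riemannian_length_ge_displacement[OF riemannian[OF s(1)] c B _ \<beta>(1) \<tau>])
        show "0 \<le> 1 - \<epsilon>" using \<epsilon> by simp
        fix t assume t: "t \<in> {0..\<tau>}"
        then have "\<beta> t \<in> W0" using inK K_sub by blast
        then show "\<beta> t \<in> fst c" "\<And>v. (1 - \<epsilon>) * ?n v \<le> N s c (\<beta> t) v" using W0(3) near[OF s] by auto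
      qed
      have cont: "continuous_on {0..1} \<beta>" using \<beta>(1) by (simp add: piecewise_C1_curve_def)
      have "(\<forall>t\<in>{0..1}. \<beta> t \<in> K) \<or> (\<exists>\<tau>\<in>{0..1}. (\<forall>t\<in>{0..\<tau>}. \<beta> t \<in> K) \<and> ?n (snd c (\<beta> \<tau>) - z0) = R)"
        by (rule exit_time[OF c cont fcont K_def K]) (use \<beta>(2) xW R in auto)
      then show ?thesis
      proof
        assume "\<forall>t\<in>{0..1}. \<beta> t \<in> K"
        then show ?thesis using disp[of 1] \<beta>(2) by simp
      next
        assume "\<exists>\<tau>\<in>{0..1}. (\<forall>t\<in>{0..\<tau>}. \<beta> t \<in> K) \<and> ?n (snd c (\<beta> \<tau>) - z0) = R"
        then obtain \<tau> where \<tau>: "\<tau> \<in> {0..1}" "\<forall>t\<in>{0..\<tau>}. \<beta> t \<in> K" "?n (snd c (\<beta> \<tau>) - z0) = R" by blast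
        have "R \<le> ?n (snd c (\<beta> \<tau>) - snd c x) + ?n (snd c x - z0)"
          using form_norm_triangle[OF B, of "snd c (\<beta> \<tau>) - snd c x" "snd c x - z0"] \<tau>(3) by simp
        then have "R / 2 \<le> ?n (snd c (\<beta> \<tau>) - snd c x)" using xW(2) R by linarith
        then have "r \<le> (1 - \<epsilon>) * ?n (snd c (\<beta> \<tau>) - snd c x)"
          unfolding r_def using \<epsilon> by (intro mult_left_mono) auto
        then have "ennreal r \<le> ennreal ((1 - \<epsilon>) * ?n (snd c (\<beta> \<tau>) - snd c x))" by (rule ennreal_leI)
        also have "\<dots> \<le> riemannian_length A (g s) \<beta>" using disp[OF \<tau>(1,2)] \<beta>(2) by simp
        finally show ?thesis by simp
      qed
    qed
    show "trapped s W K r" unfolding trapped_def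
    proof (intro allI impI)
      fix \<beta> assume "piecewise_C1_curve A \<beta> \<and> \<beta> 0 \<in> W \<and> riemannian_length A (g s) \<beta> < ennreal r"
      then show "\<forall>t\<in>{0..1}. \<beta> t \<in> K" using curve[of "\<beta> 0" \<beta>] by (auto simp: not_le)
    qed
    fix x y assume x: "x \<in> W" and y: "y \<in> W"
    have xW: "x \<in> fst c" "?n (snd c x - z0) < R / 4" using x by (auto simp: W_def)
    have yW: "y \<in> fst c" "?n (snd c y - z0) < R / 4" using y by (auto simp: W_def)
    have "?n (snd c y - snd c x) \<le> ?n (snd c y - z0) + ?n (z0 - snd c x)"
      using form_norm_triangle[OF B, of "snd c y - z0" "z0 - snd c x"] by simp
    also have "?n (z0 - snd c x) = ?n (snd c x - z0)" using form_norm_minus[OF B, of "snd c x - z0"] by simp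
    finally have "?n (snd c y - snd c x) \<le> R / 2" using xW yW by simp
    then have "(1 - \<epsilon>) * ?n (snd c y - snd c x) \<le> r"
      unfolding r_def using \<epsilon> by (intro mult_left_mono) auto
    then have le_r: "ennreal ((1 - \<epsilon>) * ?n (snd c y - snd c x)) \<le> ennreal r" by (rule ennreal_leI)
    have "ennreal ((1 - \<epsilon>) * ?n (snd c y - snd c x)) \<le> F s x y"
      unfolding riemannian_dist_def
    proof (rule INF_greatest)
      fix \<beta> assume "\<beta> \<in> {\<beta>. piecewise_C1_curve A \<beta> \<and> \<beta> 0 = x \<and> \<beta> 1 = y}"
      then show "ennreal ((1 - \<epsilon>) * ?n (snd c y - snd c x)) \<le> riemannian_length A (g s) \<beta>"
        using curve[OF x, of \<beta>] le_r by (auto intro: order_trans)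
    qed
    then show "ennreal ((1 - \<epsilon>) * N s0 c p0 (snd c y - snd c x)) \<le> F s x y" by (simp add: B_def)
    have "F s x y \<le> ennreal ((1 + \<epsilon>) * ?n (snd c y - snd c x))"
    proof (rule riemannian_dist_le_segment[OF c xW(1) yW(1), where W=W])
      show "W \<subseteq> fst c" by (auto simp: W_def)
      fix t :: real assume t: "t \<in> {0..1}"
      have "(1 - t) *\<^sub>R snd c x + t *\<^sub>R snd c y \<in> snd c ` W"
        using t x y by (intro convexD[OF conv]) auto
      then show "snd c x + t *\<^sub>R (snd c y - snd c x) \<in> snd c ` W" by (simp add: algebra_simps)
    next
      fix p assume "p \<in> W"
      then have "p \<in> W0" using WK K_sub by blast
      then show "N s c p (snd c y - snd c x) \<le> (1 + \<epsilon>) * ?n (snd c y - snd c x)" using near[OF s] by blast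
    qed
    then show "F s x y \<le> ennreal ((1 + \<epsilon>) * N s0 c p0 (snd c y - snd c x))" by (simp add: B_def)
  qed
qed


lemma compact_chart_neighbourhood:
  fixes p :: 'a
  assumes "open U" "p \<in> U"
  obtains W K where "open W" "p \<in> W" "W \<subseteq> K" "K \<subseteq> U" "compact K"
proof -
  obtain c where c: "c \<in> A" "p \<in> fst c" by (rule chart_at)
  have op: "open (snd c ` (fst c \<inter> U))"
    using open_chart[OF c(1)] assms by (intro open_chart_image_subset[OF c(1)]) auto
  have "snd c p \<in> snd c ` (fst c \<inter> U)" using c assms by blast
  with op have "\<exists>\<rho>>0. cball (snd c p) \<rho> \<subseteq> snd c ` (fst c \<inter> U)" by (meson open_contains_cball)
  then obtain \<rho> where \<rho>: "\<rho> > 0" "cball (snd c p) \<rho> \<subseteq> snd c ` (fst c \<inter> U)" by blast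
  let ?W = "{q \<in> fst c. snd c q \<in> ball (snd c p) \<rho>}" and ?K = "{q \<in> fst c. snd c q \<in> cball (snd c p) \<rho>}"
  show ?thesis
  proof
    show "open ?W" by (rule open_chart_preimage[OF c(1) open_ball])
    show "compact ?K" using \<rho>(2) by (intro compact_chart_preimage[OF c(1) compact_cball]) auto
    show "p \<in> ?W" using c \<rho>(1) by simp
    show "?W \<subseteq> ?K" by auto
    show "?K \<subseteq> U"
    proof
      fix q assume q: "q \<in> ?K"
      then obtain q' where "q' \<in> fst c \<inter> U" "snd c q = snd c q'" using \<rho>(2) by blast
      then show "q \<in> U" using q chart_inj[OF c(1)] by (auto simp: inj_on_def)
    qed
  qed
qed

lemma half_in_unit_interval: "0 < (1/2::real)" "(1/2::real) < 1"
  by auto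

lemma dist_small_imp_mem:
  assumes s: "s \<in> I" and U: "open U" "p \<in> U"
  obtains r where "r > 0" "\<And>y. F s p y < ennreal r \<Longrightarrow> y \<in> U"
proof -
  obtain c where c: "c \<in> A" "p \<in> fst c" by (rule chart_at)
  obtain \<delta> r W K where *: "\<delta> > 0" "r > 0" "open W" "p \<in> W" "W \<subseteq> K" "K \<subseteq> U \<inter> fst c" "compact K" "convex (snd c ` W)"
    and near: "\<forall>s'\<in>I. \<bar>s' - s\<bar> < \<delta> \<longrightarrow> trapped s' W K r \<and> (\<forall>x\<in>W. \<forall>y\<in>W.
       ennreal ((1 - 1/2) * N s c p (snd c y - snd c x)) \<le> F s' x y \<and>
       F s' x y \<le> ennreal ((1 + 1/2) * N s c p (snd c y - snd c x)))"
    using local_comparison[OF s c(1) U c(2) half_in_unit_interval] by (elim exE conjE)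
  have tr: "trapped s W K r" using near s *(1) by auto
  have "y \<in> U" if "F s p y < ennreal r" for y
  proof -
    from that obtain \<beta> where "piecewise_C1_curve A \<beta>" "\<beta> 0 = p" "\<beta> 1 = y" "riemannian_length A (g s) \<beta> < ennreal r"
      unfolding riemannian_dist_def by (auto simp: INF_less_iff)
    then have "\<beta> 1 \<in> K" using *(4) by (intro trappedD[OF tr]) auto
    then show ?thesis using \<open>\<beta> 1 = y\<close> *(6) by auto
  qed
  with *(2) show ?thesis by (rule that)
qed

lemma dist_le_displacement:
  assumes s: "s \<in> I" and c: "c \<in> A" and p: "p \<in> fst c"
  obtains W where "open W" "p \<in> W" "W \<subseteq> fst c" "convex (snd c ` W)"
    "\<And>x y. x \<in> W \<Longrightarrow> y \<in> W \<Longrightarrow> F s x y \<le> ennreal (2 * N s c p (snd c y - snd c x)) \<and>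
       ennreal (N s c p (snd c y - snd c x) / 2) \<le> F s x y"
proof -
  obtain \<delta> r W K where *: "\<delta> > 0" "r > 0" "open W" "p \<in> W" "W \<subseteq> K" "K \<subseteq> UNIV \<inter> fst c" "compact K" "convex (snd c ` W)"
    and near: "\<forall>s'\<in>I. \<bar>s' - s\<bar> < \<delta> \<longrightarrow> trapped s' W K r \<and> (\<forall>x\<in>W. \<forall>y\<in>W.
       ennreal ((1 - 1/2) * N s c p (snd c y - snd c x)) \<le> F s' x y \<and>
       F s' x y \<le> ennreal ((1 + 1/2) * N s c p (snd c y - snd c x)))"
    using local_comparison[OF s c open_UNIV UNIV_I p half_in_unit_interval] by (elim exE conjE)
  have nn: "N s c p v \<ge> 0" for v by (rule form_norm_nonneg[OF chart_form_family[OF s c p]])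
  have 9: "\<forall>y\<in>W. ennreal ((1 - 1/2) * N s c p (snd c y - snd c x)) \<le> F s x y \<and>
          F s x y \<le> ennreal ((1 + 1/2) * N s c p (snd c y - snd c x))" if "x \<in> W" for x
    using near s that *(1) by auto
  show ?thesis
  proof (rule that[OF *(3,4) _ *(8)])
    show "W \<subseteq> fst c" using *(5,6) by auto
    fix x y assume xy: "x \<in> W" "y \<in> W"
    have "F s x y \<le> ennreal ((1 + 1/2) * N s c p (snd c y - snd c x))" using 9 xy by blast
    also have "\<dots> \<le> ennreal (2 * N s c p (snd c y - snd c x))" using nn by (intro ennreal_leI mult_right_mono) auto
    finally show "F s x y \<le> ennreal (2 * N s c p (snd c y - snd c x)) \<and>
       ennreal (N s c p (snd c y - snd c x) / 2) \<le> F s x y" using 9[OF xy(1)] xy(2) by simp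
  qed
qed

lemma extended_metric_F:
  assumes s: "s \<in> I" shows "extended_metric (F s)"
  unfolding extended_metric_def
proof (intro conjI allI iffI)
  fix x y
  show "F s x y = F s y x" by (rule riemannian_dist_sym[OF riemannian[OF s]])
  show "F s x z \<le> F s x y + F s y z" for z by (rule riemannian_dist_triangle[OF riemannian[OF s]])
  show "x = y" if "F s x y = 0"
  proof (rule ccontr)
    assume "x \<noteq> y"
    obtain r where "r > 0" "\<And>z. F s x z < ennreal r \<Longrightarrow> z \<in> - {y}"
      by (rule dist_small_imp_mem[OF s, of "- {y}" x]) (use \<open>x \<noteq> y\<close> in auto)
    then show False using that by force
  qed
  assume "x = y"
  obtain c where c: "c \<in> A" "x \<in> fst c" by (rule chart_at)
  obtain W where W: "x \<in> W" "\<And>x' y. x' \<in> W \<Longrightarrow> y \<in> W \<Longrightarrow> F s x' y \<le> ennreal (2 * N s c x (snd c y - snd c x')) \<and>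
       ennreal (N s c x (snd c y - snd c x') / 2) \<le> F s x' y"
    using dist_le_displacement[OF s c] by metis
  have "F s x x \<le> 0" using W(2)[OF W(1) W(1)] by (simp add: form_norm_0[OF chart_form_family[OF s c]])
  then show "F s x y = 0" using \<open>x = y\<close> by simp
qed

lemma F_le_induced_length_metric: "F s x y \<le> induced_length_metric (F s) x y"
  unfolding induced_length_metric_def
proof (rule INF_greatest, clarify)
  fix c :: "real \<Rightarrow> 'a"
  have "(\<Sum>i<1. F s (c (real i)) (c (real (Suc i)))) \<le> curve_length (F s) 0 1 c"
    by (rule sum_le_curve_length) (auto simp: mono_on_def)
  then show "F s (c 0) (c 1) \<le> curve_length (F s) 0 1 c" by simp
qed

text \<open>The induced length metric is bounded from above by the length of a coordinate segment; from below it
  is bounded by the distance itself. The segment stays in \<open>W\<close> by convexity.\<close>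

lemma induced_length_metric_le_displacement:
  assumes s: "s \<in> I" and c: "c \<in> A" and p: "p \<in> fst c"
    and W: "W \<subseteq> fst c" "convex (snd c ` W)"
    "\<And>x y. x \<in> W \<Longrightarrow> y \<in> W \<Longrightarrow> F s x y \<le> ennreal (2 * N s c p (snd c y - snd c x))"
    and xy: "x \<in> W" "y \<in> W"
  shows "induced_length_metric (F s) x y \<le> ennreal (2 * N s c p (snd c y - snd c x))"
proof -
  let ?v = "snd c y - snd c x" and ?n = "N s c p"
  have B: "inner_form (chart_form (g s) c p)" by (rule chart_form_family[OF s c p])
  define \<beta> where "\<beta> t = inv_into (fst c) (snd c) (snd c x + t *\<^sub>R ?v)" for t
  have \<beta>: "\<beta> t \<in> W" "snd c (\<beta> t) = snd c x + t *\<^sub>R ?v" if t: "t \<in> {0..1}" for t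
  proof -
    have "(1 - t) *\<^sub>R snd c x + t *\<^sub>R snd c y \<in> snd c ` W"
      using t xy by (intro convexD[OF W(2)]) auto
    then have "snd c x + t *\<^sub>R ?v \<in> snd c ` W" by (simp add: algebra_simps)
    then obtain w where w: "w \<in> W" "snd c x + t *\<^sub>R ?v = snd c w" by auto
    then have "\<beta> t = w" unfolding \<beta>_def using W(1) chart_inv[OF c] by auto
    then show "\<beta> t \<in> W" "snd c (\<beta> t) = snd c x + t *\<^sub>R ?v" using w by auto
  qed
  have d: "F s (\<beta> u) (\<beta> t) \<le> ennreal (\<bar>t - u\<bar> * (2 * ?n ?v))" if "u \<in> {0..1}" "t \<in> {0..1}" for u t
  proof -
    have "snd c (\<beta> t) - snd c (\<beta> u) = (t - u) *\<^sub>R ?v"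
      unfolding \<beta>(2)[OF that(1)] \<beta>(2)[OF that(2)] by (simp add: algebra_simps)
    then show ?thesis using W(3)[OF \<beta>(1)[OF that(1)] \<beta>(1)[OF that(2)]]
      by (simp add: form_norm_scale[OF B] mult_ac)
  qed
  have n0: "0 \<le> 2 * ?n ?v" using form_norm_nonneg[OF B] by simp
  have "continuous_curve (F s) 0 1 \<beta>"
    unfolding continuous_curve_def
  proof
    fix t :: real assume t: "t \<in> {0..1}"
    show "((\<lambda>u. F s (\<beta> u) (\<beta> t)) \<longlongrightarrow> 0) (at t within {0..1})"
    proof (rule tendsto_sandwich[where f="\<lambda>_. 0"])
      show "\<forall>\<^sub>F u in at t within {0..1}. F s (\<beta> u) (\<beta> t) \<le> ennreal (\<bar>t - u\<bar> * (2 * ?n ?v))"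
        unfolding eventually_at_filter by (rule always_eventually) (use d t in auto)
      have "((\<lambda>u. \<bar>t - u\<bar> * (2 * ?n ?v)) \<longlongrightarrow> \<bar>t - t\<bar> * (2 * ?n ?v)) (at t within {0..1})"
        by (intro tendsto_intros)
      from tendsto_ennrealI[OF this]
      show "((\<lambda>u. ennreal (\<bar>t - u\<bar> * (2 * ?n ?v))) \<longlongrightarrow> 0) (at t within {0..1})" by simp
    qed auto
  qed
  moreover have "\<beta> 0 = x" "\<beta> 1 = y" using xy W(1) c by (auto simp: \<beta>_def)
  moreover have "curve_length (F s) 0 1 \<beta> \<le> ennreal (2 * ?n ?v)"
  proof (rule curve_length_leI)
    fix n and \<tau> :: "nat \<Rightarrow> real" assume \<tau>: "mono_on {..n} \<tau>" "\<tau> ` {..n} \<subseteq> {0..1}"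
    have mono: "\<tau> i \<le> \<tau> (Suc i)" if "i < n" for i using \<tau>(1) that by (auto simp: mono_on_def)
    have "(\<Sum>i<n. F s (\<beta> (\<tau> i)) (\<beta> (\<tau> (Suc i)))) \<le> (\<Sum>i<n. ennreal ((\<tau> (Suc i) - \<tau> i) * (2 * ?n ?v)))"
    proof (rule sum_mono)
      fix i assume i: "i \<in> {..<n}"
      then have "\<tau> i \<in> {0..1}" "\<tau> (Suc i) \<in> {0..1}" using \<tau>(2) by (auto simp: image_subset_iff)
      from d[OF this] mono[of i] i show "F s (\<beta> (\<tau> i)) (\<beta> (\<tau> (Suc i))) \<le> ennreal ((\<tau> (Suc i) - \<tau> i) * (2 * ?n ?v))"
        by simp
    qed
    also have "\<dots> = ennreal (\<Sum>i<n. (\<tau> (Suc i) - \<tau> i) * (2 * ?n ?v))"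
      using mono n0 by (intro sum_ennreal mult_nonneg_nonneg) auto
    also have "(\<Sum>i<n. (\<tau> (Suc i) - \<tau> i) * (2 * ?n ?v)) = (\<tau> n - \<tau> 0) * (2 * ?n ?v)"
      by (simp add: sum_lessThan_telescope flip: sum_distrib_right)
    also have "ennreal \<dots> \<le> ennreal (1 * (2 * ?n ?v))"
    proof (intro ennreal_leI mult_right_mono n0)
      have "\<tau> n \<in> {0..1}" "\<tau> 0 \<in> {0..1}" using \<tau>(2) by (auto simp: image_subset_iff)
      then show "\<tau> n - \<tau> 0 \<le> 1" by simp
    qed
    finally show "(\<Sum>i<n. F s (\<beta> (\<tau> i)) (\<beta> (\<tau> (Suc i)))) \<le> ennreal (2 * ?n ?v)" by simp
  qed
  ultimately show ?thesis
    unfolding induced_length_metric_def by (intro INF_lower2[of \<beta>]) auto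
qed

lemma generates_topology_induced:
  assumes s: "s \<in> I" shows "generates_topology (induced_length_metric (F s))"
  unfolding generates_topology_def
proof (intro allI iffI ballI)
  fix S :: "'a set" and x assume S: "open S" and x: "x \<in> S"
  obtain r where r: "r > 0" "\<And>y. F s x y < ennreal r \<Longrightarrow> y \<in> S"
    by (rule dist_small_imp_mem[OF s S x]) blast
  show "\<exists>e>0. \<forall>y. induced_length_metric (F s) x y < e \<longrightarrow> y \<in> S"
    using r F_le_induced_length_metric[of s x] by (intro exI[of _ "ennreal r"]) (auto intro: le_less_trans)
next
  fix S :: "'a set" assume *: "\<forall>x\<in>S. \<exists>e>0. \<forall>y. induced_length_metric (F s) x y < e \<longrightarrow> y \<in> S"
  show "open S"
  proof (subst open_subopen, rule ballI)
    fix x assume x: "x \<in> S"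
    then obtain e where e: "e > 0" "\<And>y. induced_length_metric (F s) x y < e \<Longrightarrow> y \<in> S" using * by blast
    obtain e' where e': "e' > 0" "ennreal e' + ennreal e' \<le> e" by (rule ennreal_halve[OF e(1)])
    obtain c where c: "c \<in> A" "x \<in> fst c" by (rule chart_at)
    obtain W where W: "open W" "x \<in> W" "W \<subseteq> fst c" "convex (snd c ` W)"
      "\<And>x' y. x' \<in> W \<Longrightarrow> y \<in> W \<Longrightarrow> F s x' y \<le> ennreal (2 * N s c x (snd c y - snd c x')) \<and>
       ennreal (N s c x (snd c y - snd c x') / 2) \<le> F s x' y"
      by (rule dist_le_displacement[OF s c]) blast
    have B: "inner_form (chart_form (g s) c x)" by (rule chart_form_family[OF s c])
    let ?V = "{z. 2 * N s c x (z - snd c x) < e'}"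
    have "continuous_on UNIV (\<lambda>z. N s c x (z - snd c x))"
      by (rule continuous_on_compose2[OF form_norm_continuous[OF B, of UNIV]]) (auto intro!: continuous_intros)
    then have "open ?V" by (intro open_Collect_less continuous_intros) auto
    then have "open {q \<in> fst c. snd c q \<in> ?V}" by (rule open_chart_preimage[OF c(1)])
    then have op: "open (W \<inter> {q \<in> fst c. snd c q \<in> ?V})" using W(1) by blast
    have "y \<in> S" if y: "y \<in> W \<inter> {q \<in> fst c. snd c q \<in> ?V}" for y
    proof (rule e(2))
      have "induced_length_metric (F s) x y \<le> ennreal (2 * N s c x (snd c y - snd c x))"
        by (rule induced_length_metric_le_displacement[OF s c W(3,4)]) (use W y in auto)
      also have "\<dots> < ennreal e'" using y e'(1) by (intro ennreal_lessI) auto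
      also have "\<dots> \<le> ennreal e' + ennreal e'" by simp
      also have "\<dots> \<le> e" by (rule e')
      finally show "induced_length_metric (F s) x y < e" .
    qed
    then show "\<exists>T. open T \<and> x \<in> T \<and> T \<subseteq> S"
      using op W(2) c e'(1) by (intro exI[of _ "W \<inter> {q \<in> fst c. snd c q \<in> ?V}"]) (auto simp: form_norm_0[OF B])
  qed
qed

end



section \<open>Uniform comparison over compact sets\<close>

text \<open>A property of sets that passes to subsets and finite unions holds for a compact set if it holds
  locally; the form of compactness used below on \<open>J \<times> K\<close>.\<close>

lemma compact_union_induct:
  fixes C :: "'a::topological_space set"
  assumes "compact C" and empty: "P {}" and mono: "\<And>U V. P U \<Longrightarrow> V \<subseteq> U \<Longrightarrow> P V"
    and union: "\<And>U V. P U \<Longrightarrow> P V \<Longrightarrow> P (U \<union> V)"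
    and local: "\<And>z. z \<in> C \<Longrightarrow> \<exists>U. open U \<and> z \<in> U \<and> P U"
  shows "P C"
proof -
  let ?\<C> = "{U. open U \<and> P U}"
  have "C \<subseteq> \<Union>?\<C>" using local by blast
  then obtain D where D: "D \<subseteq> ?\<C>" "finite D" "C \<subseteq> \<Union>D"
    by (rule compactE[OF \<open>compact C\<close>]) auto
  from D(2,1) have "P (\<Union>D)"
    by (induction D) (auto intro: empty union)
  then show ?thesis using D(3) by (rule mono)
qed

context riemannian_family
begin

abbreviation "vnorm s p V \<equiv> sqrt (g s p V V)"

lemma vnorm_chart:
  assumes "c \<in> A" "p \<in> fst c" "V \<in> tangent_space A p"
  shows "vnorm s p V = N s c p (V c)"
  by (simp add: form_norm_def chart_form_tangent[OF assms])

lemma vnorm_nonneg: "s \<in> I \<Longrightarrow> V \<in> tangent_space A p \<Longrightarrow> vnorm s p V \<ge> 0"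
  by (rule chart_at[of p]) (simp add: vnorm_chart form_norm_nonneg[OF chart_form_family])

definition vnorm_close :: "real \<Rightarrow> real \<Rightarrow> real \<Rightarrow> 'a \<Rightarrow> bool" where
  "vnorm_close \<epsilon> s s' p \<longleftrightarrow> (\<forall>V\<in>tangent_space A p.
     vnorm s p V \<le> (1 + \<epsilon>) * vnorm s' p V \<and> vnorm s' p V \<le> (1 + \<epsilon>) * vnorm s p V)"

lemma vnorm_uniformly_continuous:
  assumes J: "compact J" "J \<subseteq> I" and K: "compact K" and "\<epsilon> > 0"
  shows "\<exists>\<eta>>0. \<forall>s\<in>J. \<forall>s'\<in>I. \<bar>s - s'\<bar> < \<eta> \<longrightarrow> (\<forall>p\<in>K. vnorm_close \<epsilon> s s' p)"
proof -
  define P where "P U \<longleftrightarrow> (\<exists>\<eta>>0. \<forall>(s, p)\<in>U. s \<in> I \<longrightarrow> (\<forall>s'\<in>I. \<bar>s - s'\<bar> < \<eta> \<longrightarrow> vnorm_close \<epsilon> s s' p))" for U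
  have "P (J \<times> K)"
  proof (rule compact_union_induct[OF compact_Times[OF J(1) K]])
    show "P {}" unfolding P_def by (intro exI[of _ 1]) auto
    show "P V" if "P U" "V \<subseteq> U" for U V using that unfolding P_def by (meson subsetD)
    show "P (U \<union> V)" if UV: "P U" "P V" for U V
    proof -
      obtain \<eta>1 where 1: "\<eta>1 > 0" "\<forall>(s, p)\<in>U. s \<in> I \<longrightarrow> (\<forall>s'\<in>I. \<bar>s - s'\<bar> < \<eta>1 \<longrightarrow> vnorm_close \<epsilon> s s' p)"
        using UV(1) unfolding P_def by blast
      obtain \<eta>2 where 2: "\<eta>2 > 0" "\<forall>(s, p)\<in>V. s \<in> I \<longrightarrow> (\<forall>s'\<in>I. \<bar>s - s'\<bar> < \<eta>2 \<longrightarrow> vnorm_close \<epsilon> s s' p)"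
        using UV(2) unfolding P_def by blast
      show ?thesis unfolding P_def
      proof (rule exI[of _ "min \<eta>1 \<eta>2"], intro conjI)
        show "\<forall>(s, p)\<in>U \<union> V. s \<in> I \<longrightarrow> (\<forall>s'\<in>I. \<bar>s - s'\<bar> < min \<eta>1 \<eta>2 \<longrightarrow> vnorm_close \<epsilon> s s' p)"
          unfolding ball_Un min_less_iff_conj using 1(2) 2(2) by blast
      qed (use 1 2 in simp)
    qed
    fix z assume "z \<in> J \<times> K"
    then obtain s0 p0 where z: "z = (s0, p0)" "s0 \<in> I" using J by auto
    obtain c where c: "c \<in> A" "p0 \<in> fst c" by (rule chart_at)
    \<comment> \<open>Both parameters are compared with \<open>s0\<close>, and \<open>e\<close> solves \<open>(1 + e) / (1 - e) = 1 + \<epsilon>\<close>.\<close>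
    define e where "e = \<epsilon> / (2 + \<epsilon>)"
    have e: "0 < e" "e < 1" "1 + e = (1 + \<epsilon>) * (1 - e)" using \<open>\<epsilon> > 0\<close> by (auto simp: e_def field_simps)
    obtain \<delta> W where \<delta>: "\<delta> > 0" and W: "open W" "p0 \<in> W" "W \<subseteq> fst c" and
      near: "\<forall>s\<in>I. \<bar>s - s0\<bar> < \<delta> \<longrightarrow> (\<forall>p\<in>W. \<forall>v. (1 - e) * N s0 c p0 v \<le> N s c p v \<and> N s c p v \<le> (1 + e) * N s0 c p0 v)"
      using chart_norm_near[OF z(2) c e(1)] by (elim exE conjE)
    have le: "vnorm s p V \<le> (1 + \<epsilon>) * vnorm s' p V"
      if "s \<in> I" "s' \<in> I" "\<bar>s - s0\<bar> < \<delta>" "\<bar>s' - s0\<bar> < \<delta>" "p \<in> W" "V \<in> tangent_space A p" for s s' p V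
    proof -
      have pc: "p \<in> fst c" using that W by auto
      have "vnorm s p V \<le> (1 + e) * N s0 c p0 (V c)"
        unfolding vnorm_chart[OF c(1) pc that(6)] using near that by blast
      also have "\<dots> = (1 + \<epsilon>) * ((1 - e) * N s0 c p0 (V c))" using e(3) by simp
      also have "\<dots> \<le> (1 + \<epsilon>) * vnorm s' p V"
      proof (rule mult_left_mono)
        show "(1 - e) * N s0 c p0 (V c) \<le> vnorm s' p V"
          unfolding vnorm_chart[OF c(1) pc that(6)] using near that by blast
      qed (use \<open>\<epsilon> > 0\<close> in simp)
      finally show ?thesis .
    qed
    have "P (ball s0 (\<delta> / 2) \<times> W)" unfolding P_def
    proof (rule exI[of _ "\<delta> / 2"], intro conjI ballI, simp add: \<delta>, clarify)
      fix s p s' assume *: "s \<in> ball s0 (\<delta> / 2)" "p \<in> W" "s \<in> I" "s' \<in> I" "\<bar>s - s'\<bar> < \<delta> / 2"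
      then have "\<bar>s - s0\<bar> < \<delta>" "\<bar>s' - s0\<bar> < \<delta>" using \<delta> unfolding mem_ball dist_real_def by linarith+
      then show "vnorm_close \<epsilon> s s' p"
        using le * unfolding vnorm_close_def by blast
    qed
    then show "\<exists>U. open U \<and> z \<in> U \<and> P U"
      using \<delta> W z by (intro exI[of _ "ball s0 (\<delta> / 2) \<times> W"]) (auto intro: open_Times)
  qed
  then obtain \<eta> where \<eta>: "\<eta> > 0" "\<forall>(s, p)\<in>J \<times> K. s \<in> I \<longrightarrow> (\<forall>s'\<in>I. \<bar>s - s'\<bar> < \<eta> \<longrightarrow> vnorm_close \<epsilon> s s' p)"
    unfolding P_def by blast
  show ?thesis
    by (rule exI[of _ \<eta>]) (use \<eta> J in \<open>simp add: subset_iff\<close>)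
qed

text \<open>Chain the comparison of nearby parameters along the interval; the constants multiply.\<close>

lemma vnorm_uniformly_equivalent:
  assumes ab: "a \<le> b" "{a..b} \<subseteq> I" and K: "compact K"
  shows "\<exists>C\<ge>1. \<forall>s\<in>{a..b}. \<forall>s'\<in>{a..b}. \<forall>p\<in>K. \<forall>V\<in>tangent_space A p. vnorm s p V \<le> C * vnorm s' p V"
proof -
  obtain \<eta> where \<eta>: "\<eta> > 0" "\<forall>s\<in>{a..b}. \<forall>s'\<in>I. \<bar>s - s'\<bar> < \<eta> \<longrightarrow> (\<forall>p\<in>K. vnorm_close 1 s s' p)"
    using vnorm_uniformly_continuous[OF compact_Icc ab(2) K zero_less_one] by (elim exE conjE)
  define Q where "Q u v C \<longleftrightarrow> (\<forall>s\<in>{u..v}. \<forall>s'\<in>{u..v}. \<forall>p\<in>K. \<forall>V\<in>tangent_space A p. vnorm s p V \<le> C * vnorm s' p V)" for u v C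
  define P where "P u v \<longleftrightarrow> (a \<le> u \<and> u \<le> v \<and> v \<le> b \<longrightarrow> (\<exists>C\<ge>1. Q u v C))" for u v
  have "P a b" using ab(1)
  proof (induction rule: Bolzano)
    case (trans u v w)
    show ?case unfolding P_def
    proof
      assume uw: "a \<le> u \<and> u \<le> w \<and> w \<le> b"
      obtain C1 where C1: "C1 \<ge> 1" "Q u v C1" using trans uw by (auto simp: P_def)
      obtain C2 where C2: "C2 \<ge> 1" "Q v w C2" using trans uw by (auto simp: P_def)
      have v: "v \<in> I" "v \<in> {u..v}" "v \<in> {v..w}" using trans uw ab(2) by auto
      have "Q u w (C1 * C2)" unfolding Q_def
      proof (intro ballI)
        fix s s' p V assume *: "s \<in> {u..w}" "s' \<in> {u..w}" "p \<in> K" "V \<in> tangent_space A p"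
        have sI: "s \<in> I" "s' \<in> I" using * uw ab(2) by auto
        have n0: "0 \<le> vnorm s' p V" "0 \<le> vnorm v p V" using vnorm_nonneg[OF _ *(4)] sI v by auto
        have mono: "C * vnorm s' p V \<le> C1 * C2 * vnorm s' p V" if "C \<le> C1 * C2" for C
          using that n0 by (intro mult_right_mono) auto
        have C12: "C1 \<le> C1 * C2" "C2 \<le> C1 * C2" using C1(1) C2(1) by auto
        consider "s \<le> v" "s' \<le> v" | "v \<le> s" "v \<le> s'" | "s \<le> v" "v \<le> s'" | "v \<le> s" "s' \<le> v" by linarith
        then show "vnorm s p V \<le> C1 * C2 * vnorm s' p V"
        proof cases
          case 1
          then have "vnorm s p V \<le> C1 * vnorm s' p V" using C1(2) * unfolding Q_def by auto
          then show ?thesis using mono[OF C12(1)] by linarith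
        next
          case 2
          then have "vnorm s p V \<le> C2 * vnorm s' p V" using C2(2) * unfolding Q_def by auto
          then show ?thesis using mono[OF C12(2)] by linarith
        next
          case 3
          have "vnorm s p V \<le> C1 * vnorm v p V" using C1(2) * 3 v unfolding Q_def by auto
          also have "\<dots> \<le> C1 * (C2 * vnorm s' p V)"
            using C2(2) * 3 v C1(1) unfolding Q_def by (intro mult_left_mono) auto
          finally show ?thesis by (simp add: mult.assoc)
        next
          case 4
          have "vnorm s p V \<le> C2 * vnorm v p V" using C2(2) * 4 v unfolding Q_def by auto
          also have "\<dots> \<le> C2 * (C1 * vnorm s' p V)"
            using C1(2) * 4 v C2(1) unfolding Q_def by (intro mult_left_mono) auto
          finally show ?thesis by (simp add: mult_ac)
        qed
      qed
      moreover have "C1 * C2 \<ge> 1" using C1(1) C2(1) mult_mono[of 1 C1 1 C2] by simp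
      ultimately show "\<exists>C\<ge>1. Q u w C" by blast
    qed
  next
    case (local x)
    have "P u v" if "v - u < \<eta>" for u v
      unfolding P_def
    proof
      assume uv: "a \<le> u \<and> u \<le> v \<and> v \<le> b"
      have "Q u v (1 + 1)" unfolding Q_def
      proof (intro ballI)
        fix s s' p V assume *: "s \<in> {u..v}" "s' \<in> {u..v}" "p \<in> K" "V \<in> tangent_space A p"
        then have "s \<in> {a..b}" "s' \<in> I" "\<bar>s - s'\<bar> < \<eta>" using uv that ab(2) by auto
        then show "vnorm s p V \<le> (1 + 1) * vnorm s' p V"
          using \<eta>(2) *(3,4) unfolding vnorm_close_def by blast
      qed
      then show "\<exists>C\<ge>1. Q u v C" by (intro exI[of _ "1 + 1"]) simp
    qed
    then show ?case using \<eta>(1) by (intro exI[of _ \<eta>]) simp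
  qed
  then show ?thesis using ab by (simp add: P_def Q_def)
qed

lemma trapped_uniformly:
  assumes J: "compact J" "J \<subseteq> I" and K: "compact K"
  shows "\<exists>r>0. \<exists>K'. compact K' \<and> (\<forall>s\<in>J. trapped s K K' r)"
proof -
  define P where "P U \<longleftrightarrow> (\<exists>r>0. \<exists>K'. compact K' \<and> (\<forall>(s, p)\<in>U. s \<in> I \<longrightarrow> trapped s {p} K' r))" for U
  have "P (J \<times> K)"
  proof (rule compact_union_induct[OF compact_Times[OF J(1) K]])
    show "P {}" unfolding P_def by (intro exI[of _ 1] conjI exI[of _ "{}"]) auto
    show "P V" if "P U" "V \<subseteq> U" for U V using that unfolding P_def by (meson subsetD)
    show "P (U \<union> V)" if UV: "P U" "P V" for U V
    proof -
      obtain r1 K1 where 1: "r1 > 0" "compact K1" "\<forall>(s, p)\<in>U. s \<in> I \<longrightarrow> trapped s {p} K1 r1"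
        using UV(1) unfolding P_def by blast
      obtain r2 K2 where 2: "r2 > 0" "compact K2" "\<forall>(s, p)\<in>V. s \<in> I \<longrightarrow> trapped s {p} K2 r2"
        using UV(2) unfolding P_def by blast
      have "trapped s {p} (K1 \<union> K2) (min r1 r2)" if "(s, p) \<in> U \<union> V" "s \<in> I" for s p
        using that(1)
      proof
        assume "(s, p) \<in> U"
        then have "trapped s {p} K1 r1" using 1(3) that(2) by blast
        then show ?thesis by (rule trapped_mono) auto
      next
        assume "(s, p) \<in> V"
        then have "trapped s {p} K2 r2" using 2(3) that(2) by blast
        then show ?thesis by (rule trapped_mono) auto
      qed
      then show ?thesis unfolding P_def
        using 1 2 by (intro exI[of _ "min r1 r2"] conjI exI[of _ "K1 \<union> K2"]) auto
    qed
    fix z assume "z \<in> J \<times> K"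
    then obtain s0 p0 where z: "z = (s0, p0)" "s0 \<in> I" using J by auto
    obtain c where c: "c \<in> A" "p0 \<in> fst c" by (rule chart_at)
    obtain \<delta> r W K' where *: "\<delta> > 0" "r > 0" "open W" "p0 \<in> W" "W \<subseteq> K'" "K' \<subseteq> UNIV \<inter> fst c" "compact K'" "convex (snd c ` W)"
      and near: "\<forall>s\<in>I. \<bar>s - s0\<bar> < \<delta> \<longrightarrow> trapped s W K' r \<and> (\<forall>x\<in>W. \<forall>y\<in>W.
         ennreal ((1 - 1/2) * N s0 c p0 (snd c y - snd c x)) \<le> F s x y \<and>
         F s x y \<le> ennreal ((1 + 1/2) * N s0 c p0 (snd c y - snd c x)))"
      using local_comparison[OF z(2) c(1) open_UNIV UNIV_I c(2) half_in_unit_interval]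
      by (elim exE conjE)
    have "trapped s {p} K' r" if sp: "s \<in> ball s0 \<delta>" "p \<in> W" "s \<in> I" for s p
    proof -
      have "\<bar>s - s0\<bar> < \<delta>" using sp(1) by (simp add: dist_real_def abs_minus_commute)
      then have "trapped s W K' r" using near sp(3) by blast
      then show ?thesis by (rule trapped_mono) (use sp in auto)
    qed
    then have "P (ball s0 \<delta> \<times> W)" unfolding P_def using *(2,7) by blast
    then show "\<exists>U. open U \<and> z \<in> U \<and> P U"
      using * z by (intro exI[of _ "ball s0 \<delta> \<times> W"]) (auto intro: open_Times)
  qed
  then obtain r K' where r: "r > 0" "compact K'" "\<forall>(s, p)\<in>J \<times> K. s \<in> I \<longrightarrow> trapped s {p} K' r"
    unfolding P_def by blast
  have "trapped s K K' r" if "s \<in> J" for s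
    using r(3) that J(2) unfolding trapped_def by blast
  then show ?thesis using r(1,2) by blast
qed

lemma riemannian_length_compare:
  assumes s: "s \<in> I" "s' \<in> I" and \<beta>: "piecewise_C1_curve A \<beta>" and C: "C \<ge> 0"
    and le: "\<And>t V. t \<in> {0..1} \<Longrightarrow> V \<in> tangent_space A (\<beta> t) \<Longrightarrow> vnorm s (\<beta> t) V \<le> C * vnorm s' (\<beta> t) V"
  shows "riemannian_length A (g s) \<beta> \<le> ennreal C * riemannian_length A (g s') \<beta>"
proof -
  obtain S where P: "C1_pieces S 0 1 \<beta>" using \<beta> by (auto simp: piecewise_C1_iff_pieces)
  have S: "finite S" using P by (auto simp: C1_pieces_def)
  have "riemannian_length A (g s) \<beta> = (\<integral>\<^sup>+t. ennreal (speed (g s) \<beta> t) * indicator ({0<..<1} - S) t \<partial>lborel)"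
    unfolding riemannian_length_partial by (rule partial_length_interior[OF S])
  also have "\<dots> \<le> (\<integral>\<^sup>+t. ennreal C * (ennreal (speed (g s') \<beta> t) * indicator ({0<..<1} - S) t) \<partial>lborel)"
  proof (rule nn_integral_mono)
    fix t :: real
    show "ennreal (speed (g s) \<beta> t) * indicator ({0<..<1} - S) t \<le> ennreal C * (ennreal (speed (g s') \<beta> t) * indicator ({0<..<1} - S) t)"
    proof (cases "t \<in> {0<..<1} - S")
      case True
      obtain c where c: "c \<in> A" "\<beta> t \<in> fst c" by (rule chart_at)
      have "velocity A \<beta> t = coord_vector A (\<beta> t) c (vector_derivative (snd c \<circ> \<beta>) (at t))"
        by (rule velocity_eq_coord_vector[OF c C1_pieces_isCont[OF P] C1_pieces_derivative[OF P True c]]) (use True in auto)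
      then have "velocity A \<beta> t \<in> tangent_space A (\<beta> t)" using coord_vector_in_tangent_space[OF c] by simp
      then have "speed (g s) \<beta> t \<le> C * speed (g s') \<beta> t" using le[of t] True by (simp add: speed_def)
      then have "ennreal (speed (g s) \<beta> t) \<le> ennreal C * ennreal (speed (g s') \<beta> t)"
        using C by (simp add: ennreal_leI flip: ennreal_mult')
      then show ?thesis using True by simp
    qed simp
  qed
  also have "\<dots> = ennreal C * (\<integral>\<^sup>+t. ennreal (speed (g s') \<beta> t) * indicator ({0<..<1} - S) t \<partial>lborel)"
    by (rule nn_integral_cmult) (use speed_measurable[OF riemannian[OF s(2)] P] in simp)
  also have "\<dots> = ennreal C * riemannian_length A (g s') \<beta>"
    unfolding riemannian_length_partial partial_length_interior[OF S] ..
  finally show ?thesis .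
qed

text \<open>The smallness is required for some parameter \<open>\<sigma>\<close> unrelated to \<open>s\<close> and \<open>s'\<close>, as the infimum of the
  distances over the family is small if and only if one of them is.\<close>

definition comparable :: "real set \<Rightarrow> 'a set \<Rightarrow> real \<Rightarrow> real \<Rightarrow> real \<Rightarrow> bool" where
  "comparable T K r \<kappa> \<eta> \<longleftrightarrow> (\<forall>\<sigma>\<in>T. \<forall>s\<in>T. \<forall>s'\<in>T. \<forall>x\<in>K. \<forall>y. F \<sigma> x y < ennreal r \<longrightarrow> \<bar>s - s'\<bar> < \<eta> \<longrightarrow>
     F s x y < \<infinity> \<and> enn2real (F s x y) \<le> \<kappa> * enn2real (F s' x y))"

text \<open>If one distance of the family is small then all are, and they are computed by curves in a compact
  set, on which the norms of nearby parameters are uniformly close; so the distances are.\<close>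

lemma distances_uniformly_comparable:
  assumes ab: "a \<le> b" "{a..b} \<subseteq> I" and K: "compact K"
  shows "\<exists>r>0. \<exists>C\<ge>1. (\<forall>\<eta>. comparable {a..b} K r C \<eta>) \<and>
    (\<forall>\<epsilon>>0. \<exists>\<eta>>0. comparable {a..b} K r (1 + \<epsilon>) \<eta>)"
proof -
  obtain r0 K' where r0: "r0 > 0" and K': "compact K'" and trap: "\<forall>s\<in>{a..b}. trapped s K K' r0"
    using trapped_uniformly[OF compact_Icc ab(2) K] by (elim exE conjE)
  obtain C where C: "C \<ge> 1" "\<forall>s\<in>{a..b}. \<forall>s'\<in>{a..b}. \<forall>p\<in>K'. \<forall>V\<in>tangent_space A p. vnorm s p V \<le> C * vnorm s' p V"
    using vnorm_uniformly_equivalent[OF ab K'] by (elim exE conjE)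
  \<comment> \<open>A curve of length less than \<open>r\<close> for one parameter has length less than \<open>r0\<close> for all of them.\<close>
  define r where "r = r0 / C"
  have r: "r > 0" "r \<le> r0" using r0 C(1) by (auto simp: r_def divide_le_eq)
  have cmp: "F s x y \<le> ennreal \<kappa> * riemannian_length A (g s') \<beta>"
    if "s \<in> {a..b}" "s' \<in> {a..b}" "x \<in> K" "\<kappa> \<ge> 0" and \<beta>: "piecewise_C1_curve A \<beta>" "\<beta> 0 = x" "\<beta> 1 = y"
      "riemannian_length A (g s') \<beta> < ennreal r0"
      and \<kappa>: "\<And>p V. p \<in> K' \<Longrightarrow> V \<in> tangent_space A p \<Longrightarrow> vnorm s p V \<le> \<kappa> * vnorm s' p V" for s s' x y \<kappa> \<beta>
  proof -
    have inK: "\<forall>t\<in>{0..1}. \<beta> t \<in> K'"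
      using trap that(2,3) \<beta> by (intro ballI trappedD[of s' K K' r0]) auto
    have "F s x y \<le> riemannian_length A (g s) \<beta>"
      unfolding riemannian_dist_def using \<beta> by (intro INF_lower) auto
    also have "\<dots> \<le> ennreal \<kappa> * riemannian_length A (g s') \<beta>"
      using that ab(2) inK by (intro riemannian_length_compare \<kappa>) auto
    finally show ?thesis .
  qed
  have small: "F s x y < ennreal r0" if "\<sigma> \<in> {a..b}" "s \<in> {a..b}" "x \<in> K" "F \<sigma> x y < ennreal r" for \<sigma> s x y
  proof -
    from that(4) obtain \<beta> where \<beta>: "piecewise_C1_curve A \<beta>" "\<beta> 0 = x" "\<beta> 1 = y" "riemannian_length A (g \<sigma>) \<beta> < ennreal r"
      unfolding riemannian_dist_def by (auto simp: INF_less_iff)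
    then have lt: "riemannian_length A (g \<sigma>) \<beta> < ennreal r0" using r(2) by (meson ennreal_leI less_le_trans)
    have "F s x y \<le> ennreal C * riemannian_length A (g \<sigma>) \<beta>"
      by (rule cmp[OF that(2,1,3) _ \<beta>(1-3) lt]) (use C that in auto)
    also have "\<dots> < ennreal C * ennreal r"
      using \<beta>(4) C(1) by (intro ennreal_mult_strict_left_mono) auto
    also have "\<dots> = ennreal r0" using C(1) r0 r by (simp add: r_def flip: ennreal_mult)
    finally show ?thesis .
  qed
  have real: "enn2real (F s x y) \<le> \<kappa> * enn2real (F s' x y)"
    if st: "\<sigma> \<in> {a..b}" "s \<in> {a..b}" "s' \<in> {a..b}" "x \<in> K" "F \<sigma> x y < ennreal r" "\<kappa> \<ge> 1"
      and \<kappa>: "\<And>p V. p \<in> K' \<Longrightarrow> V \<in> tangent_space A p \<Longrightarrow> vnorm s p V \<le> \<kappa> * vnorm s' p V" for \<sigma> s s' x y \<kappa>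
  proof (rule ccontr)
    assume n: "\<not> enn2real (F s x y) \<le> \<kappa> * enn2real (F s' x y)"
    obtain f where f: "F s x y = ennreal f" "f \<ge> 0" "f < r0"
      using small[OF st(1,2,4,5)] by (cases "F s x y") (auto simp: ennreal_less_iff)
    obtain f' where f': "F s' x y = ennreal f'" "f' \<ge> 0" "f' < r0"
      using small[OF st(1,3,4,5)] by (cases "F s' x y") (auto simp: ennreal_less_iff)
    have gt: "\<kappa> * f' < f" using n f f' by simp
    have "F s' x y < ennreal (min (f / \<kappa>) r0)"
      using gt f' that(6) by (simp add: f' ennreal_less_iff field_simps)
    then obtain \<beta> where \<beta>: "piecewise_C1_curve A \<beta>" "\<beta> 0 = x" "\<beta> 1 = y" "riemannian_length A (g s') \<beta> < ennreal (min (f / \<kappa>) r0)"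
      unfolding riemannian_dist_def by (auto simp: INF_less_iff)
    then obtain l where l: "riemannian_length A (g s') \<beta> = ennreal l" "l \<ge> 0"
      by (cases "riemannian_length A (g s') \<beta>") auto
    have ll: "l < f / \<kappa>" "l < r0" using \<beta>(4) l by (auto simp: ennreal_less_iff)
    have "F s x y \<le> ennreal \<kappa> * riemannian_length A (g s') \<beta>"
      by (rule cmp[OF st(2,3,4) _ \<beta>(1-3)]) (use l ll st \<kappa> in \<open>auto simp: ennreal_less_iff\<close>)
    then have "f \<le> \<kappa> * l" using f l st(6) by (simp flip: ennreal_mult)
    then show False using ll(1) st(6) by (simp add: field_simps)
  qed
  have fin: "F s x y < \<infinity>" if "\<sigma> \<in> {a..b}" "s \<in> {a..b}" "x \<in> K" "F \<sigma> x y < ennreal r" for \<sigma> s x y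
    using small[OF that] by (auto intro: less_trans)
  show ?thesis
  proof (rule exI[of _ r], intro conjI r(1), rule exI[of _ C], intro conjI C(1) allI impI)
    show "comparable {a..b} K r C \<eta>" for \<eta>
      unfolding comparable_def
    proof (intro ballI allI impI conjI)
      fix \<sigma> s s' x y
      assume *: "\<sigma> \<in> {a..b}" "s \<in> {a..b}" "s' \<in> {a..b}" "x \<in> K" "F \<sigma> x y < ennreal r"
      show "F s x y < \<infinity>" by (rule fin[OF *(1,2,4,5)])
      show "enn2real (F s x y) \<le> C * enn2real (F s' x y)"
        by (rule real[OF * C(1)]) (use C(2) * in blast)
    qed
    fix \<epsilon> :: real assume "\<epsilon> > 0"
    obtain \<eta> where \<eta>: "\<eta> > 0" "\<forall>s\<in>{a..b}. \<forall>s'\<in>I. \<bar>s - s'\<bar> < \<eta> \<longrightarrow> (\<forall>p\<in>K'. vnorm_close \<epsilon> s s' p)"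
      using vnorm_uniformly_continuous[OF compact_Icc ab(2) K' \<open>\<epsilon> > 0\<close>] by (elim exE conjE)
    have "comparable {a..b} K r (1 + \<epsilon>) \<eta>"
      unfolding comparable_def
    proof (intro ballI allI impI conjI)
      fix \<sigma> s s' x y
      assume *: "\<sigma> \<in> {a..b}" "s \<in> {a..b}" "s' \<in> {a..b}" "x \<in> K" "F \<sigma> x y < ennreal r" "\<bar>s - s'\<bar> < \<eta>"
      show "F s x y < \<infinity>" by (rule fin[OF *(1,2,4,5)])
      show "enn2real (F s x y) \<le> (1 + \<epsilon>) * enn2real (F s' x y)"
        by (rule real[OF *(1-5)]) (use \<eta>(2) * ab(2) \<open>\<epsilon> > 0\<close> in \<open>auto simp: vnorm_close_def\<close>)
    qed
    then show "\<exists>\<eta>>0. comparable {a..b} K r (1 + \<epsilon>) \<eta>" using \<eta>(1) by blast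
  qed
qed

lemma abs_ln_quotient_le:
  fixes f f' \<kappa> :: real
  assumes "f > 0" "f' > 0" "f \<le> \<kappa> * f'" "f' \<le> \<kappa> * f"
  shows "\<bar>ln (f / f')\<bar> \<le> ln \<kappa>"
proof -
  have \<kappa>: "\<kappa> > 0" using assms by (metis less_le_trans mult_pos_pos not_less zero_less_mult_pos2)
  have "ln f \<le> ln (\<kappa> * f')" "ln f' \<le> ln (\<kappa> * f)" using assms \<kappa> by simp_all
  then show ?thesis using assms \<kappa> by (simp add: ln_mult ln_div abs_le_iff)
qed

text \<open>The modulus of continuity is the supremum of the logarithms that it has to bound. It is finite
  because all distances are comparable up to the constant \<open>C\<close>, and small near 0 because distances of
  nearby parameters are comparable up to \<open>1 + \<epsilon>\<close>.\<close>

lemma distances_modulus: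
  assumes J: "compact J" "J \<subseteq> I" and K: "compact K"
  shows "\<exists>r>0::real. \<exists>\<omega>. modulus_of_continuity \<omega> \<and>
     (\<forall>s\<in>J. \<forall>s'\<in>J. \<forall>x\<in>K. \<forall>y\<in>K. x \<noteq> y \<and> (INF \<sigma>\<in>J. F \<sigma> x y) < ennreal r \<longrightarrow>
        F s x y < \<infinity> \<and> F s' x y < \<infinity> \<and>
        \<bar>ln (enn2real (F s x y) / enn2real (F s' x y))\<bar> \<le> \<omega> \<bar>s - s'\<bar>)"
proof (cases "J = {}")
  case True
  then show ?thesis by (intro exI[of _ 1] conjI exI[of _ "\<lambda>_. 0"]) (auto simp: modulus_of_continuity_def mono_on_def)
next
  case False
  obtain a b where ab: "a \<in> J" "b \<in> J" "\<And>s. s \<in> J \<Longrightarrow> a \<le> s \<and> s \<le> b"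
    using compact_attains_inf[OF J(1) False] compact_attains_sup[OF J(1) False] by blast
  have abI: "a \<le> b" "{a..b} \<subseteq> I" "J \<subseteq> {a..b}"
  proof -
    show "a \<le> b" "J \<subseteq> {a..b}" using ab by auto
    have "a \<in> I" "b \<in> I" using ab J(2) by auto
    then show "{a..b} \<subseteq> I" using mem_is_interval_1_I[OF interval_I, of a b] by auto
  qed
  obtain r C where r: "r > 0" and C: "C \<ge> 1" and cC: "\<forall>\<eta>. comparable {a..b} K r C \<eta>"
    and c\<epsilon>: "\<forall>\<epsilon>>0. \<exists>\<eta>>0. comparable {a..b} K r (1 + \<epsilon>) \<eta>"
    using distances_uniformly_comparable[OF abI(1,2) K] by (elim exE conjE)
  have FC: "F s x y < \<infinity>" "enn2real (F s x y) \<le> C * enn2real (F s' x y)"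
    if "\<sigma> \<in> {a..b}" "s \<in> {a..b}" "s' \<in> {a..b}" "x \<in> K" "F \<sigma> x y < ennreal r" for \<sigma> s s' x y
    \<comment> \<open>Any bound that exceeds \<open>\<bar>s - s'\<bar>\<close> will do.\<close>
    using cC[rule_format, of "\<bar>s - s'\<bar> + 1"] that unfolding comparable_def by auto
  define Q where "Q s s' x y \<longleftrightarrow> s \<in> J \<and> s' \<in> J \<and> x \<in> K \<and> x \<noteq> y \<and> (\<exists>\<sigma>\<in>J. F \<sigma> x y < ennreal r)" for s s' x y
  define q where "q s s' x y = \<bar>ln (enn2real (F s x y) / enn2real (F s' x y))\<bar>" for s s' x y
  have pos: "enn2real (F s x y) > 0" if QQ: "Q s s' x y" for s s' x y
  proof -
    have "s \<in> I" "x \<noteq> y" using QQ J by (auto simp: Q_def)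
    then have "F s x y \<noteq> 0" using extended_metric_F[of s] by (auto simp: extended_metric_def)
    moreover obtain \<sigma> where "\<sigma> \<in> J" "F \<sigma> x y < ennreal r" using QQ by (auto simp: Q_def)
    then have "F s x y < \<infinity>" using QQ abI(3) unfolding Q_def by (intro FC(1)[of \<sigma> s s]) auto
    ultimately show ?thesis by (auto simp: enn2real_positive_iff zero_less_iff_neq_zero)
  qed
  have Qsym: "Q s' s x y" if "Q s s' x y" for s s' x y using that by (auto simp: Q_def)
  have qC: "q s s' x y \<le> ln C" if QQ: "Q s s' x y" for s s' x y
  proof -
    obtain \<sigma> where "\<sigma> \<in> J" "F \<sigma> x y < ennreal r" using QQ by (auto simp: Q_def)
    then show ?thesis unfolding q_def using QQ abI(3)
      by (intro abs_ln_quotient_le pos[OF QQ] pos[OF Qsym[OF QQ]] FC(2)[of \<sigma>]) (auto simp: Q_def)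
  qed
  define T where "T \<delta> = insert 0 {q s s' x y |s s' x y. Q s s' x y \<and> \<bar>s - s'\<bar> \<le> \<delta>}" for \<delta>
  define \<omega> where "\<omega> \<delta> = Sup (T \<delta>)" for \<delta>
  have bdd: "bdd_above (T \<delta>)" for \<delta>
    by (rule bdd_aboveI[of _ "ln C"]) (use qC C in \<open>auto simp: T_def\<close>)
  have T0: "0 \<in> T \<delta>" for \<delta> by (simp add: T_def)
  have \<omega>0: "\<omega> \<delta> \<ge> 0" for \<delta> unfolding \<omega>_def by (rule cSup_upper[OF T0 bdd])
  have modulus: "modulus_of_continuity \<omega>"
    unfolding modulus_of_continuity_def
  proof (intro conjI)
    have "T 0 = {0}" using pos by (fastforce simp: T_def q_def)
    then show "\<omega> 0 = 0" by (simp add: \<omega>_def)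
    show "mono_on {0..} \<omega>"
    proof (rule mono_onI)
      fix \<delta> \<delta>' :: real assume "\<delta> \<le> \<delta>'"
      then have "T \<delta> \<subseteq> T \<delta>'" unfolding T_def by (intro insert_mono) (blast intro: order_trans)
      then show "\<omega> \<delta> \<le> \<omega> \<delta>'" unfolding \<omega>_def using T0 bdd by (intro cSup_subset_mono) auto
    qed
    show "(\<omega> \<longlongrightarrow> 0) (at_right 0)" unfolding tendsto_iff
    proof (intro allI impI)
      fix e :: real assume e: "e > 0"
      obtain \<eta> where \<eta>: "\<eta> > 0" "comparable {a..b} K r (1 + e / 2) \<eta>"
        using c\<epsilon>[rule_format, OF half_gt_zero[OF e]] by (elim exE conjE)
      show "\<forall>\<^sub>F \<delta> in at_right 0. dist (\<omega> \<delta>) 0 < e"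
      proof (rule eventually_at_rightI[OF _ \<eta>(1)])
        fix \<delta> assume \<delta>: "\<delta> \<in> {0<..<\<eta>}"
        have "\<omega> \<delta> \<le> e / 2" unfolding \<omega>_def
        proof (rule cSup_least)
          show "T \<delta> \<noteq> {}" using T0 by blast
          fix t assume "t \<in> T \<delta>"
          then consider "t = 0" | s s' x y where "t = q s s' x y" "Q s s' x y" "\<bar>s - s'\<bar> \<le> \<delta>" by (auto simp: T_def)
          then show "t \<le> e / 2"
          proof cases
            case 2
            obtain \<sigma> where \<sigma>: "\<sigma> \<in> J" "F \<sigma> x y < ennreal r" using 2 by (auto simp: Q_def)
            have *: "\<sigma> \<in> {a..b}" "s \<in> {a..b}" "s' \<in> {a..b}" "x \<in> K" using 2 \<sigma> abI(3) by (auto simp: Q_def)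
            have d: "\<bar>s - s'\<bar> < \<eta>" "\<bar>s' - s\<bar> < \<eta>" using 2(3) \<delta> by auto
            have "q s s' x y \<le> ln (1 + e / 2)" unfolding q_def
            proof (intro abs_ln_quotient_le pos[OF 2(2)] pos[OF Qsym[OF 2(2)]])
              show "enn2real (F s x y) \<le> (1 + e / 2) * enn2real (F s' x y)" using \<eta>(2) * d \<sigma> unfolding comparable_def by blast
              show "enn2real (F s' x y) \<le> (1 + e / 2) * enn2real (F s x y)" using \<eta>(2) * d \<sigma> unfolding comparable_def by blast
            qed
            also have "\<dots> \<le> e / 2" using e by (intro ln_add_one_self_le_self) simp
            finally show ?thesis using 2(1) by simp
          qed (use e in simp)
        qed
        then show "dist (\<omega> \<delta>) 0 < e" using \<omega>0[of \<delta>] e by simp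
      qed
    qed
  qed
  show ?thesis
  proof (rule exI[of _ r], intro conjI r, rule exI[of _ \<omega>], intro conjI modulus ballI impI)
    fix s s' x y assume *: "s \<in> J" "s' \<in> J" "x \<in> K" "y \<in> K" "x \<noteq> y \<and> (INF \<sigma>\<in>J. F \<sigma> x y) < ennreal r"
    then obtain \<sigma> where \<sigma>: "\<sigma> \<in> J" "F \<sigma> x y < ennreal r" by (auto simp: INF_less_iff)
    then show "F s x y < \<infinity>" "F s' x y < \<infinity>" using * abI(3) FC(1) by blast+
    have "Q s s' x y" using * \<sigma> by (auto simp: Q_def)
    then have "q s s' x y \<in> T \<bar>s - s'\<bar>" by (auto simp: T_def)
    then show "\<bar>ln (enn2real (F s x y) / enn2real (F s' x y))\<bar> \<le> \<omega> \<bar>s - s'\<bar>"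
      unfolding \<omega>_def q_def[symmetric] by (rule cSup_upper[OF _ bdd])
  qed
qed

lemma product_defined_F:
  assumes "continuous_on (I \<times> UNIV) h" "\<forall>z\<in>I \<times> UNIV. h z > 0"
  shows "product_defined I h F"
proof -
  have "locally_compact_space (euclidean :: 'a topology)"
    unfolding locally_compact_space_def
  proof (intro ballI)
    fix x :: 'a
    obtain W K where "open W" "x \<in> W" "W \<subseteq> K" "compact K"
      using compact_chart_neighbourhood[OF open_UNIV UNIV_I] by metis
    then show "\<exists>U K. openin euclidean U \<and> compactin euclidean K \<and> x \<in> U \<and> U \<subseteq> K"
      by (auto simp: compactin_euclidean_iff)
  qed
  then show ?thesis
    unfolding product_defined_def
    using open_I interval_I assms extended_metric_F generates_topology_induced distances_modulus by blast
qed

end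



section \<open>Absolute continuity in charts\<close>

lemma continuous_on_eventually_interval:
  fixes \<beta> :: "real \<Rightarrow> 'a::topological_space"
  assumes "continuous_on {a..b} \<beta>" "t \<in> {a..b}" "open W" "\<beta> t \<in> W"
  shows "\<exists>\<delta>>0. \<forall>u\<in>{a..b}. \<bar>u - t\<bar> < \<delta> \<longrightarrow> \<beta> u \<in> W"
proof -
  have "(\<beta> \<longlongrightarrow> \<beta> t) (at t within {a..b})" using assms by (simp add: continuous_on)
  then have "\<forall>\<^sub>F u in at t within {a..b}. \<beta> u \<in> W" using assms by (intro topological_tendstoD)
  then obtain \<delta> where "\<delta> > 0" "\<forall>u\<in>{a..b}. u \<noteq> t \<and> dist u t < \<delta> \<longrightarrow> \<beta> u \<in> W" by (auto simp: eventually_at)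
  then show ?thesis using assms(4) by (intro exI[of _ \<delta>]) (auto simp: dist_real_def)
qed

context riemannian_family
begin

lemma abs_continuous_F_continuous:
  assumes s: "s \<in> I" and ac: "abs_continuous (F s) a b \<beta>"
  shows "continuous_on {a..b} \<beta>"
  unfolding continuous_on_topological
proof (intro ballI allI impI)
  fix t U assume t: "t \<in> {a..b}" and U: "open U" "\<beta> t \<in> U"
  obtain r where r: "r > 0" "\<And>y. F s (\<beta> t) y < ennreal r \<Longrightarrow> y \<in> U" 
    by (rule dist_small_imp_mem[OF s U]) blast
  obtain \<delta> where \<delta>: "\<delta> > 0" "\<forall>(K::nat set) u v. disjoint_intervals a b K u v \<longrightarrow> (\<Sum>i\<in>K. v i - u i) < \<delta> \<longrightarrow>
     (\<Sum>i\<in>K. F s (\<beta> (u i)) (\<beta> (v i))) < ennreal r"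
    using abs_continuous_finite_family[OF ac, of "ennreal r", where ?'k=nat] r(1) by auto
  have "\<beta> u \<in> U" if u: "u \<in> {a..b}" "u \<in> ball t \<delta>" for u
  proof (rule r(2))
    have "(\<Sum>i\<in>{0::nat}. F s (\<beta> (min t u)) (\<beta> (max t u))) < ennreal r"
      using t u by (intro \<delta>(2)[rule_format]) (auto simp: disjoint_intervals_def dist_real_def)
    then show "F s (\<beta> t) (\<beta> u) < ennreal r"
      using riemannian_dist_sym[OF riemannian[OF s], of "\<beta> t" "\<beta> u"] by (cases "t \<le> u") auto
  qed
  then show "\<exists>B. open B \<and> t \<in> B \<and> (\<forall>y\<in>{a..b}. y \<in> B \<longrightarrow> \<beta> y \<in> U)"
    using \<delta>(1) by (intro exI[of _ "ball t \<delta>"]) auto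
qed

text \<open>Both implications hold because \<open>F s\<close> and the Euclidean distance in a chart bound each other locally
  up to a constant (\<open>dist_le_displacement\<close>).\<close>

lemma abs_continuous_F_imp_charts:
  assumes s: "s \<in> I" and ac: "abs_continuous (F s) a b \<beta>"
  shows "abs_continuous_in_charts A a b \<beta>"
  unfolding abs_continuous_in_charts_def
proof (intro conjI ballI allI impI)
  show cont: "continuous_on {a..b} \<beta>" by (rule abs_continuous_F_continuous[OF assms])
  fix c u v assume c: "c \<in> A" and uv: "a \<le> u \<and> u \<le> v \<and> v \<le> b \<and> \<beta> ` {u..v} \<subseteq> fst c"
  show "abs_continuous edist u v (snd c \<circ> \<beta>)"
  proof (rule abs_continuous_local[OF edist_triangle])
    show "u \<le> v" using uv by simp
    fix t assume t: "t \<in> {u..v}"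
    then have tc: "\<beta> t \<in> fst c" using uv by auto
    obtain W where W: "open W" "\<beta> t \<in> W" "W \<subseteq> fst c" "convex (snd c ` W)"
      "\<And>x y. x \<in> W \<Longrightarrow> y \<in> W \<Longrightarrow> F s x y \<le> ennreal (2 * N s c (\<beta> t) (snd c y - snd c x)) \<and>
       ennreal (N s c (\<beta> t) (snd c y - snd c x) / 2) \<le> F s x y"
      by (rule dist_le_displacement[OF s c tc]) blast
    obtain m where m: "m > 0" "\<And>w. m * norm w \<le> N s c (\<beta> t) w"
      by (rule form_norm_lower[OF chart_form_family[OF s c tc]]) blast
    obtain \<delta> where \<delta>: "\<delta> > 0" "\<forall>u\<in>{a..b}. \<bar>u - t\<bar> < \<delta> \<longrightarrow> \<beta> u \<in> W"
      using continuous_on_eventually_interval[OF cont _ W(1,2)] t uv by auto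
    show "\<exists>\<delta>>0. \<forall>p q. u \<le> p \<and> p \<le> t \<and> t \<le> q \<and> q \<le> v \<and> q - p < \<delta> \<longrightarrow> abs_continuous edist p q (snd c \<circ> \<beta>)"
    proof (intro exI[of _ \<delta>] conjI \<delta>(1) allI impI)
      fix p q assume pq: "u \<le> p \<and> p \<le> t \<and> t \<le> q \<and> q \<le> v \<and> q - p < \<delta>"
      show "abs_continuous edist p q (snd c \<circ> \<beta>)"
      proof (rule abs_continuous_dominated[OF ac])
        show "a \<le> p" "q \<le> b" using pq uv by auto
        show "2 / m > 0" using m by simp
        fix x y assume xy: "x \<in> {p..q}" "y \<in> {p..q}"
        have xyW: "\<beta> x \<in> W" "\<beta> y \<in> W" using xy pq uv \<delta>(2) by auto
        have "norm (snd c (\<beta> y) - snd c (\<beta> x)) \<le> 2 / m * (N s c (\<beta> t) (snd c (\<beta> y) - snd c (\<beta> x)) / 2)"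
          using m by (simp add: field_simps)
        then have "edist (snd c (\<beta> x)) (snd c (\<beta> y)) \<le> ennreal (2 / m * (N s c (\<beta> t) (snd c (\<beta> y) - snd c (\<beta> x)) / 2))"
          unfolding edist_def by (intro ennreal_leI) (simp add: dist_norm norm_minus_commute)
        also have "\<dots> = ennreal (2 / m) * ennreal (N s c (\<beta> t) (snd c (\<beta> y) - snd c (\<beta> x)) / 2)"
          using m by (intro ennreal_mult') simp
        also have "\<dots> \<le> ennreal (2 / m) * F s (\<beta> x) (\<beta> y)"
          using W(5)[OF xyW] by (intro mult_left_mono) auto
        finally show "edist ((snd c \<circ> \<beta>) x) ((snd c \<circ> \<beta>) y) \<le> ennreal (2 / m) * F s (\<beta> x) (\<beta> y)" by simp
      qed
    qed
  qed
qed

lemma charts_imp_abs_continuous_F: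
  assumes s: "s \<in> I" and ab: "a \<le> b" and ac: "abs_continuous_in_charts A a b \<beta>"
  shows "abs_continuous (F s) a b \<beta>"
proof (rule abs_continuous_local[OF riemannian_dist_triangle[OF riemannian[OF s]] ab])
  fix t assume t: "t \<in> {a..b}"
  have cont: "continuous_on {a..b} \<beta>" using ac by (simp add: abs_continuous_in_charts_def)
  obtain c where c: "c \<in> A" "\<beta> t \<in> fst c" by (rule chart_at)
  obtain W where W: "open W" "\<beta> t \<in> W" "W \<subseteq> fst c" "convex (snd c ` W)"
    "\<And>x y. x \<in> W \<Longrightarrow> y \<in> W \<Longrightarrow> F s x y \<le> ennreal (2 * N s c (\<beta> t) (snd c y - snd c x)) \<and>
     ennreal (N s c (\<beta> t) (snd c y - snd c x) / 2) \<le> F s x y"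
    by (rule dist_le_displacement[OF s c]) blast
  obtain M where M: "M > 0" "\<And>w. N s c (\<beta> t) w \<le> M * norm w"
    by (rule form_norm_upper[OF chart_form_family[OF s c]]) blast
  obtain \<delta> where \<delta>: "\<delta> > 0" "\<forall>u\<in>{a..b}. \<bar>u - t\<bar> < \<delta> \<longrightarrow> \<beta> u \<in> W"
    using continuous_on_eventually_interval[OF cont t W(1,2)] by auto
  show "\<exists>\<delta>>0. \<forall>p q. a \<le> p \<and> p \<le> t \<and> t \<le> q \<and> q \<le> b \<and> q - p < \<delta> \<longrightarrow> abs_continuous (F s) p q \<beta>"
  proof (intro exI[of _ \<delta>] conjI \<delta>(1) allI impI)
    fix p q assume pq: "a \<le> p \<and> p \<le> t \<and> t \<le> q \<and> q \<le> b \<and> q - p < \<delta>"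
    have inW: "\<beta> x \<in> W" if "x \<in> {p..q}" for x using that pq \<delta>(2) by auto
    then have "\<beta> ` {p..q} \<subseteq> fst c" using W(3) by auto
    then have acc: "abs_continuous edist p q (snd c \<circ> \<beta>)"
      using ac c(1) pq unfolding abs_continuous_in_charts_def by auto
    show "abs_continuous (F s) p q \<beta>"
    proof (rule abs_continuous_dominated[OF acc order_refl order_refl])
      show "2 * M > 0" using M by simp
      fix x y assume xy: "x \<in> {p..q}" "y \<in> {p..q}"
      have "F s (\<beta> x) (\<beta> y) \<le> ennreal (2 * N s c (\<beta> t) (snd c (\<beta> y) - snd c (\<beta> x)))"
        using W(5)[OF inW[OF xy(1)] inW[OF xy(2)]] by blast
      also have "\<dots> \<le> ennreal (2 * M * dist (snd c (\<beta> x)) (snd c (\<beta> y)))"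
        using M(2)[of "snd c (\<beta> y) - snd c (\<beta> x)"] by (intro ennreal_leI) (simp add: dist_norm norm_minus_commute)
      also have "\<dots> = ennreal (2 * M) * edist ((snd c \<circ> \<beta>) x) ((snd c \<circ> \<beta>) y)"
        unfolding edist_def comp_def using M(1) by (intro ennreal_mult) auto
      finally show "F s (\<beta> x) (\<beta> y) \<le> ennreal (2 * M) * edist ((snd c \<circ> \<beta>) x) ((snd c \<circ> \<beta>) y)" .
    qed
  qed
qed

section \<open>Metric speed\<close>

lemma has_vector_derivative_quotient:
  fixes f :: "real \<Rightarrow> 'b::real_normed_vector"
  assumes "(f has_vector_derivative D) (at t)"
  shows "((\<lambda>u. (f u - f t) /\<^sub>R (u - t)) \<longlongrightarrow> D) (at t)"
proof (rule LIM_zero_cancel, rule tendsto_norm_zero_cancel)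
  have "((\<lambda>u. norm (f u - f t - (u - t) *\<^sub>R D) / norm (u - t)) \<longlongrightarrow> 0) (at t)"
    using assms by (simp add: has_vector_derivative_def has_derivative_iff_norm)
  then show "((\<lambda>u. norm ((f u - f t) /\<^sub>R (u - t) - D)) \<longlongrightarrow> 0) (at t)"
  proof (rule Lim_transform_eventually)
    show "\<forall>\<^sub>F u in at t. norm (f u - f t - (u - t) *\<^sub>R D) / norm (u - t) = norm ((f u - f t) /\<^sub>R (u - t) - D)"
      unfolding eventually_at_filter
    proof (rule always_eventually, intro allI impI)
      fix u :: real assume "u \<noteq> t"
      then have "(f u - f t) /\<^sub>R (u - t) - D = (f u - f t - (u - t) *\<^sub>R D) /\<^sub>R (u - t)"
        by (simp add: scaleR_diff_right)
      then show "norm (f u - f t - (u - t) *\<^sub>R D) / norm (u - t) = norm ((f u - f t) /\<^sub>R (u - t) - D)"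
        by (simp add: divide_inverse mult.commute)
    qed
  qed
qed

text \<open>The quotient of distances is within the factors \<open>1 - \<epsilon>\<close> and \<open>1 + \<epsilon>\<close> of the norm of the coordinate
  difference quotient, for every \<open>\<epsilon>\<close>. The parameter \<open>s\<close> is arbitrary, while the hypotheses on \<open>t\<close> do not
  mention it.\<close>

lemma metric_speed_eq:
  assumes s: "s \<in> I" and t: "t \<in> {a<..<b}" and c: "c \<in> A" "\<beta> t \<in> fst c" and cont: "isCont \<beta> t"
    and D: "((snd c \<circ> \<beta>) has_vector_derivative D) (at t)"
  shows "metric_speed (F s) a b \<beta> t = N s c (\<beta> t) D"
proof -
  let ?n = "N s c (\<beta> t)"
  have B: "inner_form (chart_form (g s) c (\<beta> t))" by (rule chart_form_family[OF s c])
  have at: "at t within {a..b} = at t" using t by (intro at_within_interior) auto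
  let ?w = "\<lambda>u. ?n ((snd c (\<beta> u) - snd c (\<beta> t)) /\<^sub>R (u - t))"
  let ?q = "\<lambda>u. enn2real (F s (\<beta> u) (\<beta> t)) / \<bar>u - t\<bar>"
  have "((\<lambda>u. (snd c (\<beta> u) - snd c (\<beta> t)) /\<^sub>R (u - t)) \<longlongrightarrow> D) (at t)"
    using has_vector_derivative_quotient[OF D] by simp
  moreover have "isCont ?n D"
    using form_norm_continuous[OF B, of UNIV] by (simp add: continuous_on_eq_continuous_at)
  ultimately have w: "(?w \<longlongrightarrow> ?n D) (at t)" by (rule isCont_tendsto_compose[rotated])
  have n0: "?n v \<ge> 0" for v by (rule form_norm_nonneg[OF B])
  have "(?q \<longlongrightarrow> ?n D) (at t)" unfolding tendsto_iff
  proof (intro allI impI)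
    fix e :: real assume e: "e > 0"
    \<comment> \<open>Half of \<open>e\<close> is left for the convergence of \<open>?w\<close>, which is eventually below \<open>?n D + 1\<close>.\<close>
    define \<epsilon> where "\<epsilon> = min (1/2) (e / (2 * (?n D + 1)))"
    have \<epsilon>: "0 < \<epsilon>" "\<epsilon> < 1" using e n0[of D] by (auto simp: \<epsilon>_def)
    have "\<epsilon> * (?n D + 1) \<le> e / (2 * (?n D + 1)) * (?n D + 1)"
      using n0[of D] by (intro mult_right_mono) (auto simp: \<epsilon>_def)
    also have "\<dots> = e / 2" using n0[of D] by (simp add: field_simps add_nonneg_eq_0_iff)
    finally have \<epsilon>e: "\<epsilon> * (?n D + 1) \<le> e / 2" .
    obtain \<delta> r W K where *: "\<delta> > 0" "r > 0" "open W" "\<beta> t \<in> W"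
      and near: "\<forall>s'\<in>I. \<bar>s' - s\<bar> < \<delta> \<longrightarrow> trapped s' W K r \<and> (\<forall>x\<in>W. \<forall>y\<in>W.
         ennreal ((1 - \<epsilon>) * ?n (snd c y - snd c x)) \<le> F s' x y \<and>
         F s' x y \<le> ennreal ((1 + \<epsilon>) * ?n (snd c y - snd c x)))"
      using local_comparison[OF s c(1) open_UNIV UNIV_I c(2) \<epsilon>] by (elim exE conjE)
    have bounds: "ennreal ((1 - \<epsilon>) * ?n (snd c y - snd c x)) \<le> F s x y \<and>
            F s x y \<le> ennreal ((1 + \<epsilon>) * ?n (snd c y - snd c x))" if "x \<in> W" "y \<in> W" for x y
      using near s *(1) that by auto
    have "\<forall>\<^sub>F u in at t. \<beta> u \<in> W" using cont *(3,4) unfolding isCont_def by (intro topological_tendstoD)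
    moreover have "\<forall>\<^sub>F u in at t. ?w u < ?n D + 1" by (rule order_tendstoD(2)[OF w]) simp
    moreover have "\<forall>\<^sub>F u in at t. dist (?w u) (?n D) < e / 2" by (rule tendstoD[OF w]) (use e in simp)
    moreover have "\<forall>\<^sub>F u in at t. u \<noteq> t" by (simp add: eventually_at_filter)
    ultimately show "\<forall>\<^sub>F u in at t. dist (?q u) (?n D) < e"
    proof eventually_elim
      case (elim u)
      let ?d = "?n (snd c (\<beta> t) - snd c (\<beta> u))"
      have "?d = ?n (snd c (\<beta> u) - snd c (\<beta> t))"
        using form_norm_minus[OF B, of "snd c (\<beta> u) - snd c (\<beta> t)"] by simp
      then have wd: "?w u = ?d / \<bar>u - t\<bar>"
        using elim(4) by (simp add: form_norm_scale[OF B] divide_inverse mult.commute)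
      note b = bounds[OF elim(1) *(4)]
      obtain f where f: "F s (\<beta> u) (\<beta> t) = ennreal f" "f \<ge> 0"
        using b by (cases "F s (\<beta> u) (\<beta> t)") (auto simp: top_unique)
      have "f \<le> (1 + \<epsilon>) * ?d" using b f n0 \<epsilon> by (simp add: ennreal_le_iff)
      moreover have "(1 - \<epsilon>) * ?d \<le> f" using b f by (simp add: ennreal_le_iff)
      ultimately have "\<bar>f - ?d\<bar> \<le> \<epsilon> * ?d" by (simp add: abs_le_iff algebra_simps)
      then have "\<bar>f - ?d\<bar> / \<bar>u - t\<bar> \<le> \<epsilon> * ?d / \<bar>u - t\<bar>" by (rule divide_right_mono) simp
      then have "\<bar>?q u - ?w u\<bar> \<le> \<epsilon> * ?w u"
        unfolding wd f(1) using f(2) by (simp flip: diff_divide_distrib)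
      also have "\<dots> \<le> \<epsilon> * (?n D + 1)" using elim(2) \<epsilon> by (intro mult_left_mono) auto
      also have "\<dots> \<le> e / 2" by (rule \<epsilon>e)
      finally show "dist (?q u) (?n D) < e" using elim(3) unfolding dist_real_def by linarith
    qed
  qed
  then show ?thesis unfolding metric_speed_def at by (intro tendsto_Lim) auto
qed


text \<open>At a Lebesgue point of the coordinate velocity the averages of the metric speed converge. The
  exceptional set does not depend on the parameter \<open>s\<close>, which is what allows \<open>s\<close> to vary with the
  point of the curve.\<close>

lemma gen_metric_speed_eq:
  assumes s: "s \<in> I" and c: "c \<in> A" and pq: "a \<le> p" "q \<le> b" and inc: "\<beta> ` {p..q} \<subseteq> fst c"
    and cont: "continuous_on {p..q} \<beta>"
    and G: "G absolutely_integrable_on UNIV"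
    and deriv: "AE u in lebesgue. u \<in> {p..q} \<longrightarrow> ((snd c \<circ> \<beta>) has_vector_derivative G u) (at u)"
    and t: "t \<in> {p<..<q}"
    and lp: "((\<lambda>h. integral {t - h..t + h} (\<lambda>u. norm (G u - G t)) / h) \<longlongrightarrow> 0) (at_right 0)"
  shows "gen_metric_speed (F s) a b \<beta> t = ereal (N s c (\<beta> t) (G t))"
proof -
  let ?n = "N s c (\<beta> t)" and ?f = "metric_speed (F s) a b \<beta>"
  \<comment> \<open>Unlike the metric speed, its almost everywhere equal version \<open>\<phi>\<close> is visibly measurable and can be
      estimated at every point.\<close>
  define \<phi> where "\<phi> u = N s c (\<beta> u) (G u)" for u
  have tc: "\<beta> t \<in> fst c" using inc t by auto
  have B: "inner_form (chart_form (g s) c (\<beta> t))" by (rule chart_form_family[OF s c tc])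
  have n0: "?n v \<ge> 0" for v by (rule form_norm_nonneg[OF B])
  have Gabs: "G absolutely_integrable_on {x..y}" for x y
    by (rule set_integrable_subset[OF G]) auto
  have Gint: "(\<lambda>u. norm (G u - v)) integrable_on {x..y}" for x y v
  proof -
    have "(\<lambda>u. G u - v) absolutely_integrable_on {x..y}"
      by (intro set_integral_diff(1) Gabs) (auto simp: absolutely_integrable_on_const)
    then show ?thesis by (auto simp: absolutely_integrable_on_def)
  qed
  obtain Z where Z: "Z \<in> null_sets lebesgue" "{u. \<not> (u \<in> {p..q} \<longrightarrow> ((snd c \<circ> \<beta>) has_vector_derivative G u) (at u))} \<subseteq> Z"
    using deriv by (auto simp: eventually_ae_filter)
  have negZ: "negligible Z" using Z(1) by (simp add: negligible_iff_null_sets)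
  have f\<phi>: "?f u = \<phi> u" if u: "u \<in> {p<..<q}" "u \<notin> Z" for u
  proof -
    have "isCont \<beta> u" using cont u(1) by (intro continuous_on_interior[of "{p..q}"]) auto
    moreover have "((snd c \<circ> \<beta>) has_vector_derivative G u) (at u)" using subsetD[OF Z(2), of u] u by auto
    ultimately show ?thesis
      unfolding \<phi>_def using u pq inc by (intro metric_speed_eq s c) auto
  qed
  have meas: "\<phi> \<in> borel_measurable (lebesgue_on {p..q})"
  proof -
    have co: "(\<lambda>u. metric_coeff A (g s) c i j (\<beta> u)) \<in> borel_measurable (lebesgue_on {p..q})"
      if "i \<in> Basis" "j \<in> Basis" for i j
    proof (rule continuous_imp_measurable_on_sets_lebesgue)
      have "continuous_on (fst c) (metric_coeff A (g s) c i j)"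
        using riemannian[OF s] c that unfolding riemannian_metric_def by blast
      then show "continuous_on {p..q} (\<lambda>u. metric_coeff A (g s) c i j (\<beta> u))"
        by (rule continuous_on_compose2[OF _ cont inc])
    qed simp
    have Gm: "G \<in> borel_measurable (lebesgue_on {p..q})"
      by (rule absolutely_integrable_measurable[THEN iffD1, THEN conjunct1, OF _ Gabs]) simp
    have Gi: "(\<lambda>u. G u \<bullet> i) \<in> borel_measurable (lebesgue_on {p..q})" for i
      using Gm by (rule borel_measurable_inner) simp
    have "(\<lambda>u. sqrt (\<Sum>i\<in>Basis. \<Sum>j\<in>Basis. (G u \<bullet> i) * (G u \<bullet> j) * metric_coeff A (g s) c i j (\<beta> u)))
        \<in> borel_measurable (lebesgue_on {p..q})"
      by (rule measurable_compose[OF _ borel_measurable_sqrt], intro borel_measurable_sum borel_measurable_times co Gi)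
    then show ?thesis
    proof (rule measurable_cong[THEN iffD1, rotated])
      fix u assume "u \<in> space (lebesgue_on {p..q})"
      then have "\<beta> u \<in> fst c" using inc by auto
      show "sqrt (\<Sum>i\<in>Basis. \<Sum>j\<in>Basis. (G u \<bullet> i) * (G u \<bullet> j) * metric_coeff A (g s) c i j (\<beta> u)) = \<phi> u"
        unfolding \<phi>_def form_norm_def chart_form_expand[OF riemannian[OF s] c \<open>\<beta> u \<in> fst c\<close>] ..
    qed
  qed
  let ?osc = "\<lambda>h. integral {t - h..t + h} (\<lambda>u. norm (G u - G t))"
  obtain M where M: "M > 0" "\<And>v. ?n v \<le> M * norm v" by (rule form_norm_upper[OF B]) blast
  let ?Av = "\<lambda>\<delta>. 1 / \<delta> * (LINT u=t..t + \<delta>|lebesgue. ?f u)"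
  have "(?Av \<longlongrightarrow> ?n (G t)) (at 0)"
    unfolding tendsto_iff
  proof (intro allI impI)
    fix e :: real assume e: "e > 0"
    define \<epsilon> where "\<epsilon> = min (1/2) (e / (2 * (?n (G t) + 1)))"
    have \<epsilon>: "0 < \<epsilon>" "\<epsilon> < 1" using e n0[of "G t"] by (auto simp: \<epsilon>_def)
    have "\<epsilon> * (?n (G t) + 1) \<le> e / (2 * (?n (G t) + 1)) * (?n (G t) + 1)"
      using n0[of "G t"] by (intro mult_right_mono) (auto simp: \<epsilon>_def)
    also have "\<dots> = e / 2" using n0[of "G t"] by (simp add: field_simps add_nonneg_eq_0_iff)
    finally have \<epsilon>e: "\<epsilon> * ?n (G t) < e / 2" using \<epsilon>(1) by (simp add: distrib_left)
    obtain \<delta>0 W where \<delta>0: "\<delta>0 > 0" and W: "open W" "\<beta> t \<in> W" "W \<subseteq> fst c" and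
      near: "\<forall>s'\<in>I. \<bar>s' - s\<bar> < \<delta>0 \<longrightarrow> (\<forall>p\<in>W. \<forall>v. (1 - \<epsilon>) * ?n v \<le> N s' c p v \<and> N s' c p v \<le> (1 + \<epsilon>) * ?n v)"
      using chart_norm_near[OF s c tc \<epsilon>(1)] by (elim exE conjE)
    have nearW: "(1 - \<epsilon>) * ?n v \<le> N s c x v \<and> N s c x v \<le> (1 + \<epsilon>) * ?n v" if "x \<in> W" for x v
      using near[rule_format, OF s] \<delta>0 that by auto
    obtain r1 where r1: "r1 > 0" "\<forall>u\<in>{p..q}. \<bar>u - t\<bar> < r1 \<longrightarrow> \<beta> u \<in> W"
      using continuous_on_eventually_interval[OF cont _ W(1,2)] t by auto
    define r where "r = min r1 (min (t - p) (q - t))"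
    have r: "r > 0" using r1 t by (auto simp: r_def)
    have pt: "u \<in> {p<..<q}" "\<beta> u \<in> W" if "\<bar>u - t\<bar> < r" for u
      using that r1(2) by (auto simp: r_def abs_less_iff)
    have \<phi>bd: "\<bar>\<phi> u - ?n (G t)\<bar> \<le> \<epsilon> * ?n (G t) + 2 * M * norm (G u - G t)" if u: "\<bar>u - t\<bar> < r" for u
    proof -
      note nw = nearW[OF pt(2)[OF u], of "G u"]
      have 1: "\<bar>\<phi> u - ?n (G u)\<bar> \<le> \<epsilon> * ?n (G u)"
        unfolding \<phi>_def abs_le_iff using nw by (simp add: algebra_simps)
      have 2: "\<bar>?n (G u) - ?n (G t)\<bar> \<le> M * norm (G u - G t)"
        using form_norm_triangle_diff[OF B, of "G u" "G t"] M(2)[of "G u - G t"] by linarith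
      have "\<epsilon> * ?n (G u) \<le> \<epsilon> * (?n (G t) + M * norm (G u - G t))"
        using 2 \<epsilon> by (intro mult_left_mono) auto
      moreover have "\<epsilon> * (M * norm (G u - G t)) \<le> 1 * (M * norm (G u - G t))"
        using \<epsilon> M by (intro mult_right_mono) auto
      ultimately show ?thesis using 1 2 by (simp add: distrib_left)
    qed
    have "\<forall>\<^sub>F h in at_right 0. ?osc h / h < e / (4 * M)"
      using order_tendstoD(2)[OF lp, of "e / (4 * M)"] e M by simp
    then obtain r2 where r2: "r2 > 0" "\<And>h. 0 < h \<Longrightarrow> h < r2 \<Longrightarrow> ?osc h / h < e / (4 * M)"
      unfolding eventually_at_right_field by auto
    have "dist (?Av \<delta>) (?n (G t)) < e" if \<delta>: "\<delta> \<noteq> 0" "\<bar>\<delta>\<bar> < min r r2" for \<delta>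
    proof -
      define x y where "x = min t (t + \<delta>)" and "y = max t (t + \<delta>)"
      have xy: "y - x = \<bar>\<delta>\<bar>" "x < y" using \<delta>(1) by (auto simp: x_def y_def)
      have in_r: "\<bar>u - t\<bar> < r" if "u \<in> {x..y}" for u
        using that \<delta>(2) by (auto simp: x_def y_def min_def max_def split: if_splits)
      have sub: "{x..y} \<subseteq> {p..q}" using pt(1) in_r by fastforce
      let ?b = "\<lambda>u. \<epsilon> * ?n (G t) + 2 * M * norm (G u - G t)"
      have Mint: "(\<lambda>u. 2 * M * norm (G u - G t)) integrable_on {x..y}"
        using has_integral_mult_right[OF integrable_integral[OF Gint]] by blast
      have bint: "?b integrable_on {x..y}"
        by (intro integrable_add integrable_const_ivl Mint)
      have \<phi>abs: "\<phi> absolutely_integrable_on {x..y}"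
      proof (rule measurable_bounded_by_integrable_imp_absolutely_integrable)
        show "\<phi> \<in> borel_measurable (lebesgue_on {x..y})"
          using measurable_restrict_mono[OF meas sub] .
        show "(\<lambda>u. ?n (G t) + ?b u) integrable_on {x..y}"
          by (intro integrable_add integrable_const_ivl bint)
        show "norm (\<phi> u) \<le> ?n (G t) + ?b u" if "u \<in> {x..y}" for u
          using \<phi>bd[OF in_r[OF that]] n0[of "G t"] by simp
      qed simp
      have eq: "?f u = \<phi> u" if "u \<in> {x..y} - Z" for u
        using that f\<phi> pt(1)[OF in_r] by blast
      have fabs: "?f absolutely_integrable_on {x..y}"
        by (rule absolutely_integrable_spike[OF \<phi>abs negZ eq])
      then have fabs': "?f absolutely_integrable_on {x<..<y}"
        by (rule set_integrable_subset) auto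
      have "?Av \<delta> = 1 / \<bar>\<delta>\<bar> * (LINT u:{x<..<y}|lebesgue. ?f u)"
        using \<delta>(1) by (cases "\<delta> > 0") (auto simp: interval_lebesgue_integral_def x_def y_def)
      also have "(LINT u:{x<..<y}|lebesgue. ?f u) = integral {x..y} ?f"
        using set_lebesgue_integral_eq_integral(2)[OF fabs'] by (simp add: integral_open_interval_real)
      also have "\<dots> = integral {x..y} \<phi>"
        by (rule integral_spike[OF negZ]) (use eq in auto)
      finally have Av: "?Av \<delta> = integral {x..y} \<phi> / \<bar>\<delta>\<bar>" by simp
      have \<phi>int: "\<phi> integrable_on {x..y}" using \<phi>abs by (simp add: absolutely_integrable_on_def)
      have "integral {x..y} (\<lambda>u. \<phi> u - ?n (G t)) = integral {x..y} \<phi> - \<bar>\<delta>\<bar> * ?n (G t)"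
        using xy by (subst Henstock_Kurzweil_Integration.integral_diff) (auto simp: \<phi>int)
      then have "\<bar>integral {x..y} \<phi> - \<bar>\<delta>\<bar> * ?n (G t)\<bar> = norm (integral {x..y} (\<lambda>u. \<phi> u - ?n (G t)))" by simp
      also have "\<dots> \<le> integral {x..y} ?b"
        by (rule integral_norm_bound_integral) (use \<phi>bd in_r \<phi>int bint in \<open>auto intro!: integrable_diff\<close>)
      also have "\<dots> = \<bar>\<delta>\<bar> * (\<epsilon> * ?n (G t)) + 2 * M * integral {x..y} (\<lambda>u. norm (G u - G t))"
        using xy Mint by (subst Henstock_Kurzweil_Integration.integral_add) auto
      also have "integral {x..y} (\<lambda>u. norm (G u - G t)) \<le> ?osc \<bar>\<delta>\<bar>"
        by (intro integral_subset_le Gint) (auto simp: x_def y_def)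
      finally have "\<bar>integral {x..y} \<phi> - \<bar>\<delta>\<bar> * ?n (G t)\<bar> \<le>
          \<bar>\<delta>\<bar> * (\<epsilon> * ?n (G t)) + 2 * M * ?osc \<bar>\<delta>\<bar>"
        using M(1) by simp
      then have "\<bar>integral {x..y} \<phi> - \<bar>\<delta>\<bar> * ?n (G t)\<bar> / \<bar>\<delta>\<bar> \<le>
          (\<bar>\<delta>\<bar> * (\<epsilon> * ?n (G t)) + 2 * M * ?osc \<bar>\<delta>\<bar>) / \<bar>\<delta>\<bar>"
        by (intro divide_right_mono) auto
      also have "\<dots> = \<epsilon> * ?n (G t) + 2 * M * (?osc \<bar>\<delta>\<bar> / \<bar>\<delta>\<bar>)"
        using \<delta>(1) by (simp add: add_divide_distrib)
      also have "\<dots> < e / 2 + 2 * M * (e / (4 * M))"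
        using \<epsilon>e r2(2)[of "\<bar>\<delta>\<bar>"] \<delta> M(1) by (intro add_strict_mono mult_strict_left_mono) auto
      also have "\<dots> = e" using M(1) by simp
      also have "\<bar>integral {x..y} \<phi> - \<bar>\<delta>\<bar> * ?n (G t)\<bar> / \<bar>\<delta>\<bar> = \<bar>integral {x..y} \<phi> / \<bar>\<delta>\<bar> - ?n (G t)\<bar>"
      proof -
        have "integral {x..y} \<phi> / \<bar>\<delta>\<bar> - ?n (G t) = (integral {x..y} \<phi> - \<bar>\<delta>\<bar> * ?n (G t)) / \<bar>\<delta>\<bar>"
          using \<delta>(1) by (simp add: diff_divide_distrib)
        then show ?thesis by simp
      qed
      finally show ?thesis unfolding Av dist_real_def .
    qed
    then show "\<forall>\<^sub>F \<delta> in at 0. dist (?Av \<delta>) (?n (G t)) < e"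
      unfolding eventually_at using r r2(1) by (intro exI[of _ "min r r2"]) auto
  qed
  then have "((\<lambda>\<delta>. ereal (?Av \<delta>)) \<longlongrightarrow> ereal (?n (G t))) (at 0)" by simp
  then show ?thesis
    unfolding gen_metric_speed_def by (intro lim_imp_Limsup) auto
qed

text \<open>The quantifier over \<open>s\<close> is inside the almost everywhere quantifier. The statement is local in \<open>t\<close>, so
  a single chart may be assumed.\<close>

lemma gen_metric_speed_AE:
  assumes ab: "a \<le> b" and ac: "abs_continuous_in_charts A a b \<beta>"
  shows "AE t in lebesgue. t \<in> {a..b} \<longrightarrow> (\<forall>s\<in>I.
    velocity A \<beta> t \<in> tangent_space A (\<beta> t) \<and>
    gen_metric_speed (F s) a b \<beta> t = ereal (vnorm s (\<beta> t) (velocity A \<beta> t)))"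
proof -
  define good where "good t \<longleftrightarrow> (\<forall>s\<in>I. velocity A \<beta> t \<in> tangent_space A (\<beta> t) \<and>
    gen_metric_speed (F s) a b \<beta> t = ereal (vnorm s (\<beta> t) (velocity A \<beta> t)))" for t
  define P where "P p q \<longleftrightarrow> (a \<le> p \<and> p \<le> q \<and> q \<le> b \<longrightarrow> (AE t in lebesgue. t \<in> {p..q} \<longrightarrow> good t))" for p q
  have cont: "continuous_on {a..b} \<beta>" using ac by (simp add: abs_continuous_in_charts_def)
  have "P a b" using ab
  proof (induction rule: Bolzano)
    case (trans p q r)
    show ?case unfolding P_def
    proof
      assume "a \<le> p \<and> p \<le> r \<and> r \<le> b"
      then have "AE t in lebesgue. t \<in> {p..q} \<longrightarrow> good t" "AE t in lebesgue. t \<in> {q..r} \<longrightarrow> good t"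
        using trans by (auto simp: P_def)
      then show "AE t in lebesgue. t \<in> {p..r} \<longrightarrow> good t"
        by eventually_elim auto
    qed
  next
    case (local t0)
    then have t0: "t0 \<in> {a..b}" by simp
    obtain c where c: "c \<in> A" "\<beta> t0 \<in> fst c" by (rule chart_at)
    obtain \<delta> where \<delta>: "\<delta> > 0" "\<forall>u\<in>{a..b}. \<bar>u - t0\<bar> < \<delta> \<longrightarrow> \<beta> u \<in> fst c"
      using continuous_on_eventually_interval[OF cont t0 open_chart[OF c(1)] c(2)] by auto
    have "P p q" if pq: "p \<le> t0 \<and> t0 \<le> q \<and> q - p < \<delta>" for p q
      unfolding P_def
    proof
      assume ap: "a \<le> p \<and> p \<le> q \<and> q \<le> b"
      have inc: "\<beta> ` {p..q} \<subseteq> fst c" using \<delta>(2) pq ap by auto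
      show "AE t in lebesgue. t \<in> {p..q} \<longrightarrow> good t"
      proof (cases "p < q")
        case True
        have "abs_continuous edist p q (snd c \<circ> \<beta>)"
          using ac c(1) ap inc unfolding abs_continuous_in_charts_def by blast
        then obtain G where G: "G absolutely_integrable_on UNIV"
          and lp: "AE t in lebesgue. t \<in> {p..q} \<longrightarrow> t \<in> {p<..<q} \<and> ((snd c \<circ> \<beta>) has_vector_derivative G t) (at t) \<and>
            ((\<lambda>h. integral {t - h..t + h} (\<lambda>u. norm (G u - G t)) / h) \<longlongrightarrow> 0) (at_right 0)"
          by (rule abs_continuous_lebesgue_points[OF True])
        have deriv: "AE t in lebesgue. t \<in> {p..q} \<longrightarrow> ((snd c \<circ> \<beta>) has_vector_derivative G t) (at t)"
          using lp by eventually_elim blast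
        have contpq: "continuous_on {p..q} \<beta>" by (rule continuous_on_subset[OF cont]) (use ap in auto)
        show ?thesis using lp
        proof eventually_elim
          case (elim t)
          show ?case
          proof
            assume tpq: "t \<in> {p..q}"
            with elim have t: "t \<in> {p<..<q}" "((snd c \<circ> \<beta>) has_vector_derivative G t) (at t)"
              "((\<lambda>h. integral {t - h..t + h} (\<lambda>u. norm (G u - G t)) / h) \<longlongrightarrow> 0) (at_right 0)" by auto
            have tc: "\<beta> t \<in> fst c" using inc tpq by auto
            have "isCont \<beta> t" using contpq t(1) by (intro continuous_on_interior[of "{p..q}"]) auto
            then have v: "velocity A \<beta> t = coord_vector A (\<beta> t) c (G t)"
              by (intro velocity_eq_coord_vector c(1) tc t(2))
            have vT: "velocity A \<beta> t \<in> tangent_space A (\<beta> t)"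
              unfolding v by (rule coord_vector_in_tangent_space[OF c(1) tc])
            show "good t" unfolding good_def
            proof (intro ballI conjI vT)
              fix s assume s: "s \<in> I"
              have "gen_metric_speed (F s) a b \<beta> t = ereal (N s c (\<beta> t) (G t))"
                using ap by (intro gen_metric_speed_eq[OF s c(1) _ _ inc contpq G deriv t(1,3)]) auto
              also have "N s c (\<beta> t) (G t) = vnorm s (\<beta> t) (velocity A \<beta> t)"
                using vnorm_chart[OF c(1) tc vT, of s] v c(1) tc by simp
              finally show "gen_metric_speed (F s) a b \<beta> t = ereal (vnorm s (\<beta> t) (velocity A \<beta> t))" .
            qed
          qed
        qed
      next
        case False
        have "AE t in lebesgue. t \<noteq> p" by (intro AE_completion AE_lborel_singleton)
        then show ?thesis by eventually_elim (use False in auto)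
      qed
    qed
    then show ?case using \<delta>(1) by (intro exI[of _ \<delta>]) blast
  qed
  then show ?thesis using ab by (simp add: P_def good_def)
qed

section \<open>The two causal structures\<close>

lemma product_curve_iff: "product_curve I F a b \<gamma> \<longleftrightarrow> spacetime_curve A I a b \<gamma>"
proof -
  have "(\<forall>s\<in>I. abs_continuous (F s) a b (snd \<circ> \<gamma>)) \<longleftrightarrow> abs_continuous_in_charts A a b (snd \<circ> \<gamma>)"
    if "a < b" "\<gamma> ` {a..b} \<subseteq> I \<times> UNIV"
  proof
    assume *: "\<forall>s\<in>I. abs_continuous (F s) a b (snd \<circ> \<gamma>)"
    have "fst (\<gamma> a) \<in> I" using that by force
    with * show "abs_continuous_in_charts A a b (snd \<circ> \<gamma>)" using abs_continuous_F_imp_charts by blast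
  next
    assume "abs_continuous_in_charts A a b (snd \<circ> \<gamma>)"
    then show "\<forall>s\<in>I. abs_continuous (F s) a b (snd \<circ> \<gamma>)"
      using that(1) by (intro ballI charts_imp_abs_continuous_F) auto
  qed
  then show ?thesis unfolding product_curve_def spacetime_curve_def by blast
qed

lemma speed_sq_AE:
  assumes \<gamma>: "spacetime_curve A I a b \<gamma>"
  shows "AE t in lebesgue_on {a..b}. product_speed_sq h F a b \<gamma> t =
    ereal (- lorentz_form h g (\<gamma> t) (spacetime_velocity A \<gamma> t) (spacetime_velocity A \<gamma> t))"
proof -
  have ab: "a \<le> b" "abs_continuous_in_charts A a b (snd \<circ> \<gamma>)" and in_I: "\<And>t. t \<in> {a..b} \<Longrightarrow> fst (\<gamma> t) \<in> I"
    using \<gamma> by (force simp: spacetime_curve_def)+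
  have "AE t in lebesgue. t \<in> {a..b} \<longrightarrow> product_speed_sq h F a b \<gamma> t =
    ereal (- lorentz_form h g (\<gamma> t) (spacetime_velocity A \<gamma> t) (spacetime_velocity A \<gamma> t))"
    using gen_metric_speed_AE[OF ab]
  proof eventually_elim
    case (elim t)
    show ?case
    proof
      assume t: "t \<in> {a..b}"
      let ?s = "fst (\<gamma> t)" and ?V = "velocity A (snd \<circ> \<gamma>) t"
      have V: "?V \<in> tangent_space A (snd (\<gamma> t))"
        and sp: "gen_metric_speed (F ?s) a b (snd \<circ> \<gamma>) t = ereal (vnorm ?s (snd (\<gamma> t)) ?V)"
        using elim t in_I[OF t] by (auto simp: comp_def)
      have "(vnorm ?s (snd (\<gamma> t)) ?V)\<^sup>2 = g ?s (snd (\<gamma> t)) ?V ?V"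
        using vnorm_nonneg[OF in_I[OF t] V] by simp
      then show "product_speed_sq h F a b \<gamma> t =
        ereal (- lorentz_form h g (\<gamma> t) (spacetime_velocity A \<gamma> t) (spacetime_velocity A \<gamma> t))"
        by (simp add: product_speed_sq_def sp lorentz_form_def spacetime_velocity_def power2_eq_square)
    qed
  qed
  then show ?thesis by (subst AE_restrict_space_iff) auto
qed

lemma continuous_lorentzian_metric_form:
  assumes h: "continuous_on (I \<times> UNIV) h" "\<forall>z\<in>I \<times> UNIV. h z > 0"
  shows "continuous_lorentzian_metric A I (lorentz_form h g)"
  unfolding continuous_lorentzian_metric_def Let_def
proof (intro conjI ballI allI)
  fix s p assume s: "s \<in> I"
  let ?T = "UNIV \<times> tangent_space A p"
  note gs = riemannian[OF s]
  fix U V W :: "real \<times> ('a, 'e) tangent" and k assume T: "U \<in> ?T" "V \<in> ?T" "W \<in> ?T"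
  show "lorentz_form h g (s, p) V W = lorentz_form h g (s, p) W V"
    using riemannian_metric_tangent(1)[OF gs, of "snd U" p "snd V" "snd W"] T by (auto simp: lorentz_form_def mult.commute)
  show "lorentz_form h g (s, p) (k * fst U + fst V, \<lambda>c. k *\<^sub>R snd U c + snd V c) W =
      k * lorentz_form h g (s, p) U W + lorentz_form h g (s, p) V W"
    using riemannian_metric_tangent(2)[OF gs, of "snd U" p "snd V" "snd W" k] T
    by (auto simp: lorentz_form_def algebra_simps)
next
  fix s p assume s: "s \<in> I"
  let ?T = "UNIV \<times> tangent_space A p"
  note gs = riemannian[OF s]
  have hp: "h (s, p) > 0" using h(2) s by auto
  have zero: "g s p (\<lambda>_. 0) V = 0" if "V \<in> tangent_space A p" for V by (rule riemannian_metric_zero[OF gs that])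
  show "\<exists>N\<in>?T. lorentz_form h g (s, p) N N < 0 \<and>
       (\<forall>V\<in>?T. lorentz_form h g (s, p) N V = 0 \<and> V \<noteq> (0, \<lambda>_. 0) \<longrightarrow> lorentz_form h g (s, p) V V > 0)"
  proof (rule bexI[of _ "(1, \<lambda>_. 0)"], intro conjI ballI impI)
    show "lorentz_form h g (s, p) (1, \<lambda>_. 0) (1, \<lambda>_. 0) < 0"
      using hp zero[OF tangent_space_0] by (simp add: lorentz_form_def)
    fix V assume V: "V \<in> ?T" "lorentz_form h g (s, p) (1, \<lambda>_. 0) V = 0 \<and> V \<noteq> (0, \<lambda>_. 0)"
    then have VT: "snd V \<in> tangent_space A p" by auto
    have f0: "fst V = 0" using V(2) zero[OF VT] hp by (simp add: lorentz_form_def)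
    then have "snd V \<noteq> (\<lambda>_. 0)" using V(2) by (metis prod.collapse)
    then have "g s p (snd V) (snd V) > 0" by (rule riemannian_metric_tangent(3)[OF gs VT VT VT])
    then show "lorentz_form h g (s, p) V V > 0" using f0 by (simp add: lorentz_form_def)
  qed (use tangent_space_0 in auto)
next
  fix c and E E' :: "real \<times> 'e" assume c: "c \<in> A" and E: "E \<in> Basis" "E' \<in> Basis"
  have hc: "continuous_on (I \<times> fst c) h" by (rule continuous_on_subset[OF h(1)]) auto
  have "continuous_on (I \<times> fst c) (\<lambda>z. chart_form (g (fst z)) c (snd z) (snd E) (snd E'))"
  proof (cases "snd E \<in> Basis \<and> snd E' \<in> Basis")
    case True
    then show ?thesis using joint c unfolding jointly_continuous_family_def metric_coeff_chart_form
      by (auto simp: case_prod_unfold)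
  next
    case False
    then have "snd E = 0 \<or> snd E' = 0" using E by (auto simp: Basis_prod_def)
    then have z: "chart_form (g (fst z)) c (snd z) (snd E) (snd E') = 0" if "z \<in> I \<times> fst c" for z
      using inner_form_bilinear[OF chart_form_family[of "fst z" c "snd z"]] that c
      by (auto simp: bilinear_lzero bilinear_rzero)
    show ?thesis by (rule continuous_on_eq[OF continuous_on_const[of _ 0]]) (simp add: z)
  qed
  then show "continuous_on (I \<times> fst c) (\<lambda>z. lorentz_form h g z (fst E, coord_vector A (snd z) c (snd E)) (fst E', coord_vector A (snd z) c (snd E')))"
    unfolding lorentz_form_def chart_form_def by (auto intro!: continuous_intros hc)
qed

end

theorem corollary1p1:
  fixes A :: "('a::{t2_space,second_countable_topology}, 'e::euclidean_space) chart set"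
    and I :: "real set"
    and h :: "real \<times> 'a \<Rightarrow> real"
    and g :: "real \<Rightarrow> 'a \<Rightarrow> ('a, 'e) tangent \<Rightarrow> ('a, 'e) tangent \<Rightarrow> real"
  assumes "smooth_atlas A"
    and "open I" and "is_interval I"
    and "continuous_on (I \<times> UNIV) h" and "\<forall>z\<in>I \<times> UNIV. h z > 0"
    and "\<forall>s\<in>I. riemannian_metric A (g s)"
    and "jointly_continuous_family A I g"
  defines "F \<equiv> \<lambda>s. riemannian_dist A (g s)"
  defines "P \<equiv> generalized_product I h F"
    and "L \<equiv> induced_structure A I (lorentz_form h g)"
  shows
    "product_defined I h F \<and>
     continuous_lorentzian_metric A I (lorentz_form h g) \<and>
     (\<forall>a b \<gamma>. future_causal P a b \<gamma> \<longleftrightarrow> future_causal L a b \<gamma>) \<and>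
     (\<forall>a b \<gamma>. past_causal P a b \<gamma> \<longleftrightarrow> past_causal L a b \<gamma>) \<and>
     (\<forall>a b \<gamma>. future_timelike P a b \<gamma> \<longleftrightarrow> future_timelike L a b \<gamma>) \<and>
     (\<forall>a b \<gamma>. past_timelike P a b \<gamma> \<longleftrightarrow> past_timelike L a b \<gamma>) \<and>
     (\<forall>a b \<gamma>. future_causal P a b \<gamma> \<or> past_causal P a b \<gamma> \<longrightarrow>
        lorentzian_length P a b \<gamma> = lorentzian_length L a b \<gamma>) \<and>
     (\<forall>p\<in>I \<times> UNIV. \<forall>q\<in>I \<times> UNIV. causal_le P p q \<longleftrightarrow> causal_le L p q) \<and>
     (\<forall>p\<in>I \<times> UNIV. \<forall>q\<in>I \<times> UNIV. timelike_ll P p q \<longleftrightarrow> timelike_ll L p q) \<and>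
     (\<forall>p\<in>I \<times> UNIV. \<forall>q\<in>I \<times> UNIV. time_separation P p q = time_separation L p q)"
proof -
  interpret riemannian_family A I g
    by unfold_locales (use assms in auto)
  have curve: "curve P a b \<gamma> \<longleftrightarrow> curve L a b \<gamma>" for a b \<gamma>
    by (simp add: P_def L_def generalized_product_def induced_structure_def F_def product_curve_iff)
  have speed: "AE t in lebesgue_on {a..b}. speed_sq P a b \<gamma> t = speed_sq L a b \<gamma> t" if "curve L a b \<gamma>" for a b \<gamma>
    using speed_sq_AE[of a b \<gamma> h] that
    by (simp add: P_def L_def generalized_product_def induced_structure_def F_def)
  have cong: "(AE t in lebesgue_on {a..b}. R (speed_sq P a b \<gamma> t)) \<longleftrightarrow> (AE t in lebesgue_on {a..b}. R (speed_sq L a b \<gamma> t))"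
    if "curve L a b \<gamma>" for a b \<gamma> R
  proof
    assume "AE t in lebesgue_on {a..b}. R (speed_sq P a b \<gamma> t)"
    with speed[OF that] show "AE t in lebesgue_on {a..b}. R (speed_sq L a b \<gamma> t)"
      by eventually_elim simp
  next
    assume "AE t in lebesgue_on {a..b}. R (speed_sq L a b \<gamma> t)"
    with speed[OF that] show "AE t in lebesgue_on {a..b}. R (speed_sq P a b \<gamma> t)"
      by eventually_elim simp
  qed
  have fc: "future_causal P a b \<gamma> \<longleftrightarrow> future_causal L a b \<gamma>" for a b \<gamma>
    unfolding future_causal_def curve using cong[of a b \<gamma> "\<lambda>x. x \<ge> 0"] by blast
  have pc: "past_causal P a b \<gamma> \<longleftrightarrow> past_causal L a b \<gamma>" for a b \<gamma>
    unfolding past_causal_def curve using cong[of a b \<gamma> "\<lambda>x. x \<ge> 0"] by blast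
  have ft: "future_timelike P a b \<gamma> \<longleftrightarrow> future_timelike L a b \<gamma>" for a b \<gamma>
    unfolding future_timelike_def curve using cong[of a b \<gamma> "\<lambda>x. x > 0"] by blast
  have pt: "past_timelike P a b \<gamma> \<longleftrightarrow> past_timelike L a b \<gamma>" for a b \<gamma>
    unfolding past_timelike_def curve using cong[of a b \<gamma> "\<lambda>x. x > 0"] by blast
  have len: "lorentzian_length P a b \<gamma> = lorentzian_length L a b \<gamma>" if "curve L a b \<gamma>" for a b \<gamma>
    unfolding lorentzian_length_def
    by (rule nn_integral_cong_AE) (use speed[OF that] in \<open>eventually_elim; simp\<close>)
  have sep: "time_separation P p q = time_separation L p q" for p q
    unfolding time_separation_def fc
    by (rule SUP_cong) (auto intro!: len simp: future_causal_def)
  have pd: "product_defined I h F" unfolding F_def by (rule product_defined_F) fact+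
  have lm: "continuous_lorentzian_metric A I (lorentz_form h g)" by (rule continuous_lorentzian_metric_form) fact+
  have len': "lorentzian_length P a b \<gamma> = lorentzian_length L a b \<gamma>" if "future_causal P a b \<gamma> \<or> past_causal P a b \<gamma>" for a b \<gamma>
    using that by (intro len) (auto simp: future_causal_def past_causal_def curve)
  show ?thesis
    using pd lm len' by (simp add: fc pc ft pt sep causal_le_def timelike_ll_def)
qed

end
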